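(* Let $k$ be a field, $S = k[x_1,\ldots,x_n]$ with $n\ge 1$, and $I \subset S$ a proper homogeneous ideal, $d = \dim S/I$. Assume that $c_i(I) < \infty$ for $i = 0,\ldots,d-1$. Then $$\operatorname{reg}(S/I) = \max\{c_0(I),\ldots,c_{d-1}(I),r(I)\}.$$
   Context: $S$ is standard graded. If $0\to F_p\to\cdots\to F_1\to F_0\to S/I\to 0$ is a graded minimal free resolution of $S/I$ over $S$ and $b_i$ is the maximum degree of the generators of $F_i$, the Castelnuovo-Mumford regularity is $\operatorname{reg}(S/I) := \max\{b_i-i \mid i=0,\ldots,p\}$. $\operatorname{in}(I)$ denotes the initial ideal of $I$ with respect to the (degree) reverse lexicographic order with $x_1>\cdots>x_n$. For $0\le i\le d$ put $S_i = k[x_1,\ldots,x_{n-i}]$. Let $J_i\subset S_i$ be the ideal obtained from $\operatorname{in}(I)$ by the evaluation $x_{n-i+1}=\cdots=x_n=0$; i.e. $J_i$ is generated by the monomial generators of $\operatorname{in}(I)$ not divisible by any of $x_{n-i+1},\ldots,x_n$. For $0\le i\le d-1$ let $\tilde J_i\subset S_i$ be the ideal of $S_i$ generated by the monomials obtained from those of $J_i$ by setting $x_{n-i}=1$ (so $J_i\subseteq\tilde J_i$). Define $c_i(I) := \sup\{r \mid (\tilde J_i/J_i)_r \neq 0\}$, with $c_i(I)=-\infty$ if $\tilde J_i=J_i$ (the value $\infty$ is allowed), and $r(I) := \sup\{r \mid (S_d/J_d)_r\neq 0\}$. *)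

theory Defs
  imports
    "HOL-Algebra.QuotRing"
    "HOL-Algebra.Module"
    "HOL-Library.Poly_Mapping"
    "HOL-Library.Extended_Nat"
    "HOL-Library.Extended_Real"
begin

section \<open>The polynomial ring in the variables \<open>x\<^sub>1, \<dots>, x\<^sub>n\<close>\<close>

text \<open>
  A monomial is an exponent function \<open>nat \<Rightarrow>\<^sub>0 nat\<close>; a polynomial is a finitely supported
  function from monomials to the field. All polynomial rings in finitely many variables live in the
  same type, so that the ring in \<open>m \<le> n\<close> variables is a subset of the ring in \<open>n\<close> variables.
  The variable with index \<open>0\<close> is never used.
\<close>

type_synonym monom = "nat \<Rightarrow>\<^sub>0 nat"
type_synonym 'k mpol = "monom \<Rightarrow>\<^sub>0 'k"

definition mdeg :: "monom \<Rightarrow> nat" where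
  "mdeg t = (\<Sum>i\<in>Poly_Mapping.keys t. Poly_Mapping.lookup t i)"

definition xmon :: "monom \<Rightarrow> 'k::field mpol" where
  "xmon t = Poly_Mapping.single t 1"

definition poly_ring :: "nat \<Rightarrow> 'k::field mpol ring" where
  "poly_ring n =
     \<lparr>carrier = {f. \<forall>t\<in>Poly_Mapping.keys f. Poly_Mapping.keys t \<subseteq> {1..n}},
      monoid.mult = (*), one = 1, zero = 0, add = (+)\<rparr>"

lemma cring_poly_ring: "cring (poly_ring n :: 'k::field mpol ring)"
proof -
  let ?C = "carrier (poly_ring n :: 'k mpol ring)"
  have add: "f + g \<in> ?C" if "f \<in> ?C" "g \<in> ?C" for f g
    using that Poly_Mapping.keys_add[of f g] unfolding poly_ring_def by (simp, blast)
  have mult: "f * g \<in> ?C" if f: "f \<in> ?C" and g: "g \<in> ?C" for f g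
  proof -
    have "Poly_Mapping.keys t \<subseteq> {1..n}" if t: "t \<in> Poly_Mapping.keys (f * g)" for t
    proof -
      obtain a b where "t = a + b" "a \<in> Poly_Mapping.keys f" "b \<in> Poly_Mapping.keys g"
        using t keys_mult[of f g] by blast
      moreover from this have "Poly_Mapping.keys a \<subseteq> {1..n}" "Poly_Mapping.keys b \<subseteq> {1..n}"
        using f g by (simp_all add: poly_ring_def)
      ultimately show ?thesis
        using Poly_Mapping.keys_add[of a b] by blast
    qed
    then show ?thesis
      by (simp add: poly_ring_def)
  qed
  have neg: "- f \<in> ?C" if "f \<in> ?C" for f
    using that by (simp add: poly_ring_def)
  have one: "1 \<in> ?C" and zero: "0 \<in> ?C"
    by (simp_all add: poly_ring_def)
  have ops: "x \<oplus>\<^bsub>poly_ring n\<^esub> y = x + y" "x \<otimes>\<^bsub>poly_ring n\<^esub> y = x * y"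
    "\<zero>\<^bsub>poly_ring n\<^esub> = 0" "\<one>\<^bsub>poly_ring n\<^esub> = 1" for x y :: "'k mpol"
    by (simp_all add: poly_ring_def)
  show ?thesis
  proof (rule cringI)
    show "abelian_group (poly_ring n :: 'k mpol ring)"
    proof (rule abelian_groupI; unfold ops)
      show "\<exists>g\<in>?C. g + f = 0" if "f \<in> ?C" for f
        using neg[OF that] by (intro bexI[of _ "- f"]) simp_all
    qed (simp_all add: add zero add.assoc add.commute)
    show "Group.comm_monoid (poly_ring n :: 'k mpol ring)"
    proof (rule comm_monoidI; unfold ops)
    qed (simp_all add: mult one mult.assoc mult.commute)
  qed (simp add: ops distrib_right)
qed

text \<open>The degree is an integer because of the shifts in graded free modules; the zero polynomial
  is homogeneous of every degree.\<close>

definition homog :: "int \<Rightarrow> 'k::field mpol \<Rightarrow> bool" where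
  "homog e f \<longleftrightarrow> (\<forall>t\<in>Poly_Mapping.keys f. int (mdeg t) = e)"

definition homogeneous_ideal :: "nat \<Rightarrow> 'k::field mpol set \<Rightarrow> bool" where
  "homogeneous_ideal n I \<longleftrightarrow>
     (\<exists>G. G \<subseteq> carrier (poly_ring n) \<and> (\<forall>g\<in>G. \<exists>e. homog e g) \<and>
          I = genideal (poly_ring n) G)"

definition irrelevant_ideal :: "nat \<Rightarrow> 'k::field mpol set" where
  "irrelevant_ideal n =
     genideal (poly_ring n) ((\<lambda>i. xmon (Poly_Mapping.single i 1)) ` {1..n})"


section \<open>Krull dimension\<close>

definition krull_dim :: "('a, 'b) ring_scheme \<Rightarrow> enat" where
  "krull_dim R = Sup {enat m | m.
     \<exists>P :: nat \<Rightarrow> 'a set. (\<forall>i\<le>m. primeideal (P i) R) \<and> (\<forall>i<m. P i \<subset> P (Suc i))}"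


section \<open>Graded free resolutions and Castelnuovo--Mumford regularity\<close>

definition linear_map ::
  "('a, 'r) ring_scheme \<Rightarrow> ('a, 'b, 'm) module_scheme \<Rightarrow> ('a, 'c, 'n) module_scheme \<Rightarrow>
   ('b \<Rightarrow> 'c) \<Rightarrow> bool" where
  "linear_map R M N f \<longleftrightarrow>
     f \<in> carrier M \<rightarrow> carrier N \<and>
     (\<forall>u\<in>carrier M. \<forall>v\<in>carrier M. f (u \<oplus>\<^bsub>M\<^esub> v) = f u \<oplus>\<^bsub>N\<^esub> f v) \<and>
     (\<forall>s\<in>carrier R. \<forall>v\<in>carrier M. f (s \<odot>\<^bsub>M\<^esub> v) = s \<odot>\<^bsub>N\<^esub> f v)"

text \<open>
  The free module of rank \<open>b\<close>: vectors with entries \<open>0, \<dots>, b - 1\<close>, extended by zero. The fields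
  \<open>monoid.mult\<close> and \<open>one\<close> belong to the record type of modules but carry no meaning there.
\<close>

type_synonym 'k vect = "nat \<Rightarrow> 'k mpol"

definition free_module :: "nat \<Rightarrow> nat \<Rightarrow> ('k::field mpol, 'k vect) module" where
  "free_module n b =
     \<lparr>carrier = {v. (\<forall>j<b. v j \<in> carrier (poly_ring n)) \<and> (\<forall>j\<ge>b. v j = 0)},
      monoid.mult = undefined, one = undefined,
      zero = (\<lambda>_. 0), add = (\<lambda>u v j. u j + v j), smult = (\<lambda>s v j. s * v j)\<rparr>"

text \<open>Degree \<open>e\<close> part of the direct sum of the \<open>S(- a j)\<close> for \<open>j < b\<close>, that is, the \<open>j\<close>-th basis
  vector has degree \<open>a j\<close>.\<close>

definition free_part :: "nat \<Rightarrow> nat \<Rightarrow> (nat \<Rightarrow> int) \<Rightarrow> int \<Rightarrow> 'k::field vect set" where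
  "free_part n b a e = {v \<in> carrier (free_module n b). \<forall>j<b. homog (e - a j) (v j)}"

definition quot_module :: "nat \<Rightarrow> 'k::field mpol set \<Rightarrow> ('k mpol, 'k mpol set) module" where
  "quot_module n I =
     ring.extend (poly_ring n Quot I)
       \<lparr>smult = (\<lambda>s C. (I +>\<^bsub>poly_ring n\<^esub> s) \<otimes>\<^bsub>poly_ring n Quot I\<^esub> C)\<rparr>"

definition quot_part :: "nat \<Rightarrow> 'k::field mpol set \<Rightarrow> int \<Rightarrow> 'k mpol set set" where
  "quot_part n I e =
     (\<lambda>f. I +>\<^bsub>poly_ring n\<^esub> f) ` {f \<in> carrier (poly_ring n). homog e f}"

text \<open>
  Data of a complex \<open>0 \<rightarrow> F\<^sub>p \<rightarrow> \<dots> \<rightarrow> F\<^sub>1 \<rightarrow> F\<^sub>0 \<rightarrow> S/I \<rightarrow> 0\<close>: its length \<open>p\<close>, the ranks of the \<open>F\<^sub>i\<close>, the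
  degrees of their basis vectors, the maps \<open>F\<^sub>i \<rightarrow> F\<^sub>i\<^sub>-\<^sub>1\<close> for \<open>1 \<le> i \<le> p\<close>, and the map
  \<open>F\<^sub>0 \<rightarrow> S/I\<close>. The values of the fields at other indices are irrelevant.
\<close>

record (overloaded) 'k graded_complex =
  len :: nat
  rk :: "nat \<Rightarrow> nat"
  gdeg :: "nat \<Rightarrow> nat \<Rightarrow> int"
  diff :: "nat \<Rightarrow> 'k vect \<Rightarrow> 'k vect"
  aug :: "'k vect \<Rightarrow> 'k mpol set"

abbreviation cmod :: "nat \<Rightarrow> 'k::field graded_complex \<Rightarrow> nat \<Rightarrow> ('k mpol, 'k vect) module" where
  "cmod n F i \<equiv> free_module n (rk F i)"

abbreviation cpart :: "nat \<Rightarrow> 'k::field graded_complex \<Rightarrow> nat \<Rightarrow> int \<Rightarrow> 'k vect set" where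
  "cpart n F i e \<equiv> free_part n (rk F i) (gdeg F i) e"

text \<open>The image of \<open>F\<^sub>i \<rightarrow> F\<^sub>i\<^sub>-\<^sub>1\<close>, which is zero for \<open>i = p + 1\<close>.\<close>

definition boundaries :: "nat \<Rightarrow> 'k::field graded_complex \<Rightarrow> nat \<Rightarrow> 'k vect set" where
  "boundaries n F i = (if i \<le> len F then diff F i ` carrier (cmod n F i) else {\<lambda>_. 0})"

text \<open>The modules \<open>F\<^sub>0, \<dots>, F\<^sub>p\<close> are required to be nonzero, so that the maximal degree of
  their generators makes sense.\<close>

definition graded_free_resolution ::
  "nat \<Rightarrow> 'k::field mpol set \<Rightarrow> 'k graded_complex \<Rightarrow> bool" where
  "graded_free_resolution n I F \<longleftrightarrow>
     (\<forall>i\<le>len F. 0 < rk F i) \<and>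
     linear_map (poly_ring n) (cmod n F 0) (quot_module n I) (aug F) \<and>
     (\<forall>e. aug F ` cpart n F 0 e \<subseteq> quot_part n I e) \<and>
     (\<forall>i\<in>{1..len F}.
        linear_map (poly_ring n) (cmod n F i) (cmod n F (i - 1)) (diff F i) \<and>
        (\<forall>e. diff F i ` cpart n F i e \<subseteq> cpart n F (i - 1) e)) \<and>
     aug F ` carrier (cmod n F 0) = carrier (quot_module n I) \<and>
     a_kernel (cmod n F 0) (quot_module n I) (aug F) = boundaries n F 1 \<and>
     (\<forall>i\<in>{1..len F}. a_kernel (cmod n F i) (cmod n F (i - 1)) (diff F i) = boundaries n F (Suc i))"

definition minimal_graded_free_resolution ::
  "nat \<Rightarrow> 'k::field mpol set \<Rightarrow> 'k graded_complex \<Rightarrow> bool" where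
  "minimal_graded_free_resolution n I F \<longleftrightarrow>
     graded_free_resolution n I F \<and>
     (\<forall>i\<in>{1..len F}. \<forall>v\<in>carrier (cmod n F i). \<forall>j<rk F (i - 1). diff F i v j \<in> irrelevant_ideal n)"

definition max_gen_degree :: "'k graded_complex \<Rightarrow> nat \<Rightarrow> int" where
  "max_gen_degree F i = Max (gdeg F i ` {..<rk F i})"

definition res_regularity :: "'k graded_complex \<Rightarrow> int" where
  "res_regularity F = Max ((\<lambda>i. max_gen_degree F i - int i) ` {..len F})"

definition cm_regularity :: "nat \<Rightarrow> 'k::field mpol set \<Rightarrow> int" where
  "cm_regularity n I =
     (THE r. \<exists>F. minimal_graded_free_resolution n I F \<and> r = res_regularity F)"


section \<open>Initial ideals for the degree reverse lexicographic order\<close>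

text \<open>\<open>u < v\<close> if \<open>u\<close> has smaller degree, or the degrees agree and the last nonzero entry of
  \<open>v - u\<close> is negative. In particular \<open>x\<^sub>1 > x\<^sub>2 > \<dots> > x\<^sub>n\<close>.\<close>

definition drl_less :: "monom \<Rightarrow> monom \<Rightarrow> bool" where
  "drl_less u v \<longleftrightarrow>
     mdeg u < mdeg v \<or>
     mdeg u = mdeg v \<and>
     (\<exists>i. Poly_Mapping.lookup v i < Poly_Mapping.lookup u i \<and>
          (\<forall>j>i. Poly_Mapping.lookup u j = Poly_Mapping.lookup v j))"

definition lead_monom :: "'k::field mpol \<Rightarrow> monom" where
  "lead_monom f =
     (THE t. t \<in> Poly_Mapping.keys f \<and> (\<forall>u\<in>Poly_Mapping.keys f. u \<noteq> t \<longrightarrow> drl_less u t))"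

definition initial_ideal :: "nat \<Rightarrow> 'k::field mpol set \<Rightarrow> 'k mpol set" where
  "initial_ideal n I = genideal (poly_ring n) {xmon (lead_monom f) | f. f \<in> I \<and> f \<noteq> 0}"


section \<open>The invariants \<open>c\<^sub>i(I)\<close> and \<open>r(I)\<close>\<close>

text \<open>Evaluation of a polynomial at \<open>x\<^sub>j = 0\<close> for all \<open>j > m\<close>.\<close>

definition eval_zero_above :: "nat \<Rightarrow> 'k::field mpol \<Rightarrow> 'k mpol" where
  "eval_zero_above m f =
     (\<Sum>t\<in>{t \<in> Poly_Mapping.keys f. Poly_Mapping.keys t \<subseteq> {..m}}.
        Poly_Mapping.single t (Poly_Mapping.lookup f t))"

text \<open>An ideal of \<open>poly_ring (n - i)\<close>.\<close>

definition J_ideal :: "nat \<Rightarrow> 'k::field mpol set \<Rightarrow> nat \<Rightarrow> 'k mpol set" where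
  "J_ideal n I i = eval_zero_above (n - i) ` initial_ideal n I"

text \<open>Updating an exponent to \<open>0\<close> is setting the variable to \<open>1\<close> in the monomial.\<close>

definition J_tilde :: "nat \<Rightarrow> 'k::field mpol set \<Rightarrow> nat \<Rightarrow> 'k mpol set" where
  "J_tilde n I i =
     genideal (poly_ring (n - i))
       {xmon (Poly_Mapping.update (n - i) 0 t) | t. xmon t \<in> J_ideal n I i}"

text \<open>The supremum of all \<open>r\<close> with \<open>(A/B)\<^sub>r \<noteq> 0\<close> for homogeneous ideals \<open>B \<subseteq> A\<close>; it is \<open>-\<infinity>\<close> if there
  are none.\<close>

definition top_degree :: "'k::field mpol set \<Rightarrow> 'k mpol set \<Rightarrow> ereal" where
  "top_degree A B = Sup {ereal (real r) | r :: nat. \<exists>f\<in>A. homog (int r) f \<and> f \<notin> B}"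

definition c_inv :: "nat \<Rightarrow> 'k::field mpol set \<Rightarrow> nat \<Rightarrow> ereal" where
  "c_inv n I i = top_degree (J_tilde n I i) (J_ideal n I i)"

definition r_inv :: "nat \<Rightarrow> 'k::field mpol set \<Rightarrow> nat \<Rightarrow> ereal" where
  "r_inv n I d = top_degree (carrier (poly_ring (n - d))) (J_ideal n I d)"

end

(*
  Let F be a minimal graded free resolution of S/I. Reduce F successively modulo x_n, x_{n-1}, ..., x_1.
  If N is the homology of the complex at some stage and x is the next variable, the homology at the next
  stage is an extension of the kernel of x on N, shifted by one place and one degree, by N / x N. A class of
  top degree is killed by x, so the supremum of (degree - place) over all homology never drops: it only
  picks up, while place 0 is not of finite length, the top degree of the kernel of x on S/(I, x_n, ..., x_{m+1}),
  x = x_m, and once S/(I, x_n, ..., x_{m+1}) has finite length it includes the top degree of that module.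
  After the last stage the complex is F tensored with k; its differential vanishes by minimality, and the
  supremum is the regularity.

  By the properties of the reverse lexicographic order these kernels and quotients live in the same degrees as
  those for in(I), which gives c_i and r. The dimension enters only through the finiteness of r: otherwise
  the filter-regular variables would give a chain of primes over I that is too long.
*)

theory Submission
  imports Defs "HOL-Library.Function_Algebras"
begin

section \<open>Monomials and polynomials\<close>

text \<open>Suprema are compared through bounds: for every integer m, "all generator degrees minus
  places are at most m" is shown equivalent to "all \<open>c_i\<close> and \<open>r\<close> are at
  most m". Only the set of degrees with nonzero homology is tracked, and the values \<infinity> and
  -\<infinity> are treated uniformly. The obstacle is that a class of top degree exists only when
  degrees are bounded above, while place 0 may be unbounded before stage d. The places from 1 on are
  therefore bounded alone up to stage d; their only input from place 0 are the kernels of x, which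
  are bounded because \<open>c_i\<close> is finite. Place 0 joins at stage d, once the dimension has
  bounded it. The \<open>c_i\<close> are defined by a saturation, the homological argument by the
  kernel of a single x. Both have the same supremum of degrees: multiply a monomial by the last
  power of x that keeps it outside \<open>in(I)\<close>. Regularity is defined as the unique value
  attained by minimal resolutions. Existence of one is proved by constructing minimal covers;
  uniqueness of the value comes from the formula, whose right-hand side does not mention the
  resolution.\<close>

abbreviation "coef \<equiv> Poly_Mapping.lookup"
abbreviation "supp \<equiv> Poly_Mapping.keys"
abbreviation Pol :: "nat \<Rightarrow> 'k::field mpol set" where "Pol m \<equiv> carrier (poly_ring m)"

definition monoms :: "nat \<Rightarrow> monom set" where
  "monoms m = {t. supp t \<subseteq> {1..m}}"

definition evar :: "nat \<Rightarrow> monom" where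
  "evar i = Poly_Mapping.single i 1"

abbreviation xvar :: "nat \<Rightarrow> 'k::field mpol" where "xvar i \<equiv> xmon (evar i)"

lemma Pol_iff: "f \<in> Pol m \<longleftrightarrow> supp f \<subseteq> monoms m"
  by (auto simp: poly_ring_def monoms_def)

lemma poly_ring_ops [simp]:
  "x \<oplus>\<^bsub>poly_ring n\<^esub> y = x + y" "x \<otimes>\<^bsub>poly_ring n\<^esub> y = x * y"
  "\<zero>\<^bsub>poly_ring n\<^esub> = 0" "\<one>\<^bsub>poly_ring n\<^esub> = 1"
  by (simp_all add: poly_ring_def)

lemma monoms_zero [simp]: "0 \<in> monoms m"
  by (simp add: monoms_def)

lemma supp_add_monom: "supp (s + t :: monom) = supp s \<union> supp t"
  by (auto simp: in_keys_iff lookup_add)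

lemma monoms_add_iff [simp]: "s + t \<in> monoms m \<longleftrightarrow> s \<in> monoms m \<and> t \<in> monoms m"
  by (auto simp: monoms_def supp_add_monom)

lemma monoms_mono: "m \<le> m' \<Longrightarrow> monoms m \<subseteq> monoms m'"
  by (auto simp: monoms_def)

lemma evar_in_monoms [simp]: "evar i \<in> monoms m \<longleftrightarrow> 1 \<le> i \<and> i \<le> m"
  by (auto simp: monoms_def evar_def)

lemma monoms_atMost: "t \<in> monoms n \<Longrightarrow> m \<le> n \<Longrightarrow> supp t \<subseteq> {..m} \<longleftrightarrow> t \<in> monoms m"
  by (auto simp: monoms_def subset_iff)

lemma Pol_zero [simp]: "0 \<in> Pol m"
  by (simp add: Pol_iff)

lemma Pol_one [simp]: "1 \<in> Pol m"
  by (simp add: Pol_iff)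

lemma Pol_add [simp]: "f \<in> Pol m \<Longrightarrow> g \<in> Pol m \<Longrightarrow> f + g \<in> Pol m"
  using Poly_Mapping.keys_add[of f g] by (auto simp: Pol_iff)

lemma Pol_uminus [simp]: "- f \<in> Pol m \<longleftrightarrow> f \<in> Pol m" for f :: "'k::field mpol"
  by (simp add: Pol_iff)

lemma Pol_diff [simp]: "f \<in> Pol m \<Longrightarrow> g \<in> Pol m \<Longrightarrow> f - g \<in> Pol m"
  using Pol_add[of f m "- g"] by simp

lemma Pol_mult [simp]: "f \<in> Pol m \<Longrightarrow> g \<in> Pol m \<Longrightarrow> f * g \<in> Pol m"
  using cring.cring_simprules(5)[OF cring_poly_ring, of f m g] by simp

lemma Pol_power [simp]: "f \<in> Pol m \<Longrightarrow> f ^ k \<in> Pol m"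
  by (induction k) auto

lemma Pol_single: "c \<noteq> 0 \<Longrightarrow> Poly_Mapping.single t c \<in> Pol m \<longleftrightarrow> t \<in> monoms m"
  by (simp add: Pol_iff)

lemma Pol_singleI [simp]: "t \<in> monoms m \<Longrightarrow> Poly_Mapping.single t c \<in> Pol m"
  by (simp add: Pol_iff)

lemma Pol_xmon [simp]: "(xmon t :: 'k::field mpol) \<in> Pol m \<longleftrightarrow> t \<in> monoms m"
  by (simp add: xmon_def Pol_single)

lemma Pol_mono: "m \<le> m' \<Longrightarrow> f \<in> Pol m \<Longrightarrow> f \<in> Pol m'"
  using monoms_mono by (auto simp: Pol_iff)

lemma supp_xmon [simp]: "supp (xmon t :: 'k::field mpol) = {t}"
  by (simp add: xmon_def)

lemma xmon_add: "xmon (s + t) = xmon s * (xmon t :: 'k::field mpol)"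
  by (simp add: xmon_def mult_single)

lemma xmon_0 [simp]: "xmon 0 = (1 :: 'k::field mpol)"
  by (simp add: xmon_def)

lemma single_eq_xmon: "Poly_Mapping.single t c = Poly_Mapping.single 0 c * (xmon t :: 'k::field mpol)"
  by (simp add: xmon_def mult_single)

lemma mpol_expand: "f = (\<Sum>t\<in>supp f. Poly_Mapping.single t (coef f t))" for f :: "'k::field mpol"
proof (rule poly_mapping_eqI)
  fix s
  show "coef f s = coef (\<Sum>t\<in>supp f. Poly_Mapping.single t (coef f t)) s"
    by (simp add: lookup_sum lookup_single when_def in_keys_iff)
qed

lemma coef_monom_mult_add: "coef (Poly_Mapping.single u c * f) (u + t) = c * coef f t"
  for f :: "'k::field mpol"
proof -
  have "coef ((\<Sum>s\<in>supp f. Poly_Mapping.single (u + s) (c * coef f s))) (u + t) = c * coef f t"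
    by (simp add: lookup_sum lookup_single when_def in_keys_iff)
  moreover have "Poly_Mapping.single u c * f = (\<Sum>s\<in>supp f. Poly_Mapping.single (u + s) (c * coef f s))"
    by (subst mpol_expand) (simp add: sum_distrib_left mult_single)
  ultimately show ?thesis by simp
qed

lemma supp_monom_mult_subset: "supp (Poly_Mapping.single u c * f) \<subseteq> (+) u ` supp f"
  for f :: "'k::field mpol"
  using keys_mult[of "Poly_Mapping.single u c" f] by (auto split: if_splits)

lemma supp_monom_mult: "c \<noteq> 0 \<Longrightarrow> supp (Poly_Mapping.single u c * f) = (+) u ` supp f"
  for f :: "'k::field mpol"
  using supp_monom_mult_subset[of u c f]
  by (auto simp: in_keys_iff coef_monom_mult_add)

lemma supp_xmon_mult: "supp (xmon u * f) = (+) u ` supp f" for f :: "'k::field mpol"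
  by (simp add: xmon_def supp_monom_mult)

lemma xmon_mult_in_Pol: "xmon u * f \<in> Pol m \<Longrightarrow> f \<in> Pol m" for f :: "'k::field mpol"
  by (auto simp: Pol_iff supp_xmon_mult)

lemma coef_mult_0: "coef (f * g) 0 = coef f 0 * coef g 0" for f g :: "'k::field mpol"
proof -
  have *: "coef (Poly_Mapping.single t c * g) 0 = (if t = 0 then c else 0) * coef g 0" for t and c :: 'k
  proof (cases "t = 0")
    case True
    then show ?thesis using coef_monom_mult_add[of 0 c g 0] by simp
  next
    case False
    have "0 \<notin> supp (Poly_Mapping.single t c * g)"
    proof
      assume "0 \<in> supp (Poly_Mapping.single t c * g)"
      then obtain s where "t + s = 0" using supp_monom_mult_subset by fastforce
      then have "supp t = {}" using supp_add_monom[of t s] by simp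
      then show False using False by simp
    qed
    then show ?thesis using False by (simp add: in_keys_iff)
  qed
  have "f * g = (\<Sum>t\<in>supp f. Poly_Mapping.single t (coef f t) * g)"
    by (subst mpol_expand[of f]) (simp add: sum_distrib_right)
  then have "coef (f * g) 0 = (\<Sum>t\<in>supp f. (if t = 0 then coef f t else 0) * coef g 0)"
    by (simp add: lookup_sum *)
  also have "\<dots> = (\<Sum>t\<in>supp f. if t = 0 then coef f 0 * coef g 0 else 0)"
    by (rule sum.cong) auto
  also have "\<dots> = coef f 0 * coef g 0"
    by (simp add: in_keys_iff)
  finally show ?thesis .
qed

lemma mdeg_superset: "finite A \<Longrightarrow> supp t \<subseteq> A \<Longrightarrow> mdeg t = (\<Sum>i\<in>A. coef t i)"
  unfolding mdeg_def by (rule sum.mono_neutral_left) (auto simp: in_keys_iff)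

lemma mdeg_add [simp]: "mdeg (s + t) = mdeg s + mdeg t"
proof -
  have "mdeg u = (\<Sum>i\<in>supp s \<union> supp t. coef u i)" if "u \<in> {s, t, s + t}" for u
    using that by (intro mdeg_superset) (auto simp: supp_add_monom)
  then show ?thesis by (simp add: lookup_add sum.distrib)
qed

lemma mdeg_0 [simp]: "mdeg 0 = 0"
  by (simp add: mdeg_def)

lemma mdeg_evar [simp]: "mdeg (evar i) = 1"
  by (simp add: mdeg_def evar_def)

lemma mdeg_single [simp]: "mdeg (Poly_Mapping.single i k) = k"
  by (simp add: mdeg_def)

lemma coef_le_mdeg: "coef t i \<le> mdeg t"
  by (cases "i \<in> supp t") (auto simp: mdeg_def in_keys_iff intro: member_le_sum)

lemma mdeg_eq_0_iff [simp]: "mdeg t = 0 \<longleftrightarrow> t = 0"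
proof
  assume "mdeg t = 0"
  then have "coef t i = 0" for i using coef_le_mdeg[of t i] by simp
  then show "t = 0" by (intro poly_mapping_eqI) simp
qed simp

lemma finite_monoms_mdeg_le: "finite {t \<in> monoms m. mdeg t \<le> D}"
proof (induction m)
  case 0
  have "{t \<in> monoms 0. mdeg t \<le> D} \<subseteq> {0}" by (auto simp: monoms_def)
  then show ?case by (rule finite_subset) simp
next
  case (Suc m)
  have "t \<in> (\<lambda>(s, k). s + Poly_Mapping.single (Suc m) k) ` ({t \<in> monoms m. mdeg t \<le> D} \<times> {..D})"
    if t: "t \<in> monoms (Suc m)" "mdeg t \<le> D" for t
  proof -
    define s where "s = Poly_Mapping.update (Suc m) 0 t"
    have e: "t = s + Poly_Mapping.single (Suc m) (coef t (Suc m))"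
      by (rule poly_mapping_eqI) (auto simp: s_def lookup_add lookup_update lookup_single when_def)
    have "s \<in> monoms m"
      using t(1) by (auto simp: monoms_def s_def keys_update le_Suc_eq)
    moreover have "mdeg s \<le> D" using e t(2) mdeg_add[of s] by (metis le_add1 le_trans)
    moreover have "coef t (Suc m) \<le> D" using coef_le_mdeg t(2) le_trans by blast
    ultimately show ?thesis using e by (intro image_eqI[of _ _ "(s, coef t (Suc m))"]) auto
  qed
  then have "{t \<in> monoms (Suc m). mdeg t \<le> D} \<subseteq>
      (\<lambda>(s, k). s + Poly_Mapping.single (Suc m) k) ` ({t \<in> monoms m. mdeg t \<le> D} \<times> {..D})"
    by blast
  then show ?case by (rule finite_subset) (use Suc in blast)
qed

lemma monom_split: "i \<in> supp t \<Longrightarrow> \<exists>s. t = evar i + s"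
  by (rule exI[of _ "Poly_Mapping.update i (coef t i - 1) t"], rule poly_mapping_eqI)
     (auto simp: evar_def lookup_add lookup_update lookup_single when_def in_keys_iff)

lemma homogD: "homog e f \<Longrightarrow> t \<in> supp f \<Longrightarrow> int (mdeg t) = e"
  by (simp add: homog_def)

lemma homog_zero [simp]: "homog e 0"
  by (simp add: homog_def)

lemma homog_add: "homog e f \<Longrightarrow> homog e g \<Longrightarrow> homog e (f + g)"
  using Poly_Mapping.keys_add[of f g] by (auto simp: homog_def)

lemma homog_uminus [simp]: "homog e (- f) \<longleftrightarrow> homog e f" for f :: "'k::field mpol"
  by (simp add: homog_def)

lemma homog_diff: "homog e f \<Longrightarrow> homog e g \<Longrightarrow> homog e (f - g)"
  using homog_add[of e f "- g"] by simp

lemma homog_mult: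
  assumes "homog d f" "homog e g"
  shows "homog (d + e) (f * g)"
  unfolding homog_def
proof
  fix t assume "t \<in> supp (f * g)"
  then obtain a b where "t = a + b" "a \<in> supp f" "b \<in> supp g" using keys_mult by blast
  with assms show "int (mdeg t) = d + e" by (auto simp: homog_def)
qed

lemma homog_single: "homog e (Poly_Mapping.single t c) \<longleftrightarrow> c = 0 \<or> int (mdeg t) = e"
  by (simp add: homog_def)

lemma homog_xmon [simp]: "homog e (xmon t :: 'k::field mpol) \<longleftrightarrow> int (mdeg t) = e"
  by (simp add: homog_def)

lemma homog_neg: "homog e f \<Longrightarrow> e < 0 \<Longrightarrow> f = 0" for f :: "'k::field mpol"
  using keys_eq_empty[of f] by (force simp: homog_def)

section \<open>Restriction to a set of monomials, and homogeneous components\<close>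

definition restr :: "monom set \<Rightarrow> 'k::field mpol \<Rightarrow> 'k mpol" where
  "restr A f = (\<Sum>t\<in>supp f \<inter> A. Poly_Mapping.single t (coef f t))"

lemma coef_restr: "coef (restr A f) t = (if t \<in> A then coef f t else 0)"
  by (simp add: restr_def lookup_sum lookup_single when_def in_keys_iff)

lemma supp_restr [simp]: "supp (restr A f) = supp f \<inter> A"
  by (auto simp: in_keys_iff coef_restr split: if_splits)

lemma restr_add: "restr A (f + g) = restr A f + restr A g"
  by (rule poly_mapping_eqI) (simp add: coef_restr lookup_add)

lemma restr_diff: "restr A (f - g) = restr A f - restr A g"
  by (rule poly_mapping_eqI) (simp add: coef_restr lookup_minus)

lemma restr_0 [simp]: "restr A 0 = 0"
  by (simp add: restr_def)

lemma restr_Compl: "restr A f + restr (- A) f = f"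
  by (rule poly_mapping_eqI) (simp add: coef_restr lookup_add)

lemma restr_id: "supp f \<subseteq> A \<Longrightarrow> restr A f = f"
  by (rule poly_mapping_eqI) (auto simp: coef_restr in_keys_iff)

lemma restr_eq_0_iff: "restr A f = 0 \<longleftrightarrow> supp f \<inter> A = {}"
  by (metis keys_eq_empty keys_zero supp_restr)

lemma restr_Pol [simp]: "f \<in> Pol m \<Longrightarrow> restr A f \<in> Pol m"
  by (auto simp: Pol_iff)

lemma homog_restr: "homog e f \<Longrightarrow> homog e (restr A f)"
  by (auto simp: homog_def)

lemma eval_zero_above_eq: "eval_zero_above m f = restr {t. supp t \<subseteq> {..m}} f"
  unfolding eval_zero_above_def restr_def by (rule sum.cong) auto

text \<open>The degree is an integer because entries of vectors in shifted free modules have degrees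
  \<open>e - a l\<close>, which may be negative; the component is then 0.\<close>

definition hc :: "int \<Rightarrow> 'k::field mpol \<Rightarrow> 'k mpol" where
  "hc e = restr {t. int (mdeg t) = e}"

lemma hc_add: "hc e (f + g) = hc e f + hc e g"
  by (simp add: hc_def restr_add)

lemma hc_diff: "hc e (f - g) = hc e f - hc e g"
  by (simp add: hc_def restr_diff)

lemma hc_0 [simp]: "hc e 0 = 0"
  by (simp add: hc_def)

lemma hc_sum: "hc e (sum f A) = (\<Sum>i\<in>A. hc e (f i))"
  by (induction A rule: infinite_finite_induct) (simp_all add: hc_add)

lemma hc_Pol [simp]: "f \<in> Pol m \<Longrightarrow> hc e f \<in> Pol m"
  by (simp add: hc_def)

lemma homog_hc [simp]: "homog e (hc e f)"
  by (auto simp: homog_def hc_def)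

lemma hc_homog: "homog d f \<Longrightarrow> hc e f = (if d = e then f else 0)"
  by (auto simp: hc_def homog_def restr_eq_0_iff intro: restr_id)

lemma hc_eq_0_iff: "hc e f = 0 \<longleftrightarrow> (\<forall>t\<in>supp f. int (mdeg t) \<noteq> e)"
  by (auto simp: hc_def restr_eq_0_iff)

lemma hc_monom_mult: "hc e (Poly_Mapping.single u c * f) = Poly_Mapping.single u c * hc (e - int (mdeg u)) f"
proof (cases "c = 0")
  case False
  show ?thesis
  proof (rule poly_mapping_eqI)
    fix s
    show "coef (hc e (Poly_Mapping.single u c * f)) s = coef (Poly_Mapping.single u c * hc (e - int (mdeg u)) f) s"
    proof (cases "\<exists>t. s = u + t")
      case True
      then show ?thesis by (auto simp: coef_monom_mult_add hc_def coef_restr)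
    next
      case n: False
      have "s \<notin> supp (Poly_Mapping.single u c * g)" for g
        using n supp_monom_mult_subset[of u c g] by blast
      then show ?thesis by (auto simp: hc_def coef_restr in_keys_iff)
    qed
  qed
qed simp

lemma hc_homog_mult:
  assumes "homog d g"
  shows "hc e (g * f) = g * hc (e - d) f"
proof -
  have "hc e (g * f) = (\<Sum>t\<in>supp g. hc e (Poly_Mapping.single t (coef g t) * f))"
    by (subst mpol_expand[of g]) (simp add: sum_distrib_right hc_sum)
  also have "\<dots> = (\<Sum>t\<in>supp g. Poly_Mapping.single t (coef g t) * hc (e - d) f)"
    by (rule sum.cong) (use assms in \<open>auto simp: hc_monom_mult homog_def\<close>)
  also have "\<dots> = g * hc (e - d) f"
    by (subst (3) mpol_expand[of g]) (simp add: sum_distrib_right)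
  finally show ?thesis .
qed

lemma hc_expand:
  assumes "finite E" "(\<lambda>t. int (mdeg t)) ` supp f \<subseteq> E"
  shows "f = (\<Sum>e\<in>E. hc e f)"
proof (rule poly_mapping_eqI)
  fix t
  have "coef (\<Sum>e\<in>E. hc e f) t = (\<Sum>e\<in>E. if int (mdeg t) = e then coef f t else 0)"
    by (simp add: lookup_sum hc_def coef_restr)
  also have "\<dots> = coef f t" using assms by (simp add: image_subset_iff) (metis in_keys_iff)
  finally show "coef f t = coef (\<Sum>e\<in>E. hc e f) t" by simp
qed

section \<open>The degree reverse lexicographic order\<close>

lemma drl_less_irrefl [simp]: "\<not> drl_less u u"
  by (simp add: drl_less_def)

lemma drl_less_trans:
  assumes "drl_less u v" "drl_less v w"
  shows "drl_less u w"
proof (cases "mdeg u < mdeg w")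
  case True then show ?thesis by (simp add: drl_less_def)
next
  case False
  then have d: "mdeg u = mdeg v" "mdeg v = mdeg w" using assms by (auto simp: drl_less_def)
  then obtain i j where i: "coef v i < coef u i" "\<forall>k>i. coef u k = coef v k"
    and j: "coef w j < coef v j" "\<forall>k>j. coef v k = coef w k"
    using assms by (auto simp: drl_less_def)
  have "coef w (max i j) < coef u (max i j) \<and> (\<forall>k>max i j. coef u k = coef w k)"
    using i j by (cases i j rule: linorder_cases) (auto simp: max_def)
  then show ?thesis using d by (auto simp: drl_less_def)
qed

lemma drl_less_total: "u \<noteq> v \<Longrightarrow> drl_less u v \<or> drl_less v u"
proof (cases "mdeg u = mdeg v")
  case True
  assume "u \<noteq> v"
  let ?A = "{i. coef u i \<noteq> coef v i}"
  have "?A \<subseteq> supp u \<union> supp v" by (auto simp: in_keys_iff)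
  then have fin: "finite ?A" by (rule finite_subset) simp
  have ne: "?A \<noteq> {}" using \<open>u \<noteq> v\<close> by (auto intro: poly_mapping_eqI)
  have M: "Max ?A \<in> ?A" by (rule Max_in[OF fin ne])
  have "\<forall>j>Max ?A. coef u j = coef v j" using Max_ge[OF fin] by fastforce
  then show ?thesis using M True unfolding drl_less_def by (metis (mono_tags, lifting) linorder_neqE_nat mem_Collect_eq)
qed (auto simp: drl_less_def)

lemma drl_less_asym: "drl_less u v \<Longrightarrow> \<not> drl_less v u"
  using drl_less_trans drl_less_irrefl by blast

lemma drl_less_add [simp]: "drl_less (w + u) (w + v) \<longleftrightarrow> drl_less u v"
  by (simp add: drl_less_def lookup_add)

lemma drl_less_mdeg: "drl_less u v \<Longrightarrow> mdeg u \<le> mdeg v"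
  by (auto simp: drl_less_def)

lemma drl_max_exists:
  "finite A \<Longrightarrow> A \<noteq> {} \<Longrightarrow> \<exists>t\<in>A. \<forall>u\<in>A. u \<noteq> t \<longrightarrow> drl_less u t"
proof (induction A rule: finite_ne_induct)
  case (insert a A)
  then obtain t where t: "t \<in> A" "\<And>u. u \<in> A \<Longrightarrow> u \<noteq> t \<Longrightarrow> drl_less u t" by blast
  show ?case
  proof (cases "drl_less t a")
    case True
    then have "drl_less u a" if "u \<in> A" for u using t(2)[OF that] drl_less_trans by blast
    then show ?thesis by blast
  next
    case False
    then have "drl_less a t" using drl_less_total[of a t] t(1) insert.hyps by blast
    then show ?thesis using t by blast
  qed
qed simp

lemma lead_monom_props:
  assumes "f \<noteq> 0"
  shows "lead_monom f \<in> supp f \<and> (\<forall>u\<in>supp f. u \<noteq> lead_monom f \<longrightarrow> drl_less u (lead_monom f))"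
proof -
  have "\<exists>!t. t \<in> supp f \<and> (\<forall>u\<in>supp f. u \<noteq> t \<longrightarrow> drl_less u t)"
  proof (rule ex_ex1I)
    show "\<exists>t. t \<in> supp f \<and> (\<forall>u\<in>supp f. u \<noteq> t \<longrightarrow> drl_less u t)"
      using drl_max_exists[of "supp f"] assms by auto
    show "t = u"
      if "t \<in> supp f \<and> (\<forall>u\<in>supp f. u \<noteq> t \<longrightarrow> drl_less u t)"
        and "u \<in> supp f \<and> (\<forall>t\<in>supp f. t \<noteq> u \<longrightarrow> drl_less t u)" for t u
      using that drl_less_asym[of t u] by metis
  qed
  from theI'[OF this] show ?thesis unfolding lead_monom_def .
qed

lemma lead_monom_in: "f \<noteq> 0 \<Longrightarrow> lead_monom f \<in> supp f"
  using lead_monom_props by blast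

lemma lead_monom_max: "u \<in> supp f \<Longrightarrow> u \<noteq> lead_monom f \<Longrightarrow> drl_less u (lead_monom f)"
  using lead_monom_props[of f] by fastforce

lemma lead_monom_eqI:
  assumes "t \<in> supp f" "\<And>u. u \<in> supp f \<Longrightarrow> u \<noteq> t \<Longrightarrow> drl_less u t"
  shows "lead_monom f = t"
  using assms lead_monom_max[of t f] lead_monom_in[of f] drl_less_asym by fastforce

lemma lead_monom_xmon [simp]: "lead_monom (xmon t :: 'k::field mpol) = t"
  by (rule lead_monom_eqI) auto

lemma lead_monom_xmon_mult:
  assumes "f \<noteq> 0"
  shows "lead_monom (xmon u * f) = u + lead_monom f"
  by (rule lead_monom_eqI) (use assms lead_monom_in lead_monom_max in \<open>auto simp: supp_xmon_mult\<close>)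

lemma xmon_mult_eq_0_iff [simp]: "xmon u * f = 0 \<longleftrightarrow> f = 0" for f :: "'k::field mpol"
  by (metis image_is_empty keys_eq_empty supp_xmon_mult)

lemma lead_monom_homog: "homog e f \<Longrightarrow> f \<noteq> 0 \<Longrightarrow> int (mdeg (lead_monom f)) = e"
  using lead_monom_in homogD by blast

text \<open>The order refines the degree, and finitely many variables have only finitely many
  monomials up to a given degree. The restriction to \<open>monoms m\<close> is essential: over all
  variables, \<open>x_1 > x_2 > ...\<close> descends forever.\<close>

lemma wf_drl_monoms: "wf {(s, t). drl_less s t \<and> s \<in> monoms m \<and> t \<in> monoms m}"
proof (rule wfI_min)
  fix x :: monom and Q assume "x \<in> Q"
  show "\<exists>z\<in>Q. \<forall>y. (y, z) \<in> {(s, t). drl_less s t \<and> s \<in> monoms m \<and> t \<in> monoms m} \<longrightarrow> y \<notin> Q"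
  proof (cases "x \<in> monoms m")
    case True
    let ?A = "{t \<in> Q \<inter> monoms m. mdeg t \<le> mdeg x}"
    have "finite ?A" by (rule finite_subset[OF _ finite_monoms_mdeg_le[of m "mdeg x"]]) auto
    have "finite A \<Longrightarrow> A \<noteq> {} \<Longrightarrow> \<exists>t\<in>A. \<forall>u\<in>A. \<not> drl_less u t" for A
    proof (induction A rule: finite_ne_induct)
      case (insert a A)
      then obtain t where t: "t \<in> A" "\<forall>u\<in>A. \<not> drl_less u t" by auto
      then show ?case
        by (cases "drl_less a t") (use drl_less_asym drl_less_trans drl_less_irrefl in blast)+
    qed simp
    then obtain t where "t \<in> ?A" "\<forall>u\<in>?A. \<not> drl_less u t"
      using \<open>finite ?A\<close> \<open>x \<in> Q\<close> True by blast
    then show ?thesis using drl_less_mdeg by (intro bexI[of _ t]) force+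
  qed (use \<open>x \<in> Q\<close> in blast)
qed

section \<open>Graded ideals and their initial ideals\<close>

lemma xmon_neq_0 [simp]: "xmon t \<noteq> (0 :: 'k::field mpol)"
  by (metis insert_not_empty keys_zero supp_xmon)

lemma a_inv_poly_ring: "f \<in> Pol n \<Longrightarrow> \<ominus>\<^bsub>poly_ring n\<^esub> f = - f" for f :: "'k::field mpol"
proof -
  interpret cring "poly_ring n :: 'k mpol ring" by (rule cring_poly_ring)
  assume "f \<in> Pol n"
  then show ?thesis by (intro minus_equality) simp_all
qed

lemma ideal_poly_ring_iff:
  fixes A :: "'k::field mpol set"
  shows "ideal A (poly_ring n) \<longleftrightarrow> A \<subseteq> Pol n \<and> 0 \<in> A \<and> (\<forall>a\<in>A. \<forall>b\<in>A. a + b \<in> A) \<and> (\<forall>r\<in>Pol n. \<forall>a\<in>A. r * a \<in> A)"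
  (is "?l = ?r")
proof
  assume ?l
  then interpret ideal A "poly_ring n" .
  show ?r
    using a_subset additive_subgroup.zero_closed[OF additive_subgroup_axioms]
      additive_subgroup.a_closed[OF additive_subgroup_axioms] I_l_closed
    by (simp add: Ball_def)
next
  assume r: ?r
  interpret cring "poly_ring n :: 'k mpol ring" by (rule cring_poly_ring)
  show ?l
  proof (rule idealI)
    show "ring (poly_ring n :: 'k mpol ring)" by (rule ring_axioms)
    show "subgroup A (add_monoid (poly_ring n))"
    proof (rule add.subgroupI)
      fix a assume a: "a \<in> A"
      then have "(- 1) * a \<in> A" using r by (metis Pol_one Pol_uminus)
      then show "\<ominus>\<^bsub>poly_ring n\<^esub> a \<in> A" using r a by (auto simp: a_inv_poly_ring)
    qed (use r in auto)
    show "x \<otimes>\<^bsub>poly_ring n\<^esub> a \<in> A" "a \<otimes>\<^bsub>poly_ring n\<^esub> x \<in> A" if "a \<in> A" "x \<in> Pol n" for a x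
      using r that by (simp_all add: mult.commute[of a x])
  qed
qed

lemma ideal_Pol: "ideal A (poly_ring n) \<Longrightarrow> a \<in> A \<Longrightarrow> a \<in> Pol n"
  and ideal_zero: "ideal A (poly_ring n) \<Longrightarrow> 0 \<in> A"
  and ideal_add: "ideal A (poly_ring n) \<Longrightarrow> a \<in> A \<Longrightarrow> b \<in> A \<Longrightarrow> a + b \<in> A"
  and ideal_mult: "ideal A (poly_ring n) \<Longrightarrow> r \<in> Pol n \<Longrightarrow> a \<in> A \<Longrightarrow> r * a \<in> A"
  by (auto simp: ideal_poly_ring_iff)

lemma ideal_uminus: "ideal A (poly_ring n) \<Longrightarrow> a \<in> A \<Longrightarrow> - a \<in> A"
  using ideal_mult[of A n "- 1" a] by simp

lemma ideal_diff: "ideal A (poly_ring n) \<Longrightarrow> a \<in> A \<Longrightarrow> b \<in> A \<Longrightarrow> a - b \<in> A"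
  using ideal_add[of A n a "- b"] ideal_uminus by auto

lemma ideal_sum: "ideal A (poly_ring n) \<Longrightarrow> (\<And>i. i \<in> B \<Longrightarrow> f i \<in> A) \<Longrightarrow> sum f B \<in> A"
  by (induction B rule: infinite_finite_induct) (auto simp: ideal_zero ideal_add)

lemma genideal_subset: "ideal A (poly_ring n) \<Longrightarrow> G \<subseteq> A \<Longrightarrow> genideal (poly_ring n) G \<subseteq> A"
  by (auto simp: genideal_def)

lemma genideal_is_ideal: "G \<subseteq> Pol n \<Longrightarrow> ideal (genideal (poly_ring n) G) (poly_ring n)"
  for G :: "'k::field mpol set"
  using ring.genideal_ideal[OF cring.axioms(1)[OF cring_poly_ring]] by blast

lemma genideal_incl: "G \<subseteq> genideal (poly_ring n) G"
  by (auto simp: genideal_def)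

text \<open>The polynomials all of whose components lie in I form an ideal, and this ideal contains
  the homogeneous generators.\<close>

lemma homogeneous_ideal_hc:
  fixes I :: "'k::field mpol set"
  assumes "homogeneous_ideal n I" "f \<in> I"
  shows "hc e f \<in> I"
proof -
  obtain G where G: "G \<subseteq> Pol n" "\<And>g. g \<in> G \<Longrightarrow> \<exists>e. homog e g" "I = genideal (poly_ring n) G"
    using assms(1) unfolding homogeneous_ideal_def by blast
  have I: "ideal I (poly_ring n)" using genideal_is_ideal G by blast
  let ?A = "{f \<in> Pol n. \<forall>e. hc e f \<in> I}"
  have mult: "hc e (r * f) \<in> I" if "r \<in> Pol n" "f \<in> ?A" for r f e
  proof -
    have "r * f = (\<Sum>t\<in>supp r. Poly_Mapping.single t (coef r t) * f)"
      by (subst mpol_expand[of r]) (simp add: sum_distrib_right)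
    then have "hc e (r * f) = (\<Sum>t\<in>supp r. Poly_Mapping.single t (coef r t) * hc (e - int (mdeg t)) f)"
      by (simp add: hc_sum hc_monom_mult)
    then show ?thesis using that by (auto simp: Pol_iff intro!: ideal_sum[OF I] ideal_mult[OF I])
  qed
  have "ideal ?A (poly_ring n)"
    unfolding ideal_poly_ring_iff using mult by (auto simp: hc_add ideal_add[OF I] ideal_zero[OF I])
  moreover have "G \<subseteq> ?A"
  proof
    fix g assume g: "g \<in> G"
    then obtain d where "homog d g" using G by blast
    moreover have "g \<in> I" using g G(3) genideal_incl by blast
    ultimately show "g \<in> ?A" using g G(1) ideal_zero[OF I] by (auto simp: hc_homog)
  qed
  ultimately show ?thesis using assms(2) G(3) genideal_subset by blast
qed

text \<open>Membership in a monomial ideal is decided term by term: sums and multiples create no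
  terms outside the multiples of the generators, and each divisible term is itself in the
  ideal.\<close>

lemma genideal_xmon:
  assumes "G \<subseteq> monoms m"
  shows "genideal (poly_ring m) (xmon ` G) = {f \<in> Pol m. \<forall>t\<in>supp f. \<exists>g\<in>G. \<exists>u. t = g + u}" (is "_ = ?A")
proof
  have mult: "r * f \<in> ?A" if "r \<in> Pol m" "f \<in> ?A" for r f
  proof -
    have "\<exists>g\<in>G. \<exists>u. t = g + u" if t: "t \<in> supp (r * f)" for t
    proof -
      obtain a b where "t = a + b" "a \<in> supp r" "b \<in> supp f" using t keys_mult by blast
      moreover obtain g u where "g \<in> G" "b = g + u" using \<open>f \<in> ?A\<close> \<open>b \<in> supp f\<close> by blast
      ultimately have "g \<in> G" "t = g + (a + u)" by (simp_all add: ac_simps)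
      then show ?thesis by blast
    qed
    with that show ?thesis by auto
  qed
  have add: "f + g \<in> ?A" if "f \<in> ?A" "g \<in> ?A" for f g
    using that Poly_Mapping.keys_add[of f g] by auto
  have "ideal ?A (poly_ring m)"
    unfolding ideal_poly_ring_iff
  proof (intro conjI ballI)
    show "?A \<subseteq> Pol m" by blast
    show "0 \<in> ?A" by simp
  qed (rule add mult; assumption)+
  moreover have "xmon t \<in> ?A" if "t \<in> G" for t
    using assms that by (auto intro!: bexI[of _ t] exI[of _ 0])
  ultimately show "genideal (poly_ring m) (xmon ` G) \<subseteq> ?A"
    by (intro genideal_subset) blast+
  have I: "ideal (genideal (poly_ring m) (xmon ` G)) (poly_ring m)"
    using assms by (intro genideal_is_ideal) auto
  show "?A \<subseteq> genideal (poly_ring m) (xmon ` G)"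
  proof
    fix f assume f: "f \<in> ?A"
    have "Poly_Mapping.single t (coef f t) \<in> genideal (poly_ring m) (xmon ` G)" if t: "t \<in> supp f" for t
    proof -
      obtain g u where gu: "g \<in> G" "t = g + u" using f t by blast
      then have "u \<in> monoms m" using f t by (auto simp: Pol_iff)
      then have "Poly_Mapping.single u (coef f t) * xmon g \<in> genideal (poly_ring m) (xmon ` G)"
        using gu genideal_incl[of "xmon ` G" m] by (intro ideal_mult[OF I]) auto
      then show ?thesis by (simp add: xmon_def mult_single gu add.commute)
    qed
    then show "f \<in> genideal (poly_ring m) (xmon ` G)"
      by (subst mpol_expand) (intro ideal_sum[OF I])
  qed
qed

text \<open>Turns minimality of a resolution into the vanishing of constant coefficients.\<close>

lemma irrelevant_ideal_eq: "irrelevant_ideal n = {f \<in> Pol n. coef f 0 = 0}"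
proof -
  have "irrelevant_ideal n = genideal (poly_ring n) (xmon ` evar ` {1..n})"
    by (simp add: irrelevant_ideal_def image_image evar_def)
  also have "\<dots> = {f \<in> Pol n. \<forall>t\<in>supp f. \<exists>g\<in>evar ` {1..n}. \<exists>u. t = g + u}"
    by (rule genideal_xmon) auto
  also have "(\<forall>t\<in>supp f. \<exists>g\<in>evar ` {1..n}. \<exists>u. t = g + u) \<longleftrightarrow> coef f 0 = 0" if "f \<in> Pol n" for f
  proof
    assume *: "\<forall>t\<in>supp f. \<exists>g\<in>evar ` {1..n}. \<exists>u. t = g + u"
    show "coef f 0 = 0"
    proof (rule ccontr)
      assume "coef f 0 \<noteq> 0"
      then obtain i u where "0 = evar i + u" using * by (fastforce simp: in_keys_iff)
      then have "mdeg 0 = mdeg (evar i) + mdeg u" by (metis mdeg_add)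
      then show False by simp
    qed
  next
    assume 0: "coef f 0 = 0"
    show "\<forall>t\<in>supp f. \<exists>g\<in>evar ` {1..n}. \<exists>u. t = g + u"
    proof
      fix t assume t: "t \<in> supp f"
      then have "t \<noteq> 0" using 0 by (auto simp: in_keys_iff)
      then obtain i where i: "i \<in> supp t" using keys_eq_empty by fastforce
      moreover have "t \<in> monoms n" using t that by (auto simp: Pol_iff)
      then have "i \<in> {1..n}" using i by (auto simp: monoms_def)
      ultimately show "\<exists>g\<in>evar ` {1..n}. \<exists>u. t = g + u" using monom_split by blast
    qed
  qed
  then have "{f \<in> Pol n. \<forall>t\<in>supp f. \<exists>g\<in>evar ` {1..n}. \<exists>u. t = g + u} = {f \<in> Pol n. coef f 0 = 0}"
    by blast
  finally show ?thesis .
qed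

lemma xmon_divide:
  assumes "\<And>u. u \<in> supp g \<Longrightarrow> \<exists>s. u = w + s"
  shows "\<exists>f. g = xmon w * (f :: 'k::field mpol)"
proof -
  have "\<forall>u\<in>supp g. \<exists>s. u = w + s" using assms by blast
  then obtain s where s: "\<forall>u\<in>supp g. u = w + s u" by metis
  have "xmon w * (\<Sum>u\<in>supp g. Poly_Mapping.single (s u) (coef g u)) = (\<Sum>u\<in>supp g. Poly_Mapping.single (w + s u) (coef g u))"
    by (simp add: sum_distrib_left xmon_def mult_single)
  also have "\<dots> = (\<Sum>u\<in>supp g. Poly_Mapping.single u (coef g u))"
    by (rule sum.cong) (use s in simp_all)
  finally show ?thesis using mpol_expand[of g] by metis
qed

lemma homog_xmon_mult_iff: "homog (int (mdeg u) + e) (xmon u * f) \<longleftrightarrow> homog e f" for f :: "'k::field mpol"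
  by (auto simp: homog_def supp_xmon_mult)

text \<open>First use of the reverse lexicographic order: at the largest variable of u, which lies
  beyond \<open>x_m\<close>, t has exponent 0, and the larger exponent makes u smaller.\<close>

lemma drl_less_if_not_monoms:
  assumes "t \<in> monoms m" "u \<in> monoms n" "u \<notin> monoms m" "mdeg u = mdeg t"
  shows "drl_less u t"
proof -
  have ne: "supp u \<noteq> {}" using assms(3) by (auto simp: monoms_def)
  let ?i = "Max (supp u)"
  have i: "?i \<in> supp u" using ne by simp
  have "m < ?i"
  proof (rule ccontr)
    assume "\<not> m < ?i"
    then have "i \<le> m" if "i \<in> supp u" for i
      using Max_ge[OF finite_keys that] \<open>\<not> m < ?i\<close> by linarith
    then have "supp u \<subseteq> {1..m}" using assms(2) by (auto simp: monoms_def)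
    then show False using assms(3) by (simp add: monoms_def)
  qed
  have t0: "coef t j = 0" if "j > m" for j
  proof -
    have "j \<notin> supp t" using assms(1) that by (auto simp: monoms_def)
    then show ?thesis by (simp add: in_keys_iff)
  qed
  have u0: "coef u j = 0" if "j > ?i" for j
    using that Max_ge[OF finite_keys, of j u] by (metis in_keys_iff not_less)
  show ?thesis unfolding drl_less_def
    using i t0 u0 \<open>m < ?i\<close> assms(4) by (intro disjI2 conjI exI[of _ ?i]) (auto simp: in_keys_iff)
qed

text \<open>Second use of the order: if the last variable \<open>x_m\<close> divides a monomial, it
  divides every smaller one of the same degree, since otherwise the last difference would be at
  \<open>x_m\<close> and have the wrong sign.\<close>

lemma drl_less_divisible:
  assumes "drl_less u (evar m + t)" "mdeg u = mdeg (evar m + t)" "u \<in> monoms m"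
  shows "m \<in> supp u"
proof (rule ccontr)
  assume "m \<notin> supp u"
  obtain i where i: "coef (evar m + t) i < coef u i" "\<forall>j>i. coef u j = coef (evar m + t) j"
    using assms by (auto simp: drl_less_def)
  then have "i \<in> supp u" by (auto simp: in_keys_iff)
  then have "i < m" using assms(3) \<open>m \<notin> supp u\<close> by (cases "i = m") (auto simp: monoms_def subset_iff le_less)
  then have "coef u m = coef (evar m + t) m" using i by blast
  then show False using \<open>m \<notin> supp u\<close> by (simp add: in_keys_iff lookup_add evar_def)
qed

lemma top_degree_le_iff:
  "top_degree A B \<le> z \<longleftrightarrow> (\<forall>r. \<forall>f\<in>A. homog (int r) f \<longrightarrow> f \<notin> B \<longrightarrow> ereal (real r) \<le> z)"
  unfolding top_degree_def Sup_le_iff by blast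

section \<open>The ideals \<open>I + (x_{m+1}, ..., x_n)\<close> and the monomials of
  \<open>in(I)\<close>\<close>

locale graded_ideal =
  fixes n :: nat and I :: "'k::field mpol set"
  assumes idl: "ideal I (poly_ring n)"
    and hcI: "f \<in> I \<Longrightarrow> hc e f \<in> I"
    and proper: "1 \<notin> I"
begin

text \<open>\<open>Xid m\<close> is the ideal \<open>(x\<^sub>m\<^sub>+\<^sub>1, \<dots>, x\<^sub>n)\<close>, and \<open>lms\<close> the set of monomials of \<open>in(I)\<close>.\<close>

definition Xid :: "nat \<Rightarrow> 'k mpol set" where
  "Xid m = {y \<in> Pol n. supp y \<inter> monoms m = {}}"

text \<open>The ideal \<open>I + (x_{m+1}, ..., x_n)\<close>. It is kept inside the ring in all n
  variables, so that all stages of the reduction modulo variables are ideals of one ring;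
  \<open>m = n - i\<close> corresponds to stage i.\<close>

definition Iid :: "nat \<Rightarrow> 'k mpol set" where
  "Iid m = {a + y | a y. a \<in> I \<and> y \<in> Xid m}"

definition lms :: "monom set" where
  "lms = {lead_monom f | f. f \<in> I \<and> f \<noteq> 0}"

lemma Xid_ideal: "ideal (Xid m) (poly_ring n)"
proof -
  have "r * y \<in> Xid m" if "r \<in> Pol n" "y \<in> Xid m" for r y
  proof -
    have "t \<notin> monoms m" if t: "t \<in> supp (r * y)" for t
    proof -
      obtain a b where "t = a + b" "b \<in> supp y" using t keys_mult by blast
      then show ?thesis using \<open>y \<in> Xid m\<close> by (auto simp: Xid_def)
    qed
    with that show ?thesis by (auto simp: Xid_def)
  qed
  moreover have "y + z \<in> Xid m" if "y \<in> Xid m" "z \<in> Xid m" for y z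
    using that Poly_Mapping.keys_add[of y z] by (auto simp: Xid_def)
  ultimately show ?thesis unfolding ideal_poly_ring_iff by (auto simp: Xid_def)
qed

lemma Xid_top [simp]: "Xid n = {0}"
  using keys_eq_empty by (fastforce simp: Xid_def Pol_iff)

lemma Xid_hc: "y \<in> Xid m \<Longrightarrow> hc e y \<in> Xid m"
  by (auto simp: Xid_def hc_def)

lemma I_Pol: "a \<in> I \<Longrightarrow> a \<in> Pol n"
  using idl ideal_Pol by blast

lemma Iid_ideal: "ideal (Iid m) (poly_ring n)"
  unfolding ideal_poly_ring_iff
proof (intro conjI ballI)
  show "Iid m \<subseteq> Pol n" using I_Pol Xid_ideal ideal_Pol by (fastforce simp: Iid_def)
  show "0 \<in> Iid m" using ideal_zero[OF idl] ideal_zero[OF Xid_ideal] by (force simp: Iid_def)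
next
  fix f g assume "f \<in> Iid m" "g \<in> Iid m"
  then obtain a y b z where "f = a + y" "g = b + z" "a \<in> I" "b \<in> I" "y \<in> Xid m" "z \<in> Xid m"
    by (auto simp: Iid_def)
  moreover from this have "f + g = (a + b) + (y + z)" by simp
  ultimately show "f + g \<in> Iid m"
    using ideal_add[OF idl] ideal_add[OF Xid_ideal] unfolding Iid_def by blast
next
  fix r f :: "'k mpol" assume "r \<in> Pol n" "f \<in> Iid m"
  then obtain a y where "f = a + y" "a \<in> I" "y \<in> Xid m"
    by (auto simp: Iid_def)
  moreover from this have "r * f = r * a + r * y" by (simp add: distrib_left)
  ultimately show "r * f \<in> Iid m"
    using ideal_mult[OF idl \<open>r \<in> Pol n\<close>] ideal_mult[OF Xid_ideal \<open>r \<in> Pol n\<close>] unfolding Iid_def by blast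
qed

lemma Iid_top [simp]: "Iid n = I"
  by (simp add: Iid_def)

lemma I_subset_Iid: "I \<subseteq> Iid m"
  unfolding Iid_def using ideal_zero[OF Xid_ideal] by force

lemma Xid_subset_Iid: "Xid m \<subseteq> Iid m"
  unfolding Iid_def using ideal_zero[OF idl] by force

lemma Iid_hc: "f \<in> Iid m \<Longrightarrow> hc e f \<in> Iid m"
  unfolding Iid_def by (clarsimp simp: hc_add) (use hcI Xid_hc in blast)

lemma lms_monoms: "t \<in> lms \<Longrightarrow> t \<in> monoms n"
  using I_Pol lead_monom_in by (fastforce simp: lms_def Pol_iff)

lemma lms_add:
  assumes "t \<in> lms" "u \<in> monoms n"
  shows "u + t \<in> lms"
proof -
  obtain f where f: "f \<in> I" "f \<noteq> 0" "t = lead_monom f" using assms by (auto simp: lms_def)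
  have "xmon u * f \<in> I" using f assms(2) by (intro ideal_mult[OF idl]) auto
  moreover have "lead_monom (xmon u * f) = u + t" using lead_monom_xmon_mult[OF f(2), of u] f(3) by simp
  ultimately show ?thesis using f unfolding lms_def by (metis (mono_tags, lifting) mem_Collect_eq xmon_mult_eq_0_iff)
qed

text \<open>The component of f in the degree of its leading monomial has the same leading monomial
  and lies in I.\<close>

lemma lms_homog:
  assumes "t \<in> lms"
  obtains f where "f \<in> I" "f \<noteq> 0" "homog (int (mdeg t)) f" "lead_monom f = t"
proof -
  obtain f where f: "f \<in> I" "f \<noteq> 0" "t = lead_monom f" using assms by (auto simp: lms_def)
  let ?g = "hc (int (mdeg t)) f"
  have t: "t \<in> supp ?g" using lead_monom_in f by (auto simp: hc_def)
  moreover have "lead_monom ?g = t"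
    by (rule lead_monom_eqI[OF t]) (use f lead_monom_max in \<open>auto simp: hc_def\<close>)
  ultimately show ?thesis using that[of ?g] f hcI by force
qed

lemma initial_ideal_eq: "initial_ideal n I = {f \<in> Pol n. supp f \<subseteq> lms}"
proof -
  have "initial_ideal n I = genideal (poly_ring n) (xmon ` lms)"
    unfolding initial_ideal_def lms_def by (rule arg_cong[of _ _ "genideal _"]) blast
  also have "\<dots> = {f \<in> Pol n. \<forall>t\<in>supp f. \<exists>g\<in>lms. \<exists>u. t = g + u}"
    using lms_monoms by (intro genideal_xmon) blast
  also have "\<dots> = {f \<in> Pol n. supp f \<subseteq> lms}"
  proof (rule Collect_cong, rule conj_cong[OF refl])
    fix f :: "'k mpol" assume f: "f \<in> Pol n"
    have "t \<in> lms" if "t \<in> supp f" "g \<in> lms" "t = g + u" for t g u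
    proof -
      have "u \<in> monoms n" using f that by (auto simp: Pol_iff)
      then show ?thesis using lms_add[OF that(2), of u] that(3) by (simp add: add.commute[of g u])
    qed
    moreover have "\<exists>g\<in>lms. \<exists>u. t = g + u" if "t \<in> lms" for t
      using that by (intro bexI[of _ t] exI[of _ 0]) auto
    ultimately show "(\<forall>t\<in>supp f. \<exists>g\<in>lms. \<exists>u. t = g + u) \<longleftrightarrow> supp f \<subseteq> lms" by blast
  qed
  finally show ?thesis .
qed

section \<open>The invariants in terms of monomials outside \<open>in(I)\<close>\<close>

lemma J_ideal_eq: "J_ideal n I i = {f \<in> Pol (n - i). supp f \<subseteq> lms}"
proof
  have *: "supp t \<subseteq> {..n - i} \<longleftrightarrow> t \<in> monoms (n - i)" if "t \<in> monoms n" for t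
    using that by (rule monoms_atMost) simp
  show "J_ideal n I i \<subseteq> {f \<in> Pol (n - i). supp f \<subseteq> lms}"
    using * by (fastforce simp: J_ideal_def eval_zero_above_eq initial_ideal_eq Pol_iff)
  show "{f \<in> Pol (n - i). supp f \<subseteq> lms} \<subseteq> J_ideal n I i"
  proof
    fix f :: "'k mpol" assume f: "f \<in> {f \<in> Pol (n - i). supp f \<subseteq> lms}"
    then have fn: "f \<in> Pol n" using Pol_mono[of "n - i" n f] by simp
    have "supp f \<subseteq> {t. supp t \<subseteq> {..n - i}}" using f by (fastforce simp: Pol_iff monoms_def)
    then have "f = eval_zero_above (n - i) f" by (simp add: eval_zero_above_eq restr_id)
    then show "f \<in> J_ideal n I i" using f fn unfolding J_ideal_def initial_ideal_eq by blast
  qed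
qed

text \<open>A homogeneous element with leading monomial 1 is a nonzero constant, hence a unit, which
  a proper ideal cannot contain.\<close>

lemma zero_notin_lms: "0 \<notin> lms"
proof
  assume "0 \<in> lms"
  then obtain f where f: "f \<in> I" "f \<noteq> 0" "homog 0 f" using lms_homog by (metis mdeg_0 of_nat_0)
  then have s: "supp f = {0}" using lead_monom_in[of f] by (fastforce simp: homog_def)
  then have "f = Poly_Mapping.single 0 (coef f 0)" using mpol_expand[of f] by simp
  then have "Poly_Mapping.single 0 (inverse (coef f 0)) * f = 1"
    using s by (metis in_keys_iff left_inverse mult_single add_0 single_one singletonI)
  then show False using ideal_mult[OF idl, of "Poly_Mapping.single 0 (inverse (coef f 0))" f] f proper by simp
qed

text \<open>Setting \<open>x_{n-i} = 1\<close> in the monomials of \<open>J_i\<close> yields the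
  saturation of \<open>J_i\<close> by \<open>x_{n-i}\<close>: a monomial belongs to it exactly when
  some power of the variable moves it into \<open>in(I)\<close>.\<close>

lemma J_tilde_eq:
  assumes "i < n"
  shows "J_tilde n I i = {f \<in> Pol (n - i). \<forall>t\<in>supp f. \<exists>k. Poly_Mapping.single (n - i) k + t \<in> lms}"
proof -
  let ?m = "n - i"
  have upd: "t = Poly_Mapping.update ?m 0 t + Poly_Mapping.single ?m (coef t ?m)" for t :: monom
    by (rule poly_mapping_eqI) (auto simp: lookup_add lookup_update lookup_single when_def)
  have updm: "Poly_Mapping.update ?m 0 t \<in> monoms ?m \<longleftrightarrow> t \<in> monoms ?m" for t :: monom
    using assms by (auto simp: monoms_def keys_update)
  have sm: "Poly_Mapping.single ?m k \<in> monoms ?m" for k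
    using assms by (auto simp: monoms_def)
  have mm: "t \<in> monoms ?m \<Longrightarrow> t \<in> monoms n" for t using monoms_mono[of ?m n] by auto
  define G where "G = Poly_Mapping.update ?m 0 ` (lms \<inter> monoms ?m)"
  have "J_tilde n I i = genideal (poly_ring ?m) (xmon ` G)"
    unfolding J_tilde_def J_ideal_eq G_def
    by (rule arg_cong[of _ _ "genideal _"]) (auto simp: image_iff)
  also have "\<dots> = {f \<in> Pol ?m. \<forall>t\<in>supp f. \<exists>g\<in>G. \<exists>u. t = g + u}"
    by (rule genideal_xmon) (auto simp: G_def updm)
  also have "\<dots> = {f \<in> Pol ?m. \<forall>t\<in>supp f. \<exists>k. Poly_Mapping.single ?m k + t \<in> lms}"
  proof (rule Collect_cong, rule conj_cong[OF refl], rule ball_cong[OF refl])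
    fix f :: "'k mpol" and t assume f: "f \<in> Pol ?m" and t: "t \<in> supp f"
    then have tm: "t \<in> monoms ?m" by (auto simp: Pol_iff)
    show "(\<exists>g\<in>G. \<exists>u. t = g + u) \<longleftrightarrow> (\<exists>k. Poly_Mapping.single ?m k + t \<in> lms)"
    proof
      assume "\<exists>g\<in>G. \<exists>u. t = g + u"
      then obtain s u where s: "s \<in> lms" "s \<in> monoms ?m" "t = Poly_Mapping.update ?m 0 s + u"
        by (auto simp: G_def)
      then have "u \<in> monoms n" using tm mm by auto
      then have "u + s \<in> lms" using lms_add s by blast
      moreover have "u + s = Poly_Mapping.single ?m (coef s ?m) + t"
        by (subst upd[of s]) (simp add: s(3) ac_simps)
      ultimately show "\<exists>k. Poly_Mapping.single ?m k + t \<in> lms" by metis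
    next
      assume "\<exists>k. Poly_Mapping.single ?m k + t \<in> lms"
      then obtain k where k: "Poly_Mapping.single ?m k + t \<in> lms" by blast
      have "Poly_Mapping.update ?m 0 (Poly_Mapping.single ?m k + t) = Poly_Mapping.update ?m 0 t"
        by (rule poly_mapping_eqI) (auto simp: lookup_add lookup_update lookup_single when_def)
      then have "Poly_Mapping.update ?m 0 t \<in> G" unfolding G_def
        using k tm sm by (intro image_eqI[of _ _ "Poly_Mapping.single ?m k + t"]) auto
      then show "\<exists>g\<in>G. \<exists>u. t = g + u" using upd[of t] by blast
    qed
  qed
  finally show ?thesis .
qed

text \<open>Since \<open>n - i\<close> is truncated, for \<open>i \<ge> n\<close> the exponent set to \<open>0\<close> is that of the unused variable \<open>x\<^sub>0\<close>.\<close>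

lemma J_tilde_eq_J:
  assumes "i \<ge> n"
  shows "J_tilde n I i = {0}" "J_ideal n I i = {0}"
proof -
  have m0: "monoms 0 = {0}" by (auto simp: monoms_def)
  show J: "J_ideal n I i = {0}"
    using assms zero_notin_lms keys_eq_empty unfolding J_ideal_eq by (fastforce simp: Pol_iff m0)
  have "J_tilde n I i = genideal (poly_ring 0) {}"
    using assms by (simp add: J_tilde_def J)
  then show "J_tilde n I i = {0}"
    using genideal_xmon[of "{}" 0, where 'a='k] keys_eq_empty by fastforce
qed

text \<open>Replaces the saturation by the colon with one variable. If a power of
  \<open>x_{n-i}\<close> moves t into \<open>in(I)\<close>, then the last multiple of t still
  outside has degree at least that of t and enters \<open>in(I)\<close> after one more
  multiplication. For i \<ge> n the supremum is empty and the bound holds for every z.\<close>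

lemma c_inv_le_iff:
  "c_inv n I i \<le> z \<longleftrightarrow>
   (i < n \<longrightarrow> (\<forall>t\<in>monoms (n - i). t \<notin> lms \<longrightarrow> evar (n - i) + t \<in> lms \<longrightarrow> ereal (real (mdeg t)) \<le> z))"
proof (cases "i < n")
  case False
  then show ?thesis by (simp add: c_inv_def top_degree_le_iff J_tilde_eq_J)
next
  case True
  let ?m = "n - i"
  have sm: "Poly_Mapping.single ?m k \<in> monoms ?m" for k
    using True by (auto simp: monoms_def)
  show ?thesis (is "?l \<longleftrightarrow> ?r")
  proof
    assume l: ?l
    have "ereal (real (mdeg t)) \<le> z" if "t \<in> monoms ?m" "t \<notin> lms" "evar ?m + t \<in> lms" for t
    proof -
      have "(xmon t :: 'k mpol) \<in> J_tilde n I i"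
        using that by (auto simp: J_tilde_eq[OF True] evar_def)
      moreover have "(xmon t :: 'k mpol) \<notin> J_ideal n I i" using that by (simp add: J_ideal_eq)
      ultimately show ?thesis using l unfolding c_inv_def top_degree_le_iff by (metis homog_xmon)
    qed
    then show ?r by blast
  next
    assume r: ?r
    show ?l unfolding c_inv_def top_degree_le_iff
    proof (intro allI ballI impI)
      fix r f assume f: "f \<in> J_tilde n I i" "homog (int r) f" "f \<notin> J_ideal n I i"
      then have "f \<in> Pol ?m" by (simp add: J_tilde_eq[OF True])
      then obtain t where t: "t \<in> supp f" "t \<notin> lms" using f(3) by (auto simp: J_ideal_eq)
      then have dt: "mdeg t = r" and tm: "t \<in> monoms ?m" using f(2) \<open>f \<in> Pol ?m\<close>
        by (auto simp: homog_def Pol_iff)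
      let ?P = "\<lambda>k. Poly_Mapping.single ?m k + t \<in> lms"
      obtain k where "?P k" using f(1) t by (auto simp: J_tilde_eq[OF True])
      then have P: "?P (LEAST k. ?P k)" by (rule LeastI)
      \<comment> \<open>The least exponent is positive because t itself is outside
        \<open>in(I)\<close>; its predecessor gives the monomial to which the hypothesis
        applies.\<close>
      then obtain k where k: "(LEAST k. ?P k) = Suc k" using t(2) by (cases "LEAST k. ?P k") auto
      then have nk: "Poly_Mapping.single ?m k + t \<notin> lms" using not_less_Least[of k ?P] by simp
      have "evar ?m + (Poly_Mapping.single ?m k + t) = Poly_Mapping.single ?m (Suc k) + t"
        by (simp add: evar_def add.assoc[symmetric] single_add[symmetric])
      then have "ereal (real (mdeg (Poly_Mapping.single ?m k + t))) \<le> z"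
        using P k nk r True tm sm by (metis monoms_add_iff)
      then show "ereal (real r) \<le> z" using dt
        by (metis ereal_less_eq(3) le_add2 mdeg_add of_nat_le_iff order_trans)
    qed
  qed
qed

lemma r_inv_le_iff:
  "r_inv n I d \<le> z \<longleftrightarrow> (\<forall>t\<in>monoms (n - d). t \<notin> lms \<longrightarrow> ereal (real (mdeg t)) \<le> z)" (is "?l \<longleftrightarrow> ?r")
proof
  assume l: ?l
  have "ereal (real (mdeg t)) \<le> z" if "t \<in> monoms (n - d)" "t \<notin> lms" for t
  proof -
    have "(xmon t :: 'k mpol) \<in> Pol (n - d)" "(xmon t :: 'k mpol) \<notin> J_ideal n I d"
      using that by (simp_all add: J_ideal_eq)
    then show ?thesis using l unfolding r_inv_def top_degree_le_iff by (metis homog_xmon)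
  qed
  then show ?r by blast
next
  assume r: ?r
  show ?l unfolding r_inv_def top_degree_le_iff
  proof (intro allI ballI impI)
    fix r f assume f: "f \<in> Pol (n - d)" "homog (int r) f" "f \<notin> J_ideal n I d"
    then obtain t where "t \<in> supp f" "t \<notin> lms" by (auto simp: J_ideal_eq)
    then show "ereal (real r) \<le> z" using f(1,2) r by (fastforce simp: homog_def Pol_iff)
  qed
qed

text \<open>In \<open>f = b + z\<close> with b in I and z in \<open>(x_{m+1}, ..., x_n)\<close>,
  both homogeneous, f and b agree on the monomials in \<open>x_1, ..., x_m\<close>. All other terms
  of b involve a later variable and are smaller, so f and b have the same leading monomial.\<close>

lemma lead_monom_Iid:
  assumes f: "f \<in> Iid m" "homog e f" "f \<noteq> 0" and t: "lead_monom f \<in> monoms m"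
  shows "lead_monom f \<in> lms"
proof -
  obtain a y where ay: "a \<in> I" "y \<in> Xid m" "f = a + y" using f(1) by (auto simp: Iid_def)
  define b z where "b = hc e a" and "z = hc e y"
  have bz: "b \<in> I" "z \<in> Xid m" "homog e b" "f = b + z"
    using ay hcI Xid_hc hc_add[of e a y] hc_homog[OF f(2), of e] by (auto simp: b_def z_def)
  let ?t = "lead_monom f"
  have coef_eq: "coef b u = coef f u" if "u \<in> monoms m" for u
    using bz that by (force simp: Xid_def lookup_add in_keys_iff)
  have tb: "?t \<in> supp b" using lead_monom_in[OF f(3)] coef_eq[OF t] by (simp add: in_keys_iff)
  have "drl_less u ?t" if u: "u \<in> supp b" "u \<noteq> ?t" for u
  proof (cases "u \<in> monoms m")
    case True
    then show ?thesis using coef_eq[OF True] u lead_monom_max by (simp add: in_keys_iff)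
  next
    case False
    have "u \<in> monoms n" using u I_Pol[OF bz(1)] by (auto simp: Pol_iff)
    moreover have "mdeg u = mdeg ?t" using homogD[OF bz(3)] u(1) tb by (metis of_nat_eq_iff)
    ultimately show ?thesis using drl_less_if_not_monoms[OF t] False by blast
  qed
  then have "lead_monom b = ?t" using tb by (intro lead_monom_eqI) auto
  moreover have "b \<noteq> 0" using tb by auto
  ultimately show ?thesis using bz(1) unfolding lms_def by (metis (mono_tags, lifting) mem_Collect_eq)
qed

text \<open>Division with remainder modulo \<open>Iid m\<close>: as long as the leading monomial
  lies in \<open>in(I)\<close> or involves a variable beyond \<open>x_m\<close>, it can be cancelled
  by a homogeneous element of \<open>Iid m\<close>. This stops by well-foundedness, and not at 0
  since f is outside \<open>Iid m\<close>.\<close>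

lemma normal_form:
  assumes "f \<in> Pol n" "homog e f" "f \<notin> Iid m"
  shows "\<exists>g\<in>Pol n. homog e g \<and> f - g \<in> Iid m \<and> g \<noteq> 0 \<and> lead_monom g \<in> monoms m \<and> lead_monom g \<notin> lms"
  using assms
proof (induction "lead_monom f" arbitrary: f rule: wf_induct_rule[OF wf_drl_monoms[of n]])
  case 1
  note f = \<open>f \<in> Pol n\<close> \<open>homog e f\<close> \<open>f \<notin> Iid m\<close>
  let ?t = "lead_monom f"
  have f0: "f \<noteq> 0" using f(3) ideal_zero[OF Iid_ideal] by auto
  have t: "?t \<in> supp f" "?t \<in> monoms n" "int (mdeg ?t) = e"
    using lead_monom_in[OF f0] f by (auto simp: Pol_iff homog_def)
  show ?case
  proof (cases "?t \<in> monoms m \<and> ?t \<notin> lms")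
    case True
    then show ?thesis using f f0 ideal_zero[OF Iid_ideal] by (intro bexI[of _ f]) auto
  next
    case False
    \<comment> \<open>The cancelling element comes from I if the leading monomial is in
      \<open>in(I)\<close>; otherwise the monomial involves a variable beyond \<open>x_m\<close> and
      is itself in \<open>Xid m\<close>.\<close>
    have "\<exists>g\<in>Iid m. homog e g \<and> g \<noteq> 0 \<and> lead_monom g = ?t"
    proof (cases "?t \<in> lms")
      case True
      then show ?thesis using lms_homog I_subset_Iid t(3) by (metis subsetD)
    next
      case nl: False
      then have "xmon ?t \<in> Xid m" using False t by (simp add: Xid_def)
      then have "xmon ?t \<in> Iid m" using Xid_subset_Iid by blast
      then show ?thesis using t(3) by (intro bexI[of _ "xmon ?t"]) auto
    qed
    then obtain g where g: "g \<in> Iid m" "homog e g" "g \<noteq> 0" "lead_monom g = ?t" by blast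
    define c where "c = coef f ?t / coef g ?t"
    define h where "h = Poly_Mapping.single 0 c * g"
    have gt: "coef g ?t \<noteq> 0" using lead_monom_in[OF g(3)] g(4) by (simp add: in_keys_iff)
    have h: "h \<in> Iid m" using g by (auto simp: h_def intro: ideal_mult[OF Iid_ideal])
    have hh: "homog e h" using homog_mult[of 0 "Poly_Mapping.single 0 c" e g] g(2) by (simp add: h_def homog_single)
    have ht: "coef h ?t = coef f ?t" using coef_monom_mult_add[of 0 c g ?t] gt by (simp add: h_def c_def)
    have hs: "supp h \<subseteq> supp g" using supp_monom_mult_subset[of 0 c g] by (auto simp: h_def)
    let ?f = "f - h"
    have P: "?f \<in> Pol n" "homog e ?f" "?f \<notin> Iid m"
      using f h hh ideal_Pol[OF Iid_ideal h] ideal_add[OF Iid_ideal, of ?f m h] by (auto intro: homog_diff)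
    then have n0: "?f \<noteq> 0" using ideal_zero[OF Iid_ideal] by auto
    have l: "lead_monom ?f \<in> supp ?f" by (rule lead_monom_in[OF n0])
    then have "lead_monom ?f \<noteq> ?t" using ht by (auto simp: in_keys_iff lookup_minus)
    moreover have "lead_monom ?f \<in> supp f \<or> lead_monom ?f \<in> supp g" using l hs by (auto simp: in_keys_iff lookup_minus)
    ultimately have "drl_less (lead_monom ?f) ?t" using lead_monom_max g(4) by metis
    moreover have "lead_monom ?f \<in> monoms n" using l P(1) by (auto simp: Pol_iff)
    ultimately obtain g' where g': "g' \<in> Pol n" "homog e g'" "?f - g' \<in> Iid m" "g' \<noteq> 0" "lead_monom g' \<in> monoms m" "lead_monom g' \<notin> lms"
      using 1(1)[of ?f] P t(2) by blast
    have "f - g' \<in> Iid m" using ideal_add[OF Iid_ideal g'(3) h] by (simp add: algebra_simps)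
    then show ?thesis using g' by blast
  qed
qed

text \<open>The quotient by \<open>Iid m\<close> and the ring \<open>S_{n-m}/J_{n-m}\<close> are
  nonzero in the same degrees: normal forms give one direction, monomials outside
  \<open>in(I)\<close> the other.\<close>

lemma notin_Iid_iff:
  assumes "m \<le> n"
  shows "(\<exists>f\<in>Pol n. homog e f \<and> f \<notin> Iid m) \<longleftrightarrow> (\<exists>t\<in>monoms m. t \<notin> lms \<and> int (mdeg t) = e)"
proof
  assume "\<exists>f\<in>Pol n. homog e f \<and> f \<notin> Iid m"
  then show "\<exists>t\<in>monoms m. t \<notin> lms \<and> int (mdeg t) = e"
    using normal_form lead_monom_homog by meson
next
  assume "\<exists>t\<in>monoms m. t \<notin> lms \<and> int (mdeg t) = e"
  then obtain t where t: "t \<in> monoms m" "t \<notin> lms" "int (mdeg t) = e" by blast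
  have "xmon t \<notin> Iid m" using lead_monom_Iid[of "xmon t" m e] t by auto
  then show "\<exists>f\<in>Pol n. homog e f \<and> f \<notin> Iid m"
    using t monoms_mono[OF assms] by (intro bexI[of _ "xmon t"]) auto
qed

text \<open>From f to t, take the leading monomial of a normal form g of f: \<open>x_m * g\<close>
  lies in \<open>Iid m\<close> too, so its leading monomial is in \<open>in(I)\<close>. From t to f,
  take a homogeneous g in I with leading monomial \<open>x_m * t\<close>, drop the terms involving
  variables beyond \<open>x_m\<close>, and divide the rest by \<open>x_m\<close>; the order makes
  this division possible.\<close>

lemma colon_Iid_iff:
  assumes "1 \<le> m" "m \<le> n"
  shows "(\<exists>f\<in>Pol n. homog e f \<and> f \<notin> Iid m \<and> xvar m * f \<in> Iid m) \<longleftrightarrow>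
         (\<exists>t\<in>monoms m. t \<notin> lms \<and> evar m + t \<in> lms \<and> int (mdeg t) = e)"
proof
  assume "\<exists>f\<in>Pol n. homog e f \<and> f \<notin> Iid m \<and> xvar m * f \<in> Iid m"
  then obtain f where f: "f \<in> Pol n" "homog e f" "f \<notin> Iid m" "xvar m * f \<in> Iid m" by blast
  then obtain g where g: "g \<in> Pol n" "homog e g" "f - g \<in> Iid m" "g \<noteq> 0" "lead_monom g \<in> monoms m" "lead_monom g \<notin> lms"
    using normal_form by blast
  have x: "(xvar m :: 'k mpol) \<in> Pol n" using assms by simp
  have "xvar m * g = xvar m * f - xvar m * (f - g)" by (simp add: algebra_simps)
  then have "xvar m * g \<in> Iid m" using ideal_diff[OF Iid_ideal f(4) ideal_mult[OF Iid_ideal x g(3)]] by simp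
  moreover have "homog (1 + e) (xvar m * g)" using homog_mult[of 1 "xvar m" e g] g(2) by simp
  ultimately have "evar m + lead_monom g \<in> lms"
    using lead_monom_Iid[of "xvar m * g" m] g assms by (auto simp: lead_monom_xmon_mult)
  then show "\<exists>t\<in>monoms m. t \<notin> lms \<and> evar m + t \<in> lms \<and> int (mdeg t) = e"
    using g lead_monom_homog by blast
next
  assume "\<exists>t\<in>monoms m. t \<notin> lms \<and> evar m + t \<in> lms \<and> int (mdeg t) = e"
  then obtain t where t: "t \<in> monoms m" "t \<notin> lms" "evar m + t \<in> lms" "int (mdeg t) = e" by blast
  from lms_homog[OF t(3)] obtain g where
    g: "g \<in> I" "g \<noteq> 0" "homog (int (mdeg (evar m + t))) g" "lead_monom g = evar m + t" .
  let ?r = "restr (monoms m) g"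
  have tm: "evar m + t \<in> monoms m" using t assms by simp
  have "\<exists>s. u = evar m + s" if u: "u \<in> supp ?r" for u
  proof (cases "u = evar m + t")
    case False
    then have "drl_less u (evar m + t)" using u g(4) lead_monom_max by force
    moreover have "mdeg u = mdeg (evar m + t)" using homogD[OF g(3), of u] u by simp
    ultimately have "m \<in> supp u" using u by (intro drl_less_divisible) auto
    then show ?thesis by (rule monom_split)
  qed blast
  then obtain f where f: "?r = xvar m * f" using xmon_divide by blast
  have lr: "lead_monom ?r = evar m + t"
    by (rule lead_monom_eqI) (use g lead_monom_in[OF g(2)] lead_monom_max[of _ g] tm in auto)
  have "evar m + t \<in> supp ?r" using lead_monom_in[OF g(2)] g(4) tm by simp
  then have f0: "f \<noteq> 0" using f by auto
  then have lf: "lead_monom f = t" using lr f lead_monom_xmon_mult[OF f0, of "evar m"] by simp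
  have "homog (int (mdeg (evar m + t))) ?r" using g(3) by (rule homog_restr)
  then have hf: "homog e f" using f t(4) homog_xmon_mult_iff[of "evar m" e f] by simp
  have "?r \<in> Pol n" using g(1) I_Pol by simp
  then have fP: "f \<in> Pol n" using f xmon_mult_in_Pol by metis
  have "restr (- monoms m) g \<in> Xid m" using I_Pol[OF g(1)] by (auto simp: Xid_def)
  then have "g - restr (- monoms m) g \<in> Iid m"
    using ideal_diff[OF Iid_ideal] I_subset_Iid Xid_subset_Iid g(1) by blast
  moreover have "g - restr (- monoms m) g = ?r" using restr_Compl[of "monoms m" g] by (metis add_diff_cancel_right')
  ultimately have "xvar m * f \<in> Iid m" using f by simp
  moreover have "f \<notin> Iid m" using lead_monom_Iid[of f m e] hf f0 lf t by auto
  ultimately show "\<exists>f\<in>Pol n. homog e f \<and> f \<notin> Iid m \<and> xvar m * f \<in> Iid m" using fP hf by blast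
qed

lemma c_inv_le_iff':
  "c_inv n I i \<le> z \<longleftrightarrow>
   (i < n \<longrightarrow> (\<forall>e. (\<exists>f\<in>Pol n. homog e f \<and> f \<notin> Iid (n - i) \<and> xvar (n - i) * f \<in> Iid (n - i)) \<longrightarrow> ereal (real_of_int e) \<le> z))"
proof (cases "i < n")
  case True
  then have *: "(\<exists>f\<in>Pol n. homog e f \<and> f \<notin> Iid (n - i) \<and> xvar (n - i) * f \<in> Iid (n - i)) \<longleftrightarrow>
         (\<exists>t\<in>monoms (n - i). t \<notin> lms \<and> evar (n - i) + t \<in> lms \<and> int (mdeg t) = e)" for e
    by (intro colon_Iid_iff) auto
  show ?thesis unfolding c_inv_le_iff * using True by (metis of_int_of_nat_eq)
qed (simp add: c_inv_le_iff)

lemma r_inv_le_iff':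
  "r_inv n I d \<le> z \<longleftrightarrow> (\<forall>e. (\<exists>f\<in>Pol n. homog e f \<and> f \<notin> Iid (n - d)) \<longrightarrow> ereal (real_of_int e) \<le> z)"
  unfolding r_inv_le_iff notin_Iid_iff[OF diff_le_self] by (metis of_int_of_nat_eq)

end

section \<open>Dimension\<close>

abbreviation coset :: "nat \<Rightarrow> 'k::field mpol set \<Rightarrow> 'k mpol \<Rightarrow> 'k mpol set" where
  "coset n I f \<equiv> I +>\<^bsub>poly_ring n\<^esub> f"

lemma coset_eq_iff:
  fixes I :: "'k::field mpol set"
  assumes "ideal I (poly_ring n)" "f \<in> Pol n" "g \<in> Pol n"
  shows "coset n I f = coset n I g \<longleftrightarrow> f - g \<in> I"
proof -
  interpret cring "poly_ring n :: 'k mpol ring" by (rule cring_poly_ring)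
  show ?thesis
    using quotient_eq_iff_same_a_r_cos[OF assms] assms by (simp add: a_minus_def a_inv_poly_ring)
qed

lemma carrier_Quot: "carrier (poly_ring n Quot I) = coset n I ` Pol n"
  by (auto simp: FactRing_def A_RCOSETS_def')

lemma Quot_mult:
  "ideal I (poly_ring n) \<Longrightarrow> f \<in> Pol n \<Longrightarrow> g \<in> Pol n \<Longrightarrow>
   coset n I f \<otimes>\<^bsub>poly_ring n Quot I\<^esub> coset n I g = coset n I (f * g)"
  by (simp add: FactRing_def ideal.rcoset_mult_add)

lemma prime_ideal_poly_ringI:
  fixes Q :: "'k::field mpol set"
  assumes "ideal Q (poly_ring n)" "1 \<notin> Q"
    and "\<And>f g. f \<in> Pol n \<Longrightarrow> g \<in> Pol n \<Longrightarrow> f * g \<in> Q \<Longrightarrow> f \<in> Q \<or> g \<in> Q"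
  shows "primeideal Q (poly_ring n)"
  by (rule primeidealI) (use assms cring_poly_ring Pol_one in auto)

lemma primeideal_poly_ringD:
  fixes Q :: "'k::field mpol set"
  assumes "primeideal Q (poly_ring n)"
  shows "ideal Q (poly_ring n)" "1 \<notin> Q"
    "f \<in> Pol n \<Longrightarrow> g \<in> Pol n \<Longrightarrow> f * g \<in> Q \<Longrightarrow> f \<in> Q \<or> g \<in> Q"
proof -
  interpret primeideal Q "poly_ring n" by (rule assms)
  show "ideal Q (poly_ring n)" by (rule ideal_axioms)
  show "1 \<notin> Q"
  proof
    assume "1 \<in> Q"
    then have "r \<in> Q" if "r \<in> Pol n" for r using ideal_mult[OF ideal_axioms that] by fastforce
    then show False using I_notcarr ideal_Pol[OF ideal_axioms] by blast
  qed
  show "f \<in> Q \<or> g \<in> Q" if "f \<in> Pol n" "g \<in> Pol n" "f * g \<in> Q"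
    using I_prime[of f g] that by simp
qed

section \<open>Primes disjoint from a multiplicative set, and chains of primes in the
  quotient\<close>

lemma ideal_adjoin:
  fixes Q :: "'k::field mpol set"
  assumes Q: "ideal Q (poly_ring n)" and a: "a \<in> Pol n"
  shows "ideal {q + r * a | q r. q \<in> Q \<and> r \<in> Pol n} (poly_ring n)" (is "ideal ?A _")
  unfolding ideal_poly_ring_iff
proof (intro conjI ballI)
  show "?A \<subseteq> Pol n" using ideal_Pol[OF Q] a by auto
  show "0 \<in> ?A" using ideal_zero[OF Q] by (intro CollectI exI[of _ 0]) simp
next
  fix f g assume "f \<in> ?A" "g \<in> ?A"
  then obtain q r q' r' where "f = q + r * a" "g = q' + r' * a" "q \<in> Q" "q' \<in> Q" "r \<in> Pol n" "r' \<in> Pol n"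
    by blast
  then show "f + g \<in> ?A" using ideal_add[OF Q]
    by (intro CollectI exI[of _ "q + q'"] exI[of _ "r + r'"]) (simp add: distrib_right)
next
  fix s f :: "'k mpol" assume "s \<in> Pol n" "f \<in> ?A"
  then obtain q r where "f = q + r * a" "q \<in> Q" "r \<in> Pol n" by blast
  then show "s * f \<in> ?A" using ideal_mult[OF Q \<open>s \<in> Pol n\<close>] \<open>s \<in> Pol n\<close>
    by (intro CollectI exI[of _ "s * q"] exI[of _ "s * r"]) (simp add: distrib_left mult.assoc)
qed

lemma ideal_chain_Union:
  fixes \<A> :: "'k::field mpol set set"
  assumes "\<A> \<noteq> {}" "\<And>A. A \<in> \<A> \<Longrightarrow> ideal A (poly_ring n)"
    and chain: "\<And>A B. A \<in> \<A> \<Longrightarrow> B \<in> \<A> \<Longrightarrow> A \<subseteq> B \<or> B \<subseteq> A"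
  shows "ideal (\<Union>\<A>) (poly_ring n)"
  unfolding ideal_poly_ring_iff
proof (intro conjI ballI)
  show "\<Union>\<A> \<subseteq> Pol n" using assms(2) ideal_Pol by blast
  show "0 \<in> \<Union>\<A>" using assms(1,2) ideal_zero by blast
next
  fix a b assume "a \<in> \<Union>\<A>" "b \<in> \<Union>\<A>"
  then obtain A A' where "A \<in> \<A>" "a \<in> A" "A' \<in> \<A>" "b \<in> A'" by blast
  then have "\<exists>A\<in>\<A>. a \<in> A \<and> b \<in> A" using chain[of A A'] by blast
  then show "a + b \<in> \<Union>\<A>" using assms(2) ideal_add by blast
next
  fix r a :: "'k mpol" assume "r \<in> Pol n" "a \<in> \<Union>\<A>"
  then show "r * a \<in> \<Union>\<A>" using assms(2) ideal_mult by blast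
qed

text \<open>Zorn's lemma gives an ideal maximal among those that contain A and avoid T, and such an
  ideal is prime: if f and g are outside, both enlarged ideals meet T, and the product of the two
  elements of T would lie in Q as soon as f g does.\<close>

lemma prime_ideal_disjoint_exists:
  fixes A :: "'k::field mpol set"
  assumes A: "ideal A (poly_ring n)"
    and T: "1 \<in> T" "\<And>s t. s \<in> T \<Longrightarrow> t \<in> T \<Longrightarrow> s * t \<in> T" "A \<inter> T = {}"
  shows "\<exists>Q. primeideal Q (poly_ring n) \<and> A \<subseteq> Q \<and> Q \<inter> T = {}"
proof -
  let ?F = "{Q. ideal Q (poly_ring n) \<and> A \<subseteq> Q \<and> Q \<inter> T = {}}"
  have "\<exists>M\<in>?F. \<forall>X\<in>?F. M \<subseteq> X \<longrightarrow> X = M"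
  proof (rule subset_Zorn_nonempty)
    show "?F \<noteq> {}" using A T by blast
    fix \<C> assume c: "\<C> \<noteq> {}" "subset.chain ?F \<C>"
    then have sub: "\<C> \<subseteq> ?F" and ch: "\<And>X Y. X \<in> \<C> \<Longrightarrow> Y \<in> \<C> \<Longrightarrow> X \<subseteq> Y \<or> Y \<subseteq> X"
      by (auto simp: subset_chain_def)
    have "ideal (\<Union>\<C>) (poly_ring n)"
      using c(1) sub ch by (intro ideal_chain_Union) auto
    then show "\<Union>\<C> \<in> ?F" using c(1) sub by blast
  qed
  then obtain Q where "Q \<in> ?F" and max: "\<forall>X\<in>?F. Q \<subseteq> X \<longrightarrow> X = Q" by (rule bexE)
  then have Q: "ideal Q (poly_ring n)" "A \<subseteq> Q" "Q \<inter> T = {}" by simp_all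
  have meets: "\<exists>q\<in>Q. \<exists>r\<in>Pol n. q + r * a \<in> T" if a: "a \<in> Pol n" "a \<notin> Q" for a
  proof (rule ccontr)
    let ?X = "{q + r * a | q r. q \<in> Q \<and> r \<in> Pol n}"
    assume "\<not> ?thesis"
    then have "?X \<inter> T = {}" by blast
    moreover have QX: "Q \<subseteq> ?X"
    proof
      fix q assume "q \<in> Q"
      then show "q \<in> ?X" by (intro CollectI exI[of _ q] exI[of _ 0]) simp
    qed
    moreover have "A \<subseteq> ?X" using Q(2) QX by (rule subset_trans)
    ultimately have "?X \<in> ?F" using ideal_adjoin[OF Q(1) a(1)] by (intro CollectI conjI)
    from bspec[OF max this] QX have "?X = Q" by (rule mp)
    moreover have "a \<in> ?X" using ideal_zero[OF Q(1)] by (intro CollectI exI[of _ 0] exI[of _ 1]) simp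
    ultimately show False using a(2) by blast
  qed
  have "primeideal Q (poly_ring n)"
  proof (rule prime_ideal_poly_ringI[OF Q(1)])
    show "1 \<notin> Q" using T(1) Q(3) by blast
    fix f g assume fg: "f \<in> Pol n" "g \<in> Pol n" "f * g \<in> Q"
    show "f \<in> Q \<or> g \<in> Q"
    proof (rule ccontr)
      assume "\<not> (f \<in> Q \<or> g \<in> Q)"
      then have n: "f \<notin> Q" "g \<notin> Q" by simp_all
      obtain p r where p: "p \<in> Q" "r \<in> Pol n" "p + r * f \<in> T" using meets[OF fg(1) n(1)] by blast
      obtain q s where q: "q \<in> Q" "s \<in> Pol n" "q + s * g \<in> T" using meets[OF fg(2) n(2)] by blast
      note pq = p q
      have "(p + r * f) * (q + s * g) = (q + s * g) * p + (r * f) * q + (r * s) * (f * g)"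
        by (simp add: algebra_simps)
      also have "\<dots> \<in> Q"
        using ideal_mult[OF Q(1), of "q + s * g" p] ideal_mult[OF Q(1), of "r * f" q]
          ideal_mult[OF Q(1), of "r * s" "f * g"] pq fg ideal_Pol[OF Q(1)]
        by (intro ideal_add[OF Q(1)]) simp_all
      finally show False using T(2)[OF pq(3,6)] Q(3) by blast
    qed
  qed
  then show ?thesis using Q by blast
qed

text \<open>The multiplicative set consists of the products of elements outside P with powers of x.
  A prime disjoint from it lies inside P and omits x, hence is strictly smaller than P.\<close>

lemma prime_ideal_below_exists:
  fixes A :: "'k::field mpol set"
  assumes A: "ideal A (poly_ring n)" and P: "primeideal P (poly_ring n)"
    and x: "x \<in> P" and disj: "\<And>s k. s \<in> Pol n \<Longrightarrow> s \<notin> P \<Longrightarrow> s * x ^ k \<notin> A"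
  shows "\<exists>Q. primeideal Q (poly_ring n) \<and> A \<subseteq> Q \<and> Q \<subset> P"
proof -
  let ?T = "{s * x ^ k | s k. s \<in> Pol n \<and> s \<notin> P}"
  note pp = primeideal_poly_ringD[OF P]
  have xP: "x \<in> Pol n" using ideal_Pol[OF pp(1) x] .
  have one: "1 \<in> ?T" using pp(2) by (intro CollectI exI[of _ 1] exI[of _ 0]) simp
  have "\<exists>Q. primeideal Q (poly_ring n) \<and> A \<subseteq> Q \<and> Q \<inter> ?T = {}"
  proof (rule prime_ideal_disjoint_exists[OF A one])
    fix s t assume "s \<in> ?T" "t \<in> ?T"
    then obtain a k b l where "s = a * x ^ k" "t = b * x ^ l" "a \<in> Pol n" "b \<in> Pol n" "a \<notin> P" "b \<notin> P" by blast
    then have "s * t = (a * b) * x ^ (k + l)" "a * b \<in> Pol n" "a * b \<notin> P"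
      using pp(3) by (auto simp: power_add algebra_simps)
    then show "s * t \<in> ?T" by blast
  qed (use disj in blast)
  then obtain Q where Q: "primeideal Q (poly_ring n)" "A \<subseteq> Q" "Q \<inter> ?T = {}" by blast
  have "Q \<subseteq> P"
  proof
    fix s assume s: "s \<in> Q"
    then have "s \<in> Pol n" using ideal_Pol[OF primeideal_poly_ringD(1)[OF Q(1)]] by blast
    moreover have "s * x ^ 0 \<notin> ?T" using s Q(3) by auto
    ultimately show "s \<in> P" by blast
  qed
  moreover have "1 * x ^ 1 \<in> ?T" using pp(2) Pol_one by blast
  then have "x \<notin> Q" using Q(3) by auto
  ultimately show ?thesis using Q x by blast
qed

lemma primeideal_Quot:
  fixes I :: "'k::field mpol set"
  assumes I: "ideal I (poly_ring n)" and P: "primeideal P (poly_ring n)" and sub: "I \<subseteq> P"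
  shows "primeideal (coset n I ` P) (poly_ring n Quot I)"
proof -
  interpret cring "poly_ring n :: 'k mpol ring" by (rule cring_poly_ring)
  note pp = primeideal_poly_ringD[OF P]
  have mem: "f \<in> P" if f: "f \<in> Pol n" "coset n I f \<in> coset n I ` P" for f
  proof -
    obtain p where p: "p \<in> P" "coset n I f = coset n I p" using f by blast
    then have "f - p \<in> P" using coset_eq_iff[OF I f(1), of p] ideal_Pol[OF pp(1)] sub by auto
    then show ?thesis using ideal_add[OF pp(1), of "f - p" p] p(1) by simp
  qed
  show ?thesis
  proof (rule primeidealI)
    show "ideal (coset n I ` P) (poly_ring n Quot I)" by (rule ring_ideal_imp_quot_ideal[OF I pp(1)])
    show "cring (poly_ring n Quot I)" by (rule ideal.quotient_is_cring[OF I cring_poly_ring])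
    have "coset n I 1 \<notin> coset n I ` P" using mem[of 1] pp(2) by auto
    then show "carrier (poly_ring n Quot I) \<noteq> coset n I ` P" using imageI[OF Pol_one, of "coset n I"] by (metis carrier_Quot)
  next
    fix a b assume ab: "a \<in> carrier (poly_ring n Quot I)" "b \<in> carrier (poly_ring n Quot I)"
      "a \<otimes>\<^bsub>poly_ring n Quot I\<^esub> b \<in> coset n I ` P"
    then obtain f g where fg: "f \<in> Pol n" "g \<in> Pol n" "a = coset n I f" "b = coset n I g"
      by (auto simp: carrier_Quot)
    then have "f * g \<in> P" using ab(3) mem[of "f * g"] Quot_mult[OF I] by auto
    then show "a \<in> coset n I ` P \<or> b \<in> coset n I ` P" using pp(3)[of f g] fg by blast
  qed
qed

lemma krull_dim_Quot_ge:
  fixes I :: "'k::field mpol set"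
  assumes I: "ideal I (poly_ring n)" and sub: "I \<subseteq> P 0"
    and P: "\<And>i. i \<le> m \<Longrightarrow> primeideal (P i) (poly_ring n)" "\<And>i. i < m \<Longrightarrow> P i \<subset> P (Suc i)"
  shows "enat m \<le> krull_dim (poly_ring n Quot I)"
proof -
  have subi: "i \<le> m \<Longrightarrow> I \<subseteq> P i" for i
  proof (induction i)
    case (Suc i)
    then show ?case using P(2)[of i] by auto
  qed (use sub in simp)
  let ?P = "\<lambda>i. coset n I ` P i"
  have "primeideal (?P i) (poly_ring n Quot I)" if "i \<le> m" for i
    using primeideal_Quot[OF I P(1)[OF that] subi[OF that]] .
  moreover have "?P i \<subset> ?P (Suc i)" if i: "i < m" for i
  proof -
    obtain f where f: "f \<in> P (Suc i)" "f \<notin> P i" using P(2)[OF i] by blast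
    note a = primeideal_poly_ringD(1)[OF P(1)[of i]] and b = primeideal_poly_ringD(1)[OF P(1)[of "Suc i"]]
    have "coset n I f \<notin> ?P i"
    proof
      assume "coset n I f \<in> ?P i"
      then obtain p where p: "p \<in> P i" "coset n I f = coset n I p" by blast
      have "f - p \<in> P i" using coset_eq_iff[OF I, of f p] ideal_Pol[OF b f(1)] ideal_Pol[OF a p(1)] p subi[of i] i by auto
      then show False using ideal_add[OF a, of "f - p" p] p(1) f(2) i by simp
    qed
    then show ?thesis using f(1) P(2)[OF i] by blast
  qed
  ultimately have "enat m \<in> {enat m | m. \<exists>P :: nat \<Rightarrow> 'k mpol set set.
      (\<forall>i\<le>m. primeideal (P i) (poly_ring n Quot I)) \<and> (\<forall>i<m. P i \<subset> P (Suc i))}"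
    by (intro CollectI exI[of _ m] conjI refl exI[of _ ?P]) auto
  then show ?thesis unfolding krull_dim_def by (rule Sup_upper)
qed

lemma primeideal_irrelevant: "primeideal {f \<in> Pol n. coef f 0 = (0::'k::field)} (poly_ring n)"
proof (rule prime_ideal_poly_ringI)
  show "ideal {f \<in> Pol n. coef f 0 = (0::'k)} (poly_ring n)"
    by (auto simp: ideal_poly_ring_iff lookup_add coef_mult_0)
qed (auto simp: coef_mult_0)

lemma xvar_power: "xvar j ^ k = (xmon (Poly_Mapping.single j k) :: 'k::field mpol)"
proof (induction k)
  case (Suc k)
  then show ?case by (simp add: xmon_add[symmetric] evar_def single_add[symmetric])
qed simp

section \<open>From the dimension to bounded degrees\<close>

context graded_ideal
begin

lemma Iid_component:
  assumes "f \<in> Pol n" "\<And>e. hc e f \<in> Iid m"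
  shows "f \<in> Iid m"
proof -
  have "f = (\<Sum>e\<in>(\<lambda>t. int (mdeg t)) ` supp f. hc e f)" by (rule hc_expand) auto
  then show ?thesis using assms(2) ideal_sum[OF Iid_ideal] by metis
qed

text \<open>A monomial whose degree exceeds the sum of the given exponents has some exponent above
  its own bound, hence lies in \<open>Iid m\<close>.\<close>

lemma bounded_if_powers_in:
  assumes pw: "\<And>j. j \<in> {1..n} \<Longrightarrow> \<exists>k. xvar j ^ k \<in> Iid m"
  shows "\<exists>b::int. \<forall>e f. f \<in> Pol n \<longrightarrow> homog e f \<longrightarrow> f \<notin> Iid m \<longrightarrow> e \<le> b"
proof -
  obtain k where k: "\<And>j. j \<in> {1..n} \<Longrightarrow> xvar j ^ k j \<in> Iid m" using pw by metis
  define b where "b = (\<Sum>j\<in>{1..n}. k j)"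
  have big: "xmon t \<in> Iid m" if t: "t \<in> monoms n" "mdeg t > b" for t
  proof -
    have "mdeg t = (\<Sum>j\<in>{1..n}. coef t j)" using t(1) by (intro mdeg_superset) (auto simp: monoms_def)
    then have "\<exists>j\<in>{1..n}. k j < coef t j" using t(2) sum_mono[of "{1..n}" "coef t" k] unfolding b_def
      by (metis linorder_not_less)
    then obtain j where j: "j \<in> {1..n}" "k j < coef t j" by blast
    have e: "t = Poly_Mapping.update j (coef t j - k j) t + Poly_Mapping.single j (k j)" (is "t = ?s + _")
      by (rule poly_mapping_eqI) (use j in \<open>auto simp: lookup_add lookup_update lookup_single when_def\<close>)
    then have "?s \<in> monoms n" using t(1) by (metis monoms_add_iff)
    then have "xmon ?s * xvar j ^ k j \<in> Iid m" using k[OF j(1)] by (intro ideal_mult[OF Iid_ideal]) auto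
    then show ?thesis by (subst e) (simp add: xmon_add xvar_power)
  qed
  have "e \<le> int b" if f: "f \<in> Pol n" "homog e f" "f \<notin> Iid m" for e f
  proof (rule ccontr)
    assume e: "\<not> e \<le> int b"
    have "Poly_Mapping.single t (coef f t) \<in> Iid m" if t: "t \<in> supp f" for t
    proof -
      have "xmon t \<in> Iid m" using f(1) t homogD[OF f(2) t] e by (intro big) (auto simp: Pol_iff)
      then have "Poly_Mapping.single 0 (coef f t) * xmon t \<in> Iid m" by (intro ideal_mult[OF Iid_ideal]) auto
      then show ?thesis by (metis single_eq_xmon)
    qed
    then have "f \<in> Iid m" by (subst mpol_expand) (rule ideal_sum[OF Iid_ideal])
    then show False using f(3) by blast
  qed
  then show ?thesis by blast
qed

text \<open>With unbounded degrees some variable is not nilpotent modulo \<open>Iid m\<close>.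
  Inverting it together with the elements of nonzero constant term leaves a prime strictly below the
  irrelevant ideal.\<close>

lemma prime_above_if_unbounded:
  assumes unb: "\<nexists>b::int. \<forall>e f. f \<in> Pol n \<longrightarrow> homog e f \<longrightarrow> f \<notin> Iid m \<longrightarrow> e \<le> b"
  shows "\<exists>P. primeideal P (poly_ring n) \<and> Iid m \<subseteq> P \<and> P \<subset> {f \<in> Pol n. coef f 0 = 0}"
proof -
  obtain j where j: "j \<in> {1..n}" "\<And>k. xvar j ^ k \<notin> Iid m" using bounded_if_powers_in unb by blast
  show ?thesis
  proof (rule prime_ideal_below_exists[OF Iid_ideal primeideal_irrelevant])
    have "(evar j) \<noteq> 0" by (metis mdeg_0 mdeg_evar zero_neq_one)
    then show "xvar j \<in> {f \<in> Pol n. coef f 0 = 0}" using j(1) by (auto simp: xmon_def lookup_single)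
    fix s :: "'k mpol" and k assume s: "s \<in> Pol n" "s \<notin> {f \<in> Pol n. coef f 0 = 0}"
    show "s * xvar j ^ k \<notin> Iid m"
    proof
      assume a: "s * xvar j ^ k \<in> Iid m"
      let ?c = "coef s 0"
      \<comment> \<open>Only the nonzero constant term of s contributes to the degree k component of
        \<open>s * x_j ^ k\<close>, so that a power of \<open>x_j\<close> would lie in
        \<open>Iid m\<close>.\<close>
      have "hc 0 s = Poly_Mapping.single 0 ?c"
        by (rule poly_mapping_eqI) (auto simp: hc_def coef_restr lookup_single when_def)
      then have "hc (int k) (xvar j ^ k * s) = xvar j ^ k * Poly_Mapping.single 0 ?c"
        using hc_homog_mult[of "int k" "xvar j ^ k" "int k" s] by (simp add: xvar_power)
      then have "xvar j ^ k * Poly_Mapping.single 0 ?c \<in> Iid m"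
        using Iid_hc[OF a, of "int k"] by (simp add: mult.commute)
      then have "Poly_Mapping.single 0 (inverse ?c) * (xvar j ^ k * Poly_Mapping.single 0 ?c) \<in> Iid m"
        by (rule ideal_mult[OF Iid_ideal, rotated]) simp
      also have "Poly_Mapping.single 0 (inverse ?c) * (xvar j ^ k * Poly_Mapping.single 0 ?c) =
          xvar j ^ k * (Poly_Mapping.single 0 (inverse ?c) * Poly_Mapping.single 0 ?c)" by (simp add: ac_simps)
      also have "Poly_Mapping.single 0 (inverse ?c) * Poly_Mapping.single 0 ?c = (1 :: 'k mpol)"
        using s by (simp add: mult_single)
      finally show False using j(2) by simp
    qed
  qed
qed

text \<open>Filter-regularity means that \<open>x_m\<close> can be cancelled modulo
  \<open>Iid m\<close> in all degrees above b. If \<open>s * x_m ^ k\<close> were in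
  \<open>Iid m\<close> with s outside P, then a large power of a variable outside P would push s
  into these degrees, and cancelling would put its product with s into P.\<close>

lemma prime_below_filter_regular:
  assumes m: "m \<in> {1..n}"
    and P: "primeideal P (poly_ring n)" "Iid (m - 1) \<subseteq> P" "P \<subset> {f \<in> Pol n. coef f 0 = 0}"
    and bound: "\<And>e f. f \<in> Pol n \<Longrightarrow> homog e f \<Longrightarrow> xvar m * f \<in> Iid m \<Longrightarrow> f \<notin> Iid m \<Longrightarrow> e \<le> b"
  shows "\<exists>Q. primeideal Q (poly_ring n) \<and> Iid m \<subseteq> Q \<and> Q \<subset> P"
proof (rule prime_ideal_below_exists[OF Iid_ideal P(1)])
  note pp = primeideal_poly_ringD[OF P(1)]
  have x: "xvar m \<in> Pol n" using m by auto
  have "xvar m \<in> Xid (m - 1)" using m by (auto simp: Xid_def)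
  then show "xvar m \<in> P" using Xid_subset_Iid P(2) by blast
  have "\<exists>l\<in>{1..n}. xvar l \<notin> P"
  proof (rule ccontr)
    assume "\<not> ?thesis"
    then have "irrelevant_ideal n \<subseteq> P"
      unfolding irrelevant_ideal_def by (intro genideal_subset[OF pp(1)]) (auto simp: evar_def)
    then show False using P(3) unfolding irrelevant_ideal_eq by blast
  qed
  then obtain l where l: "l \<in> {1..n}" "xvar l \<notin> P" by blast
  have powl: "xvar l ^ k \<notin> P" for k
  proof (induction k)
    case (Suc k)
    have "xvar l \<in> P \<or> xvar l ^ k \<in> P" if "xvar l * xvar l ^ k \<in> P"
      using l(1) that by (intro pp(3)) simp_all
    then show ?case using Suc l(2) by auto
  qed (use pp(2) in simp)
  have cancel: "f \<in> Iid m" if "homog e f" "f \<in> Pol n" "e > b" "xvar m ^ k * f \<in> Iid m" for k e f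
    using that
  proof (induction k arbitrary: e f)
    case (Suc k)
    have "homog (1 + e) (xvar m * f)" using homog_mult[of 1 "xvar m" e f] Suc.prems(1) by simp
    moreover have "xvar m ^ k * (xvar m * f) \<in> Iid m" using Suc.prems(4) by (simp add: ac_simps)
    moreover have "xvar m * f \<in> Pol n" using x Suc.prems(2) by (rule Pol_mult)
    ultimately have "xvar m * f \<in> Iid m"
      using Suc.prems(3) by (intro Suc.IH[of "1 + e" "xvar m * f"]) simp_all
    from bound[OF Suc.prems(2,1) this] Suc.prems(3) show ?case by (cases "f \<in> Iid m") simp_all
  qed simp
  fix s :: "'k mpol" and k assume s: "s \<in> Pol n" "s \<notin> P"
  show "s * xvar m ^ k \<notin> Iid m"
  proof
    assume a: "s * xvar m ^ k \<in> Iid m"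
    \<comment> \<open>The components of \<open>x_l ^ N * s\<close> vanish below degree N, and every
      degree from N on exceeds b.\<close>
    define N where "N = nat (b + 1)"
    let ?u = "xvar l ^ N :: 'k mpol"
    have uP: "?u \<in> Pol n" using l by simp
    have "?u * s \<in> Iid m"
    proof (rule Iid_component)
      show "?u * s \<in> Pol n" using uP s by simp
      fix e
      have h: "hc e (?u * s) = ?u * hc (e - int N) s"
        by (rule hc_homog_mult) (simp add: xvar_power)
      show "hc e (?u * s) \<in> Iid m"
      proof (cases "e < int N")
        case True
        then have "hc (e - int N) s = 0" by (intro homog_neg[OF homog_hc]) simp
        then show ?thesis using h ideal_zero[OF Iid_ideal] by simp
      next
        case False
        then have "e > b" unfolding N_def by linarith
        have "xvar m ^ k * (?u * s) = ?u * (s * xvar m ^ k)" by (simp add: ac_simps)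
        then have "xvar m ^ k * (?u * s) \<in> Iid m" using ideal_mult[OF Iid_ideal uP a] by (simp only:)
        then have "hc (int k + e) (xvar m ^ k * (?u * s)) \<in> Iid m" by (rule Iid_hc)
        moreover have "hc (int k + e) (xvar m ^ k * (?u * s)) = xvar m ^ k * hc e (?u * s)"
          using hc_homog_mult[of "int k" "xvar m ^ k" "int k + e" "?u * s"] by (simp add: xvar_power)
        ultimately show ?thesis using cancel[OF homog_hc _ \<open>e > b\<close>] uP s by simp
      qed
    qed
    moreover have "Iid m \<subseteq> Iid (m - 1)"
      unfolding Iid_def Xid_def using monoms_mono[of "m - 1" m] by fastforce
    ultimately have "?u * s \<in> P" using P(2) by blast
    then show False using pp(3)[OF uP s(1)] powl s(2) by blast
  qed
qed

text \<open>Each filter-regular variable lowers the dimension, so that a chain of primes ending in the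
  irrelevant ideal can be extended downwards \<open>d\<close> times.\<close>

lemma bounded_if_krull_dim:
  assumes dim: "krull_dim (poly_ring n Quot I) \<le> enat d" and d: "d \<le> n"
    and bound: "\<And>i. i < d \<Longrightarrow> \<exists>b::int. \<forall>e f. f \<in> Pol n \<longrightarrow> homog e f \<longrightarrow>
        xvar (n - i) * f \<in> Iid (n - i) \<longrightarrow> f \<notin> Iid (n - i) \<longrightarrow> e \<le> b"
  shows "\<exists>b::int. \<forall>e f. f \<in> Pol n \<longrightarrow> homog e f \<longrightarrow> f \<notin> Iid (n - d) \<longrightarrow> e \<le> b"
proof (rule ccontr)
  assume unb: "\<not> ?thesis"
  let ?M = "{f \<in> Pol n. coef f 0 = (0::'k)}"
  \<comment> \<open>The chain at k = 0 already has one strict inclusion, given by unboundedness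
    below the irrelevant ideal. Each of the d variables adds one, and at k = d the lowest prime
    contains \<open>Iid n = I\<close>: this makes d + 1 inclusions.\<close>
  have "\<exists>P. (\<forall>i\<le>Suc k. primeideal (P i) (poly_ring n)) \<and> (\<forall>i<Suc k. P i \<subset> P (Suc i)) \<and>
      Iid (n - (d - k)) \<subseteq> P 0 \<and> P 0 \<subset> ?M" if "k \<le> d" for k
    using that
  proof (induction k)
    case 0
    obtain Q where Q: "primeideal Q (poly_ring n)" "Iid (n - d) \<subseteq> Q" "Q \<subset> ?M"
      using prime_above_if_unbounded[OF unb] by blast
    then show ?case using primeideal_irrelevant
      by (intro exI[of _ "\<lambda>i. if i = 0 then Q else ?M"]) auto
  next
    case (Suc k)
    then obtain P where P: "\<forall>i\<le>Suc k. primeideal (P i) (poly_ring n)" "\<forall>i<Suc k. P i \<subset> P (Suc i)"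
        "Iid (n - (d - k)) \<subseteq> P 0" "P 0 \<subset> ?M" by auto
    let ?m = "n - (d - Suc k)"
    have m: "?m \<in> {1..n}" "n - (d - k) = ?m - 1" using Suc.prems d by auto
    obtain b where b: "\<forall>e f. f \<in> Pol n \<longrightarrow> homog e f \<longrightarrow> xvar ?m * f \<in> Iid ?m \<longrightarrow> f \<notin> Iid ?m \<longrightarrow> e \<le> b"
      using bound[of "d - Suc k"] Suc.prems by auto
    have "\<exists>Q. primeideal Q (poly_ring n) \<and> Iid ?m \<subseteq> Q \<and> Q \<subset> P 0"
      using P b m by (intro prime_below_filter_regular[where b = b]) auto
    then obtain Q where Q: "primeideal Q (poly_ring n)" "Iid ?m \<subseteq> Q" "Q \<subset> P 0" by blast
    let ?P = "case_nat Q P"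
    have "\<forall>i\<le>Suc (Suc k). primeideal (?P i) (poly_ring n)" using P(1) Q(1) by (auto split: nat.split)
    moreover have "\<forall>i<Suc (Suc k). ?P i \<subset> ?P (Suc i)" using P(2) Q(3) by (auto split: nat.split)
    ultimately show ?case using Q P(4) by (intro exI[of _ ?P]) auto
  qed
  from this[of d] obtain P where P: "\<forall>i\<le>Suc d. primeideal (P i) (poly_ring n)"
      "\<forall>i<Suc d. P i \<subset> P (Suc i)" "I \<subseteq> P 0" by auto
  have "enat (Suc d) \<le> krull_dim (poly_ring n Quot I)"
    using P by (intro krull_dim_Quot_ge[OF idl, of P]) auto
  then show False using dim by (metis Suc_n_not_le_n enat_ord_simps(1) order_trans)
qed

end

section \<open>Homology modulo a regular sequence\<close>

text \<open>A complex given by its degree e parts \<open>C j e\<close>, all inside one additive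
  group, with commuting operators \<open>x i\<close> of degree 1 that are compatible with the
  differential. The differential has degree 0 and starts at place 1, so every element at place 0 is
  a cycle.\<close>

locale graded_strands =
  fixes C :: "nat \<Rightarrow> int \<Rightarrow> 'v::ab_group_add set"
    and D :: "nat \<Rightarrow> 'v \<Rightarrow> 'v" and x :: "nat \<Rightarrow> 'v \<Rightarrow> 'v"
  assumes C_zero [simp]: "0 \<in> C j e"
    and C_diff: "u \<in> C j e \<Longrightarrow> v \<in> C j e \<Longrightarrow> u - v \<in> C j e"
    and D_C: "v \<in> C (Suc j) e \<Longrightarrow> D (Suc j) v \<in> C j e"
    and D_diff: "u \<in> C (Suc j) e \<Longrightarrow> v \<in> C (Suc j) e \<Longrightarrow> D (Suc j) (u - v) = D (Suc j) u - D (Suc j) v"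
    and x_C: "v \<in> C j e \<Longrightarrow> x i v \<in> C j (e + 1)"
    and x_diff: "x i (u - v) = x i u - x i v"
    and D_x: "v \<in> C (Suc j) e \<Longrightarrow> D (Suc j) (x i v) = x i (D (Suc j) v)"
    and x_commute: "x i (x k v) = x k (x i v)"
begin

text \<open>The degree e part of \<open>(x 0, ..., x (i - 1)) C_j\<close>.\<close>

primrec N :: "nat \<Rightarrow> nat \<Rightarrow> int \<Rightarrow> 'v set" where
  "N 0 j e = {0}"
| "N (Suc i) j e = {y + x i w | y w. y \<in> N i j e \<and> w \<in> C j (e - 1)}"

text \<open>\<open>H i j e\<close>: the complex reduced modulo \<open>x 0, \<dots>, x (i - 1)\<close> has nonzero homology at place \<open>j\<close>
  in degree \<open>e\<close>; \<open>Hk i j e\<close>: some nonzero class there is killed by \<open>x i\<close>.\<close>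

definition Z :: "nat \<Rightarrow> nat \<Rightarrow> int \<Rightarrow> 'v set" where
  "Z i j e = {v \<in> C j e. \<forall>k. j = Suc k \<longrightarrow> D j v \<in> N i k e}"

text \<open>\<open>Z\<close> and \<open>B\<close> are the preimages in C of the cycles and
  boundaries of the complex reduced modulo \<open>N i\<close>, so that homology is discussed with
  elements of C.\<close>

definition B :: "nat \<Rightarrow> nat \<Rightarrow> int \<Rightarrow> 'v set" where
  "B i j e = {D (Suc j) u + y | u y. u \<in> C (Suc j) e \<and> y \<in> N i j e}"

definition H :: "nat \<Rightarrow> nat \<Rightarrow> int \<Rightarrow> bool" where
  "H i j e \<longleftrightarrow> (\<exists>v\<in>Z i j e. v \<notin> B i j e)"

definition Hk :: "nat \<Rightarrow> nat \<Rightarrow> int \<Rightarrow> bool" where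
  "Hk i j e \<longleftrightarrow> (\<exists>v\<in>Z i j e. v \<notin> B i j e \<and> x i v \<in> B i j (e + 1))"

lemma C_uminus: "v \<in> C j e \<Longrightarrow> - v \<in> C j e"
  using C_diff[of 0 j e v] by simp

lemma C_add: "u \<in> C j e \<Longrightarrow> v \<in> C j e \<Longrightarrow> u + v \<in> C j e"
  using C_diff[of u j e "- v"] C_uminus by simp

lemma D_zero [simp]: "D (Suc j) 0 = 0"
  using D_diff[of 0 j 0 0] by simp

lemma x_zero [simp]: "x i 0 = 0"
  using x_diff[of i 0 0] by simp

lemma D_uminus: "v \<in> C (Suc j) e \<Longrightarrow> D (Suc j) (- v) = - D (Suc j) v"
  using D_diff[of 0 j e v] by simp

lemma D_add: "u \<in> C (Suc j) e \<Longrightarrow> v \<in> C (Suc j) e \<Longrightarrow> D (Suc j) (u + v) = D (Suc j) u + D (Suc j) v"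
  using D_diff[of u j e "- v"] C_uminus D_uminus by simp

lemma x_uminus: "x i (- v) = - x i v"
  using x_diff[of i 0 v] by simp

lemma x_add: "x i (u + v) = x i u + x i v"
  using x_diff[of i u "- v"] x_uminus by simp

lemma x_C': "v \<in> C j (e - 1) \<Longrightarrow> x i v \<in> C j e"
  using x_C[of v j "e - 1"] by simp

lemma N_C: "v \<in> N i j e \<Longrightarrow> v \<in> C j e"
  by (induction i arbitrary: v e) (auto intro: C_add x_C')

lemma N_SucI: "y \<in> N i j e \<Longrightarrow> w \<in> C j (e - 1) \<Longrightarrow> y + x i w \<in> N (Suc i) j e"
  by auto

lemma N_zero [simp]: "0 \<in> N i j e"
  by (induction i arbitrary: e) (auto intro!: exI[of _ 0])

lemma N_diff: "u \<in> N i j e \<Longrightarrow> v \<in> N i j e \<Longrightarrow> u - v \<in> N i j e"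
proof (induction i arbitrary: u v e)
  case (Suc i)
  then obtain y w y' w' where "u = y + x i w" "v = y' + x i w'" "y \<in> N i j e" "y' \<in> N i j e"
      "w \<in> C j (e - 1)" "w' \<in> C j (e - 1)" by auto
  moreover from this have "u - v = (y - y') + x i (w - w')" by (simp add: x_diff)
  ultimately show ?case using Suc.IH N_SucI C_diff by metis
qed simp

lemma N_uminus: "v \<in> N i j e \<Longrightarrow> - v \<in> N i j e"
  using N_diff[of 0 i j e v] by simp

lemma N_add: "u \<in> N i j e \<Longrightarrow> v \<in> N i j e \<Longrightarrow> u + v \<in> N i j e"
  using N_diff[of u i j e "- v"] N_uminus by simp

lemma N_mono: "v \<in> N i j e \<Longrightarrow> v \<in> N (Suc i) j e"
  using N_SucI[of v i j e 0] by simp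

lemma D_N: "v \<in> N i (Suc j) e \<Longrightarrow> D (Suc j) v \<in> N i j e"
proof (induction i arbitrary: v e)
  case (Suc i)
  then obtain y w where yw: "v = y + x i w" "y \<in> N i (Suc j) e" "w \<in> C (Suc j) (e - 1)" by auto
  then have "D (Suc j) v = D (Suc j) y + x i (D (Suc j) w)"
    using D_add[of y j e "x i w"] N_C x_C' D_x by simp
  then show ?case using Suc.IH[OF yw(2)] D_C[OF yw(3)] by auto
qed simp

lemma x_N_N: "z \<in> N i j e \<Longrightarrow> x k z \<in> N i j (e + 1)"
proof (induction i arbitrary: z e)
  case (Suc i)
  then obtain y w where yw: "z = y + x i w" "y \<in> N i j e" "w \<in> C j (e - 1)" by auto
  then have "x k z = x k y + x i (x k w)" by (simp add: x_add x_commute)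
  then show ?case using Suc.IH[OF yw(2)] x_C'[of w j e] yw(3) x_C[OF yw(3), of k] by auto
qed simp

lemma B_mono: "v \<in> B i j e \<Longrightarrow> v \<in> B (Suc i) j e"
  unfolding B_def using N_mono by blast

end

text \<open>Acyclic at every place from 1 on; the homology at place 0 is free to be nonzero. The
  operators \<open>x 0, ..., x (n - 1)\<close> form a regular sequence on each
  \<open>C j\<close>.\<close>

locale exact_strands = graded_strands +
  fixes n :: nat
  assumes DD: "v \<in> C (Suc (Suc j)) e \<Longrightarrow> D (Suc j) (D (Suc (Suc j)) v) = 0"
    and exact: "v \<in> C (Suc j) e \<Longrightarrow> D (Suc j) v = 0 \<Longrightarrow> \<exists>u\<in>C (Suc (Suc j)) e. D (Suc (Suc j)) u = v"
    and regular: "i < n \<Longrightarrow> w \<in> C j e \<Longrightarrow> x i w \<in> N i j (e + 1) \<Longrightarrow> w \<in> N i j e"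
begin

lemma D_D_N:
  assumes "u \<in> C (Suc j) e" "j = Suc k"
  shows "D j (D (Suc j) u) = 0"
  using assms DD by simp

lemma B_Z: "v \<in> B i j e \<Longrightarrow> v \<in> Z i j e"
proof -
  assume "v \<in> B i j e"
  then obtain u y where uy: "v = D (Suc j) u + y" "u \<in> C (Suc j) e" "y \<in> N i j e" by (auto simp: B_def)
  have "D j v \<in> N i k e" if k: "j = Suc k" for k
    using uy D_D_N[OF uy(2) k] D_N[of y i k e] D_add[of "D (Suc j) u" k e y] D_C[of u j e] N_C k by simp
  then show ?thesis using uy by (auto simp: Z_def C_add D_C N_C)
qed

lemma not_H_0: "\<not> H 0 (Suc j) e"
proof
  assume "H 0 (Suc j) e"
  then obtain v where v: "v \<in> C (Suc j) e" "D (Suc j) v = 0" "v \<notin> B 0 (Suc j) e" by (auto simp: H_def Z_def)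
  then obtain u where "u \<in> C (Suc (Suc j)) e" "D (Suc (Suc j)) u = v" using exact by blast
  then show False using v(3) by (auto simp: B_def)
qed

text \<open>The next three lemmas are the elementwise form of the exact sequences
  \<open>0 \<rightarrow> H\<^sub>j / x H\<^sub>j \<rightarrow> H\<^sub>j(C / x C) \<rightarrow> (0 : x)\<^bsub>H\<^sub>j\<^sub>-\<^sub>1\<^esub>(- 1) \<rightarrow> 0\<close>.\<close>

lemma H_Suc_0: "H (Suc i) 0 e \<Longrightarrow> H i 0 e"
  using B_mono[of _ i 0 e] by (auto simp: H_def Z_def)

lemma H_Suc_Suc:
  assumes "i < n" "H (Suc i) (Suc j) e"
  shows "H i (Suc j) e \<or> Hk i j (e - 1)"
proof -
  obtain v where v: "v \<in> C (Suc j) e" "D (Suc j) v \<in> N (Suc i) j e" "v \<notin> B (Suc i) (Suc j) e"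
    using assms(2) by (auto simp: H_def Z_def)
  \<comment> \<open>The class of w is the image of the class of v under the connecting homomorphism.
    It is killed by \<open>x i\<close>, since \<open>x i w\<close> is a boundary modulo
    \<open>N i\<close>.\<close>
  then obtain y w where yw: "D (Suc j) v = y + x i w" "y \<in> N i j e" "w \<in> C j (e - 1)" by auto
  have xw: "x i w = D (Suc j) v + (- y)" using yw(1) by simp
  then have xwB: "x i w \<in> B i j e" using v(1) N_uminus[OF yw(2)] unfolding B_def by blast
  have wZ: "w \<in> Z i j (e - 1)"
  proof -
    have "D j w \<in> N i k (e - 1)" if k: "j = Suc k" for k
    proof -
      have "x i w \<in> Z i j e" using xwB by (rule B_Z)
      then have "D j (x i w) \<in> N i k e" using k by (auto simp: Z_def)
      then show ?thesis using regular[OF assms(1), of "D j w" k "e - 1"] D_x[of w k "e - 1" i] D_C[of w k "e - 1"] yw(3) k by simp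
    qed
    then show ?thesis using yw(3) by (auto simp: Z_def)
  qed
  show ?thesis
  proof (cases "w \<in> B i j (e - 1)")
    case False
    then show ?thesis using wZ xwB by (auto simp: Hk_def)
  next
    case True
    then obtain u z where uz: "w = D (Suc j) u + z" "u \<in> C (Suc j) (e - 1)" "z \<in> N i j (e - 1)"
      by (auto simp: B_def)
    have xz: "x i z \<in> N i j e"
      using x_N_N[OF uz(3), of i] by simp
    \<comment> \<open>If the image of v is zero, then subtracting a multiple of \<open>x i\<close>,
      which vanishes at the next stage, turns v into a cycle of the present stage.\<close>
    let ?v = "v - x i u"
    have vC: "?v \<in> C (Suc j) e" using C_diff[OF v(1) x_C'[OF uz(2)]] .
    have "D (Suc j) ?v = y + x i w - x i (D (Suc j) u)"
      using D_diff[OF v(1) x_C'[OF uz(2)]] D_x[OF uz(2)] yw(1) by simp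
    also have "\<dots> = y + x i z" using uz(1) x_add[of i "D (Suc j) u" z] by simp
    finally have "D (Suc j) ?v \<in> N i j e" using N_add[OF yw(2) xz] by simp
    then have "?v \<in> Z i (Suc j) e" using vC by (auto simp: Z_def)
    moreover have "?v \<notin> B i (Suc j) e"
    proof
      assume "?v \<in> B i (Suc j) e"
      then obtain s q where sq: "?v = D (Suc (Suc j)) s + q" "s \<in> C (Suc (Suc j)) e" "q \<in> N i (Suc j) e"
        by (auto simp: B_def)
      have "v = D (Suc (Suc j)) s + (q + x i u)" using sq(1) by (simp add: algebra_simps)
      moreover have "q + x i u \<in> N (Suc i) (Suc j) e" using sq(3) uz(2) by auto
      ultimately show False using v(3) sq(2) unfolding B_def by blast
    qed
    ultimately show ?thesis by (auto simp: H_def)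
  qed
qed

lemma Hk_H_Suc:
  assumes "i < n" "Hk i j e"
  shows "H (Suc i) (Suc j) (e + 1)"
proof -
  obtain w where w: "w \<in> Z i j e" "w \<notin> B i j e" "x i w \<in> B i j (e + 1)" using assms(2) by (auto simp: Hk_def)
  \<comment> \<open>The element v is a preimage of w under the connecting homomorphism; it sits one
    place and one degree higher.\<close>
  then obtain v y where vy: "x i w = D (Suc j) v + y" "v \<in> C (Suc j) (e + 1)" "y \<in> N i j (e + 1)"
    by (auto simp: B_def)
  have wC: "w \<in> C j e" using w(1) by (simp add: Z_def)
  have "D (Suc j) v = - y + x i w" using vy(1) by simp
  then have "D (Suc j) v \<in> N (Suc i) j (e + 1)"
    using N_SucI[OF N_uminus[OF vy(3)]] wC by simp
  then have "v \<in> Z (Suc i) (Suc j) (e + 1)" using vy(2) by (auto simp: Z_def)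
  moreover have "v \<notin> B (Suc i) (Suc j) (e + 1)"
  proof
    assume "v \<in> B (Suc i) (Suc j) (e + 1)"
    then obtain u q s where v: "v = D (Suc (Suc j)) u + (q + x i s)" "u \<in> C (Suc (Suc j)) (e + 1)"
        "q \<in> N i (Suc j) (e + 1)" "s \<in> C (Suc j) e"
      by (auto simp: B_def)
    have "D (Suc j) v = D (Suc j) q + x i (D (Suc j) s)"
      using v DD[OF v(2)] D_x[OF v(4)] D_add[of "D (Suc (Suc j)) u" j "e + 1" "q + x i s"]
        D_add[of q j "e + 1" "x i s"] D_C[OF v(2)] N_C[OF v(3)] x_C[OF v(4)] C_add by simp
    \<comment> \<open>A boundary v makes \<open>x i\<close> times the difference of w and a boundary
      vanish modulo \<open>N i\<close>; regularity then makes w itself a boundary.\<close>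
    then have "x i (w - D (Suc j) s) = D (Suc j) q + y" using vy(1) x_diff by simp
    then have "x i (w - D (Suc j) s) \<in> N i j (e + 1)" using N_add[OF D_N[OF v(3)] vy(3)] by simp
    then have "w - D (Suc j) s \<in> N i j e"
      using regular[OF assms(1)] C_diff[OF wC D_C[OF v(4)]] by blast
    moreover have "w = D (Suc j) s + (w - D (Suc j) s)" by simp
    ultimately show False using w(2) v(4) unfolding B_def by blast
  qed
  ultimately show ?thesis by (auto simp: H_def)
qed

section \<open>Degree minus place under reduction\<close>

lemma Hk_H: "Hk i j e \<Longrightarrow> H i j e"
  by (auto simp: Hk_def H_def)

lemma x_Z: "v \<in> Z i j e \<Longrightarrow> x k v \<in> Z i j (e + 1)"
  using D_x x_C x_N_N by (auto simp: Z_def)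

lemma Hk_if_top: "H i j e \<Longrightarrow> \<not> H i j (e + 1) \<Longrightarrow> Hk i j e"
  using x_Z unfolding H_def Hk_def by blast

text \<open>Without a killed class from degree e on, multiplication by \<open>x i\<close> would give
  nonzero classes in all higher degrees.\<close>

lemma Hk_above:
  assumes "H i j e" and bound: "\<And>e. H i j e \<Longrightarrow> e \<le> b"
  shows "\<exists>e'\<ge>e. Hk i j e'"
proof (rule ccontr)
  assume n: "\<not> ?thesis"
  have "H i j (e + int k)" for k
  proof (induction k)
    case (Suc k)
    then show ?case using Hk_if_top[of i j "e + int k"] n by (force simp: ac_simps)
  qed (use assms in simp)
  from bound[OF this[of "nat (b - e) + 1"]] show False by linarith
qed

text \<open>Each reduction moves homology up by at most one place. At i = n this becomes the bound
  on the length of minimal resolutions.\<close>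

lemma H_vanish: "i \<le> n \<Longrightarrow> H i j e \<Longrightarrow> j \<le> i"
proof (induction i arbitrary: j e)
  case 0
  then show ?case using not_H_0 by (cases j) auto
next
  case (Suc i)
  show ?case
  proof (cases j)
    case (Suc j')
    then show ?thesis using H_Suc_Suc[of i j' e] Suc.prems Suc.IH Hk_H by fastforce
  qed simp
qed

text \<open>Place 0 is left out since its degrees may be unbounded. New classes in positive places
  come from kernels one place below, at the same value of degree minus place; only the kernel at
  place 0 adds something not counted before. Conversely a class at place j + 1 has, by boundedness,
  a killed class above it, which survives at the next stage. The bound m must vary in the induction,
  since that boundedness is itself an instance of the induction hypothesis.\<close>

lemma positive_homology_bound_iff:
  assumes bound: "\<And>i. i < d \<Longrightarrow> \<exists>b. \<forall>e. Hk i 0 e \<longrightarrow> e \<le> b" and "i \<le> d" "i \<le> n"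
  shows "(\<forall>j e. H i (Suc j) e \<longrightarrow> e - int (Suc j) \<le> m) \<longleftrightarrow> (\<forall>k<i. \<forall>e. Hk k 0 e \<longrightarrow> e \<le> m)"
  using assms(2,3)
proof (induction i arbitrary: m)
  case 0
  then show ?case using not_H_0 by simp
next
  case (Suc i)
  have IH: "(\<forall>j e. H i (Suc j) e \<longrightarrow> e - int (Suc j) \<le> m) \<longleftrightarrow> (\<forall>k<i. \<forall>e. Hk k 0 e \<longrightarrow> e \<le> m)" for m
    using Suc by simp
  have "\<forall>k<i. \<exists>b. \<forall>e. Hk k 0 e \<longrightarrow> e \<le> b" using bound Suc.prems by simp
  then obtain b where b: "\<And>k e. k < i \<Longrightarrow> Hk k 0 e \<Longrightarrow> e \<le> b k" by metis
  \<comment> \<open>For i = 0 the maximum of the empty set is an unspecified value, but then no k <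
    i exists.\<close>
  have "e \<le> Max (b ` {..<i})" if "k < i" "Hk k 0 e" for k e
  proof -
    have "b k \<le> Max (b ` {..<i})" using that(1) by (intro Max_ge) auto
    then show ?thesis using b[OF that] by simp
  qed
  then obtain M where M: "\<And>j e. H i (Suc j) e \<Longrightarrow> e - int (Suc j) \<le> M" using IH by metis
  show ?case
  proof
    assume l: "\<forall>j e. H (Suc i) (Suc j) e \<longrightarrow> e - int (Suc j) \<le> m"
    have Hk: "e - int j \<le> m" if "Hk i j e" for j e
      using l Hk_H_Suc[OF _ that] Suc.prems by force
    have "e - int (Suc j) \<le> m" if "H i (Suc j) e" for j e
    proof -
      \<comment> \<open>The bound M only serves to find a killed class above degree e; the sharp
        bound m is then read off at the next stage.\<close>
      have "e' \<le> M + int (Suc j)" if "H i (Suc j) e'" for e' using M[OF that] by simp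
      from Hk_above[OF that this] obtain e' where e': "e' \<ge> e" "Hk i (Suc j) e'" by blast
      from Hk[OF e'(2)] e'(1) show ?thesis by simp
    qed
    then have "\<forall>k<i. \<forall>e. Hk k 0 e \<longrightarrow> e \<le> m" using IH by blast
    then show "\<forall>k<Suc i. \<forall>e. Hk k 0 e \<longrightarrow> e \<le> m" using Hk[of 0] by (auto simp: less_Suc_eq)
  next
    assume r: "\<forall>k<Suc i. \<forall>e. Hk k 0 e \<longrightarrow> e \<le> m"
    then have "\<forall>k<i. \<forall>e. Hk k 0 e \<longrightarrow> e \<le> m" by (blast intro: less_SucI)
    then have *: "\<And>j e. H i (Suc j) e \<Longrightarrow> e - int (Suc j) \<le> m" using IH by blast
    show "\<forall>j e. H (Suc i) (Suc j) e \<longrightarrow> e - int (Suc j) \<le> m"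
    proof (intro allI impI)
      fix j e assume "H (Suc i) (Suc j) e"
      then consider "H i (Suc j) e" | "Hk i j (e - 1)" using H_Suc_Suc[of i j e] Suc.prems by auto
      then show "e - int (Suc j) \<le> m"
      proof cases
        case 2
        show ?thesis
        proof (cases j)
          case 0
          then show ?thesis using 2 r by force
        next
          case (Suc j')
          then show ?thesis using *[of j' "e - 1"] Hk_H 2 by force
        qed
      qed (rule *)
    qed
  qed
qed

text \<open>Once all places are bounded, a killed class above a given one passes to the next stage
  with degree and place both raised by one, and every class of the next stage comes from one with
  the same degree minus place.\<close>

lemma homology_bound_step:
  assumes bound: "\<And>j e. H i j e \<Longrightarrow> e - int j \<le> M" and i: "i < n"
  shows "(\<forall>j e. H (Suc i) j e \<longrightarrow> e - int j \<le> m) \<longleftrightarrow> (\<forall>j e. H i j e \<longrightarrow> e - int j \<le> m)"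
proof
  assume l: "\<forall>j e. H (Suc i) j e \<longrightarrow> e - int j \<le> m"
  show "\<forall>j e. H i j e \<longrightarrow> e - int j \<le> m"
  proof (intro allI impI)
    fix j e assume h: "H i j e"
    have "e' \<le> M + int j" if "H i j e'" for e' using bound[OF that] by simp
    from Hk_above[OF h this] obtain e' where e': "e' \<ge> e" "Hk i j e'" by blast
    then show "e - int j \<le> m" using l Hk_H_Suc[OF i e'(2)] by force
  qed
next
  assume r: "\<forall>j e. H i j e \<longrightarrow> e - int j \<le> m"
  show "\<forall>j e. H (Suc i) j e \<longrightarrow> e - int j \<le> m"
  proof (intro allI impI)
    fix j e assume h: "H (Suc i) j e"
    show "e - int j \<le> m"
    proof (cases j)
      case 0
      then show ?thesis using h r H_Suc_0 by fastforce
    next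
      case (Suc j')
      then have "H i j e \<or> H i j' (e - 1)" using H_Suc_Suc[OF i] h Hk_H by blast
      then show ?thesis using r Suc by force
    qed
  qed
qed

text \<open>At stage d the positive places are governed by the kernels at place 0, and place 0 is
  added as a separate term. From there to stage n all degrees are bounded and the supremum of degree
  minus place stays constant.\<close>

lemma homology_bound_iff:
  assumes bound: "\<And>i. i < d \<Longrightarrow> \<exists>b. \<forall>e. Hk i 0 e \<longrightarrow> e \<le> b"
    and bound': "\<exists>b. \<forall>e. H d 0 e \<longrightarrow> e \<le> b" and d: "d \<le> n"
  shows "(\<forall>j e. H n j e \<longrightarrow> e - int j \<le> m) \<longleftrightarrow>
    (\<forall>i<d. \<forall>e. Hk i 0 e \<longrightarrow> e \<le> m) \<and> (\<forall>e. H d 0 e \<longrightarrow> e \<le> m)"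
proof -
  have split: "(\<forall>j. P j) \<longleftrightarrow> P 0 \<and> (\<forall>j. P (Suc j))" for P :: "nat \<Rightarrow> bool"
    by (metis not0_implies_Suc)
  have base: "(\<forall>j e. H d j e \<longrightarrow> e - int j \<le> m) \<longleftrightarrow>
      (\<forall>i<d. \<forall>e. Hk i 0 e \<longrightarrow> e \<le> m) \<and> (\<forall>e. H d 0 e \<longrightarrow> e \<le> m)" for m
    by (subst split) (use positive_homology_bound_iff[OF bound order_refl d, of m] in auto)
  have "\<forall>k\<in>{..<d}. \<exists>b. \<forall>e. Hk k 0 e \<longrightarrow> e \<le> b" using bound by simp
  then obtain b where b: "\<And>k e. k < d \<Longrightarrow> Hk k 0 e \<Longrightarrow> e \<le> b k" by (metis lessThan_iff)
  obtain b' where b': "\<And>e. H d 0 e \<Longrightarrow> e \<le> b'" using bound' by blast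
  define M where "M = Max (insert b' (b ` {..<d}))"
  have "b' \<le> M" "\<And>k. k < d \<Longrightarrow> b k \<le> M" by (auto simp: M_def)
  then have M: "\<forall>j e. H d j e \<longrightarrow> e - int j \<le> M"
    unfolding base using b b' by (meson order_trans)
  have "\<forall>m. (\<forall>j e. H i j e \<longrightarrow> e - int j \<le> m) \<longleftrightarrow> (\<forall>j e. H d j e \<longrightarrow> e - int j \<le> m)"
    if "d \<le> i" "i \<le> n" for i
    using that
  proof (induction i rule: dec_induct)
    case (step i)
    then have "\<And>j e. H i j e \<Longrightarrow> e - int j \<le> M" using M by (meson Suc_leD)
    then show ?case using homology_bound_step[of i M] step by simp
  qed simp
  then show ?thesis using base d by simp
qed

end

section \<open>Minimal graded free complexes\<close>

abbreviation Free :: "nat \<Rightarrow> nat \<Rightarrow> 'k::field vect set" where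
  "Free n b \<equiv> carrier (free_module n b)"

text \<open>The degree e component of a vector when the l-th basis vector has degree
  \<open>a l\<close>.\<close>

definition vc :: "(nat \<Rightarrow> int) \<Rightarrow> int \<Rightarrow> 'k::field vect \<Rightarrow> 'k vect" where
  "vc a e v = (\<lambda>l. hc (e - a l) (v l))"

definition unit_vec :: "nat \<Rightarrow> 'k::field vect" where
  "unit_vec l = (\<lambda>k. if k = l then 1 else 0)"

lemma Free_iff: "v \<in> Free n b \<longleftrightarrow> (\<forall>l<b. v l \<in> Pol n) \<and> (\<forall>l\<ge>b. v l = 0)"
  by (simp add: free_module_def)

lemma Free_Pol: "v \<in> Free n b \<Longrightarrow> v l \<in> Pol n"
  by (cases "l < b") (auto simp: Free_iff)

lemma Free_zero [simp]: "0 \<in> Free n b"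
  by (simp add: Free_iff)

lemma Free_add: "u \<in> Free n b \<Longrightarrow> v \<in> Free n b \<Longrightarrow> u + v \<in> Free n b"
  and Free_diff: "u \<in> Free n b \<Longrightarrow> v \<in> Free n b \<Longrightarrow> u - v \<in> Free n b"
  and Free_smult: "s \<in> Pol n \<Longrightarrow> v \<in> Free n b \<Longrightarrow> (\<lambda>l. s * v l) \<in> Free n b"
  by (simp_all add: Free_iff)

lemma Free_sum: "(\<And>i. i \<in> A \<Longrightarrow> v i \<in> Free n b) \<Longrightarrow> sum v A \<in> Free n b"
  by (induction A rule: infinite_finite_induct) (auto simp: Free_add)

lemma Free_vc: "v \<in> Free n b \<Longrightarrow> vc a e v \<in> Free n b"
  by (simp add: Free_iff vc_def)

lemma unit_vec_Free: "l < b \<Longrightarrow> unit_vec l \<in> Free n b"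
  by (auto simp: Free_iff unit_vec_def)

lemma free_part_iff: "v \<in> free_part n b a e \<longleftrightarrow> v \<in> Free n b \<and> (\<forall>l. homog (e - a l) (v l))"
proof -
  have "homog (e - a l) (v l)" if "v \<in> Free n b" "\<not> l < b" for l
    using that by (simp add: Free_iff)
  then show ?thesis unfolding free_part_def by blast
qed

lemma free_part_vc: "v \<in> Free n b \<Longrightarrow> vc a e v \<in> free_part n b a e"
  by (simp add: free_part_iff Free_vc) (simp add: vc_def)

lemma vc_add: "vc a e (u + v) = vc a e u + vc a e v"
  by (rule ext) (simp add: vc_def hc_add)

lemma vc_0 [simp]: "vc a e 0 = 0"
  by (rule ext) (simp add: vc_def)

lemma vc_sum: "vc a e (sum v A) = (\<Sum>i\<in>A. vc a e (v i))"
  by (induction A rule: infinite_finite_induct) (simp_all only: sum.infinite sum.empty sum.insert vc_add vc_0 not_False_eq_True)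

lemma vc_free_part: "v \<in> free_part n b a d \<Longrightarrow> vc a e v = (if d = e then v else 0)"
proof
  fix l
  assume "v \<in> free_part n b a d"
  then show "vc a e v l = (if d = e then v else 0) l"
    using hc_homog[of "d - a l" "v l" "e - a l"] by (simp add: free_part_iff vc_def)
qed

lemma sum_fun_apply: "sum v A l = (\<Sum>i\<in>A. v i l)" for v :: "'i \<Rightarrow> 'a \<Rightarrow> 'b::comm_monoid_add"
  by (induction A rule: infinite_finite_induct) simp_all

lemma vc_expand:
  assumes "v \<in> Free n b"
  obtains E where "finite E" "v = (\<Sum>e\<in>E. vc a e v)"
proof
  let ?E = "\<Union>l<b. (\<lambda>t. int (mdeg t) + a l) ` supp (v l)"
  show fin: "finite ?E" by simp
  show "v = (\<Sum>e\<in>?E. vc a e v)"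
  proof
    fix l
    show "v l = (\<Sum>e\<in>?E. vc a e v) l"
    proof (cases "l < b")
      case True
      have inj: "inj_on (\<lambda>e. e - a l) ?E" by (auto intro: inj_onI)
      have sub: "(\<lambda>t. int (mdeg t)) ` supp (v l) \<subseteq> (\<lambda>e. e - a l) ` ?E"
      proof
        fix d assume "d \<in> (\<lambda>t. int (mdeg t)) ` supp (v l)"
        then obtain t where t: "t \<in> supp (v l)" "d = int (mdeg t)" by blast
        then have "int (mdeg t) + a l \<in> ?E" using True by blast
        moreover have "d = int (mdeg t) + a l - a l" using t by simp
        ultimately show "d \<in> (\<lambda>e. e - a l) ` ?E" by blast
      qed
      have "v l = (\<Sum>d\<in>(\<lambda>e. e - a l) ` ?E. hc d (v l))"
        using fin sub by (intro hc_expand finite_imageI)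
      also have "\<dots> = (\<Sum>e\<in>?E. hc (e - a l) (v l))"
        by (subst sum.reindex[OF inj]) simp
      finally show ?thesis by (simp add: sum_fun_apply vc_def)
    next
      case False
      then show ?thesis using assms by (simp add: sum_fun_apply vc_def Free_iff)
    qed
  qed
qed

text \<open>Stage i divides by \<open>x_{n-i}\<close>, so the variables are killed in the order
  \<open>x_n, x_{n-1}, ..., x_1\<close>. The value 0 from n on makes the family total and compatible
  with the differential.\<close>

definition lin :: "nat \<Rightarrow> nat \<Rightarrow> 'k::field mpol" where
  "lin n i = (if i < n then xvar (n - i) else 0)"

lemma lin_Pol [simp]: "lin n i \<in> Pol n"
  by (auto simp: lin_def)

lemma homog_lin [simp]: "homog 1 (lin n i)"
  by (simp add: lin_def)

text \<open>Avoiding \<open>monoms (m - 1)\<close> means lying in \<open>(x_m, ..., x_n)\<close>.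
  The terms that involve only \<open>x_1, ..., x_m\<close> are then divisible by \<open>x_m\<close>,
  and the others lie in \<open>(x_{m+1}, ..., x_n)\<close>.\<close>

lemma avoid_monoms_split:
  fixes y :: "'k::field mpol"
  assumes y: "y \<in> Pol n" "homog e y" "supp y \<inter> monoms (m - 1) = {}" and m: "1 \<le> m" "m \<le> n"
  shows "\<exists>y' w. y = y' + xvar m * w \<and> y' \<in> Pol n \<and> homog e y' \<and> supp y' \<inter> monoms m = {} \<and>
    w \<in> Pol n \<and> homog (e - 1) w"
proof -
  let ?r = "restr (monoms m) y"
  have "\<exists>s. u = evar m + s" if u: "u \<in> supp ?r" for u
  proof -
    have um: "u \<in> monoms m" "u \<notin> monoms (m - 1)" using u y(3) by auto
    have "m \<in> supp u"
    proof (rule ccontr)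
      assume n: "m \<notin> supp u"
      have "i \<in> {1..m - 1}" if i: "i \<in> supp u" for i
      proof -
        have "i \<in> {1..m}" "i \<noteq> m" using um(1) i n by (auto simp: monoms_def)
        then show ?thesis by auto
      qed
      then show False using um(2) by (auto simp: monoms_def)
    qed
    then show ?thesis by (rule monom_split)
  qed
  then obtain w where w: "?r = xvar m * w" using xmon_divide by blast
  have "?r \<in> Pol n" using y(1) by simp
  then have "w \<in> Pol n" using w xmon_mult_in_Pol by metis
  moreover have "homog (e - 1) w"
    using homog_xmon_mult_iff[of "evar m" "e - 1" w] homog_restr[OF y(2), of "monoms m"] w by simp
  moreover have "y = restr (- monoms m) y + xvar m * w" using restr_Compl[of "monoms m" y] w by (simp add: add.commute)
  ultimately show ?thesis using y by (intro exI[of _ "restr (- monoms m) y"] exI[of _ w]) (auto simp: homog_restr)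
qed

lemma avoid_monoms_add:
  fixes w :: "'k::field mpol"
  assumes "supp y \<inter> monoms m = {}" "1 \<le> m"
  shows "supp (y + xvar m * w) \<inter> monoms (m - 1) = {}"
proof -
  have "supp (xvar m * w) \<inter> monoms (m - 1) = {}" using assms(2) by (auto simp: supp_xmon_mult)
  moreover have "supp y \<inter> monoms (m - 1) = {}" using assms(1) monoms_mono[of "m - 1" m] by auto
  ultimately show ?thesis using Poly_Mapping.keys_add[of y "xvar m * w"] by blast
qed

text \<open>An unbounded complex indexed by all places; a finite resolution is continued by modules
  of rank 0. Exactness is required from place 1 on, and minimality says that the images have no
  constant terms.\<close>

locale graded_free_complex =
  fixes n :: nat and b :: "nat \<Rightarrow> nat" and a :: "nat \<Rightarrow> nat \<Rightarrow> int" and D :: "nat \<Rightarrow> 'k::field vect \<Rightarrow> 'k vect"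
  assumes D_Free: "v \<in> Free n (b (Suc j)) \<Longrightarrow> D (Suc j) v \<in> Free n (b j)"
    and D_plus: "u \<in> Free n (b (Suc j)) \<Longrightarrow> v \<in> Free n (b (Suc j)) \<Longrightarrow> D (Suc j) (u + v) = D (Suc j) u + D (Suc j) v"
    and D_smult: "s \<in> Pol n \<Longrightarrow> v \<in> Free n (b (Suc j)) \<Longrightarrow> D (Suc j) (\<lambda>l. s * v l) = (\<lambda>l. s * D (Suc j) v l)"
    and D_degree: "v \<in> free_part n (b (Suc j)) (a (Suc j)) e \<Longrightarrow> D (Suc j) v \<in> free_part n (b j) (a j) e"
    and D_exact: "v \<in> Free n (b (Suc j)) \<Longrightarrow> D (Suc j) v = 0 \<longleftrightarrow> v \<in> D (Suc (Suc j)) ` Free n (b (Suc (Suc j)))"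
    and D_minimal: "v \<in> Free n (b (Suc j)) \<Longrightarrow> coef (D (Suc j) v l) 0 = 0"
begin

lemma D_0 [simp]: "D (Suc j) 0 = 0"
  using D_plus[of 0 j 0] by simp

lemma D_minus:
  assumes "u \<in> Free n (b (Suc j))" "v \<in> Free n (b (Suc j))"
  shows "D (Suc j) (u - v) = D (Suc j) u - D (Suc j) v"
  using D_plus[OF Free_diff[OF assms] assms(2)] by (simp add: algebra_simps)

lemma D_sum:
  "(\<And>i. i \<in> A \<Longrightarrow> v i \<in> Free n (b (Suc j))) \<Longrightarrow> D (Suc j) (sum v A) = (\<Sum>i\<in>A. D (Suc j) (v i))"
  by (induction A rule: infinite_finite_induct) (simp_all add: D_plus Free_sum)

text \<open>A vector is the sum of its components; the differential maps the component of degree d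
  to degree d, so taking degree e on the image selects one summand.\<close>

lemma D_vc:
  assumes v: "v \<in> Free n (b (Suc j))"
  shows "D (Suc j) (vc (a (Suc j)) e v) = vc (a j) e (D (Suc j) v)"
proof -
  let ?c = "\<lambda>e. vc (a (Suc j)) e v"
  obtain E where E: "finite E" "v = (\<Sum>e\<in>E. ?c e)" using vc_expand[OF v] by blast
  have d: "D (Suc j) (?c e) \<in> free_part n (b j) (a j) e" for e
    using D_degree[OF free_part_vc[OF v]] .
  have "vc (a j) e (D (Suc j) v) = vc (a j) e (D (Suc j) (\<Sum>e\<in>E. ?c e))" using E(2) by simp
  also have "\<dots> = (\<Sum>d\<in>E. if d = e then D (Suc j) (?c d) else 0)"
    using vc_free_part[OF d] by (simp add: D_sum Free_vc v vc_sum)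
  also have "\<dots> = (if e \<in> E then D (Suc j) (?c e) else 0)" using E(1) by simp
  also have "\<dots> = D (Suc j) (?c e)"
  proof (cases "e \<in> E")
    case False
    have "?c e = vc (a (Suc j)) e (\<Sum>e\<in>E. ?c e)" using E(2) by simp
    also have "\<dots> = (\<Sum>d\<in>E. if d = e then ?c d else 0)"
      using vc_free_part[OF free_part_vc[OF v]] by (simp add: vc_sum)
    also have "\<dots> = 0" using False by (intro sum.neutral) auto
    finally show ?thesis using False by simp
  qed simp
  finally show ?thesis ..
qed

sublocale graded_strands "\<lambda>j e. free_part n (b j) (a j) e" D "\<lambda>i v l. lin n i * v l"
proof
  fix j i k e and u v :: "'k vect"
  show "0 \<in> free_part n (b j) (a j) e" by (simp add: free_part_iff)
  show "u - v \<in> free_part n (b j) (a j) e"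
    if "u \<in> free_part n (b j) (a j) e" "v \<in> free_part n (b j) (a j) e"
    using that by (simp add: free_part_iff Free_diff homog_diff)
  show "D (Suc j) v \<in> free_part n (b j) (a j) e" if "v \<in> free_part n (b (Suc j)) (a (Suc j)) e"
    using that by (rule D_degree)
  show "D (Suc j) (u - v) = D (Suc j) u - D (Suc j) v"
    if "u \<in> free_part n (b (Suc j)) (a (Suc j)) e" "v \<in> free_part n (b (Suc j)) (a (Suc j)) e"
    using that by (simp add: free_part_iff D_minus)
  show "(\<lambda>l. lin n i * v l) \<in> free_part n (b j) (a j) (e + 1)" if "v \<in> free_part n (b j) (a j) e"
  proof -
    have "homog (e + 1 - a j l) (lin n i * v l)" for l
      using homog_mult[OF homog_lin[of n i], of "e - a j l" "v l"] that
      by (simp add: free_part_iff algebra_simps)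
    then show ?thesis using that by (simp add: free_part_iff Free_smult)
  qed
  show "D (Suc j) (\<lambda>l. lin n i * v l) = (\<lambda>l. lin n i * D (Suc j) v l)"
    if "v \<in> free_part n (b (Suc j)) (a (Suc j)) e"
    using that by (simp add: free_part_iff D_smult)
qed (simp_all add: fun_eq_iff algebra_simps)

text \<open>Membership in \<open>(x_{n-i+1}, ..., x_n) F_j\<close> becomes a condition on single
  monomials. Regularity of the variables then reduces to a remark on exponents.\<close>

lemma N_eq:
  "i \<le> n \<Longrightarrow> N i j e = {v \<in> free_part n (b j) (a j) e. \<forall>l. supp (v l) \<inter> monoms (n - i) = {}}"
proof (induction i arbitrary: e)
  case 0
  have "v = 0" if "v \<in> Free n (b j)" "\<forall>l. supp (v l) \<inter> monoms n = {}" for v :: "'k vect"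
  proof
    fix l
    have "supp (v l) \<subseteq> monoms n" using Free_Pol[OF that(1)] by (simp add: Pol_iff)
    then have "supp (v l) = {}" using that(2) by blast
    then show "v l = 0 l" by simp
  qed
  then show ?case by (auto simp: free_part_iff)
next
  case (Suc i)
  let ?m = "n - i"
  have m: "1 \<le> ?m" "?m \<le> n" "n - Suc i = ?m - 1" using Suc.prems by auto
  have lin: "lin n i = xvar ?m" using Suc.prems by (simp add: lin_def)
  show ?case
  proof (intro equalityI subsetI)
    fix v assume v: "v \<in> N (Suc i) j e"
    then obtain y w where yw: "v = y + (\<lambda>l. lin n i * w l)" "y \<in> N i j e" by auto
    then have "supp (y l) \<inter> monoms ?m = {}" for l using Suc by auto
    then have "supp (v l) \<inter> monoms (n - Suc i) = {}" for l
      using avoid_monoms_add[OF _ m(1), of "y l" "w l"] by (simp only: yw(1) m(3) lin plus_fun_apply)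
    then show "v \<in> {v \<in> free_part n (b j) (a j) e. \<forall>l. supp (v l) \<inter> monoms (n - Suc i) = {}}"
      using N_C[OF v] by blast
  next
    fix v :: "'k vect" assume "v \<in> {v \<in> free_part n (b j) (a j) e. \<forall>l. supp (v l) \<inter> monoms (n - Suc i) = {}}"
    then have v: "v \<in> Free n (b j)" "\<And>l. homog (e - a j l) (v l)" "\<And>l. supp (v l) \<inter> monoms (?m - 1) = {}"
      by (simp_all add: free_part_iff)
    have "\<exists>y w :: 'k vect. \<forall>l. v l = y l + xvar ?m * w l \<and> y l \<in> Pol n \<and> homog (e - a j l) (y l) \<and>
        supp (y l) \<inter> monoms ?m = {} \<and> w l \<in> Pol n \<and> homog (e - a j l - 1) (w l)"
      using avoid_monoms_split[OF Free_Pol[OF v(1)] v(2,3) m(1,2)] by metis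
    then obtain y w :: "'k vect" where yw: "\<And>l. v l = y l + xvar ?m * w l" "\<And>l. y l \<in> Pol n" "\<And>l. homog (e - a j l) (y l)"
        "\<And>l. supp (y l) \<inter> monoms ?m = {}" "\<And>l. w l \<in> Pol n" "\<And>l. homog (e - a j l - 1) (w l)" by blast
    define y' w' where "y' = (\<lambda>l. if l < b j then y l else 0)" and "w' = (\<lambda>l. if l < b j then w l else 0)"
    have "y' \<in> N i j e" using yw Suc by (auto simp: y'_def free_part_iff Free_iff)
    moreover have "w' \<in> free_part n (b j) (a j) (e - 1)"
      using yw by (auto simp: w'_def free_part_iff Free_iff algebra_simps)
    moreover have "v = y' + (\<lambda>l. lin n i * w' l)"
      using yw(1) v(1) by (auto simp: fun_eq_iff y'_def w'_def lin Free_iff not_less)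
    ultimately show "v \<in> N (Suc i) j e" by auto
  qed
qed

sublocale exact_strands "\<lambda>j e. free_part n (b j) (a j) e" D "\<lambda>i v l. lin n i * v l" n
proof
  fix j e and v :: "'k vect"
  show "D (Suc j) (D (Suc (Suc j)) v) = 0" if "v \<in> free_part n (b (Suc (Suc j))) (a (Suc (Suc j))) e"
    using that D_exact[of "D (Suc (Suc j)) v" j] D_Free[of v "Suc j"] by (simp add: free_part_iff)
  show "\<exists>u\<in>free_part n (b (Suc (Suc j))) (a (Suc (Suc j))) e. D (Suc (Suc j)) u = v"
    if v: "v \<in> free_part n (b (Suc j)) (a (Suc j)) e" "D (Suc j) v = 0"
  proof -
    obtain u where u: "u \<in> Free n (b (Suc (Suc j)))" "v = D (Suc (Suc j)) u"
      using D_exact v by (auto simp: free_part_iff)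
    then have "D (Suc (Suc j)) (vc (a (Suc (Suc j))) e u) = v"
      using D_vc[OF u(1), of e] vc_free_part[OF v(1), of e] by simp
    then show ?thesis using free_part_vc[OF u(1)] by blast
  qed
next
  fix i j e and w :: "'k vect"
  assume i: "i < n" and w: "w \<in> free_part n (b j) (a j) e" and xw: "(\<lambda>l. lin n i * w l) \<in> N i j (e + 1)"
  \<comment> \<open>Multiplication by \<open>x_{n-i}\<close> does not change whether a monomial
    involves a variable beyond \<open>x_{n-i}\<close>.\<close>
  have "supp (w l) \<inter> monoms (n - i) = {}" for l
  proof -
    have "supp (lin n i * w l) \<inter> monoms (n - i) = {}"
      using xw N_eq[of i j "e + 1"] i by (simp only: less_imp_le) blast
    then have "supp (xvar (n - i) * w l) \<inter> monoms (n - i) = {}" using i by (simp add: lin_def)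
    then show ?thesis using i by (auto simp: supp_xmon_mult)
  qed
  then show "w \<in> N i j e" using w i by (simp add: N_eq)
qed

text \<open>After all n variables only constant coefficients are left and, by minimality, the
  differential vanishes there. The homology is the tensor product of \<open>F_j\<close> with k, with
  one class for each basis vector.\<close>

lemma H_top_iff: "H n j e \<longleftrightarrow> (\<exists>l<b j. a j l = e)"
proof
  have m0: "monoms 0 = {0}" by (auto simp: monoms_def)
  assume "H n j e"
  then obtain v where v: "v \<in> free_part n (b j) (a j) e" "v \<notin> B n j e" by (auto simp: H_def Z_def)
  have "v \<notin> N n j e"
  proof
    assume "v \<in> N n j e"
    moreover have "v = D (Suc j) 0 + v" by simp
    ultimately show False using v(2) C_zero unfolding B_def by blast
  qed
  then obtain l where l: "0 \<in> supp (v l)" using v(1) by (auto simp: N_eq m0)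
  have "v l \<noteq> 0" using l by auto
  then have "l < b j" using v(1) by (auto simp: free_part_iff Free_iff not_less[symmetric])
  moreover have "int (mdeg 0) = e - a j l" using v(1) l homogD by (metis free_part_iff)
  ultimately show "\<exists>l<b j. a j l = e" by auto
next
  have m0: "monoms 0 = {0}" by (auto simp: monoms_def)
  assume "\<exists>l<b j. a j l = e"
  then obtain l where l: "l < b j" "a j l = e" by blast
  let ?v = "unit_vec l :: 'k vect"
  have v: "?v \<in> free_part n (b j) (a j) e"
    using l unit_vec_Free[OF l(1)] by (auto simp: free_part_iff) (auto simp: unit_vec_def homog_def)
  have "D j ?v \<in> N n k e" if k: "j = Suc k" for k
  proof -
    have "D (Suc k) ?v \<in> free_part n (b k) (a k) e" using D_degree v k by blast
    then show ?thesis using D_minimal[of ?v k] v k by (auto simp: N_eq m0 free_part_iff in_keys_iff)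
  qed
  then have "?v \<in> Z n j e" using v by (auto simp: Z_def)
  moreover have "?v \<notin> B n j e"
  proof
    assume "?v \<in> B n j e"
    then obtain u y where uy: "?v = D (Suc j) u + y" "u \<in> free_part n (b (Suc j)) (a (Suc j)) e" "y \<in> N n j e"
      by (auto simp: B_def)
    have "coef (?v l) 0 = coef (D (Suc j) u l) 0 + coef (y l) 0" using uy(1) by (simp add: lookup_add)
    also have "\<dots> = 0" using D_minimal[of u j l] uy(2,3) by (auto simp: N_eq m0 free_part_iff in_keys_iff)
    finally show False by (simp add: unit_vec_def)
  qed
  ultimately show "H n j e" by (auto simp: H_def)
qed

text \<open>The form of Hilbert's syzygy theorem for minimal resolutions: a basis vector beyond
  place n would give homology at a place where there is none.\<close>

lemma rank_vanish: "n < j \<Longrightarrow> b j = 0"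
  using H_vanish[of n j "a j 0"] H_top_iff[of j "a j 0"] by (cases "b j") auto

end

section \<open>The augmentation and the homology at place 0\<close>

text \<open>\<open>A\<close> chooses representatives for the augmentation \<open>F\<^sub>0 \<rightarrow> S/I\<close>.\<close>

locale graded_free_res = graded_free_complex n b a D + graded_ideal n I
  for n :: nat and b :: "nat \<Rightarrow> nat" and a :: "nat \<Rightarrow> nat \<Rightarrow> int" and D :: "nat \<Rightarrow> 'k::field vect \<Rightarrow> 'k vect"
    and I :: "'k mpol set" +
  fixes A :: "'k vect \<Rightarrow> 'k mpol"
  assumes A_Pol: "v \<in> Free n (b 0) \<Longrightarrow> A v \<in> Pol n"
    and A_plus: "u \<in> Free n (b 0) \<Longrightarrow> v \<in> Free n (b 0) \<Longrightarrow> A (u + v) - (A u + A v) \<in> I"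
    and A_smult: "s \<in> Pol n \<Longrightarrow> v \<in> Free n (b 0) \<Longrightarrow> A (\<lambda>l. s * v l) - s * A v \<in> I"
    and A_degree: "v \<in> free_part n (b 0) (a 0) e \<Longrightarrow> \<exists>f\<in>Pol n. homog e f \<and> A v - f \<in> I"
    and A_surj: "f \<in> Pol n \<Longrightarrow> \<exists>v\<in>Free n (b 0). A v - f \<in> I"
    and A_kernel: "v \<in> Free n (b 0) \<Longrightarrow> A v \<in> I \<longleftrightarrow> v \<in> D (Suc 0) ` Free n (b (Suc 0))"
begin

lemma I_trans: "f - g \<in> I \<Longrightarrow> g - h \<in> I \<Longrightarrow> f - h \<in> I"
  using ideal_add[OF idl, of "f - g" "g - h"] by simp

lemma I_sym: "f - g \<in> I \<Longrightarrow> g - f \<in> I"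
  using ideal_uminus[OF idl, of "f - g"] by simp

lemma I_cong_add: "f - f' \<in> I \<Longrightarrow> g - g' \<in> I \<Longrightarrow> (f + g) - (f' + g') \<in> I"
  using ideal_add[OF idl, of "f - f'" "g - g'"] by (simp add: algebra_simps)

lemma I_cong_mult: "s \<in> Pol n \<Longrightarrow> f - f' \<in> I \<Longrightarrow> s * f - s * f' \<in> I"
  using ideal_mult[OF idl, of s "f - f'"] by (simp add: algebra_simps)

lemma Iid_cong: "f - g \<in> I \<Longrightarrow> f \<in> Iid m \<longleftrightarrow> g \<in> Iid m"
  using ideal_add[OF Iid_ideal, of "f - g" m g] ideal_diff[OF Iid_ideal, of f m "f - g"] I_subset_Iid by fastforce

lemma A_0: "A 0 \<in> I"
proof -
  have "(0 :: 'k vect) = D (Suc 0) 0" by simp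
  then have "0 \<in> D (Suc 0) ` Free n (b (Suc 0))" using Free_zero by (rule image_eqI)
  then show ?thesis using A_kernel[OF Free_zero] by blast
qed

lemma A_minus:
  assumes "u \<in> Free n (b 0)" "v \<in> Free n (b 0)"
  shows "A (u - v) - (A u - A v) \<in> I"
  using I_sym[OF A_plus[OF Free_diff[OF assms] assms(2)]] by (simp add: algebra_simps)

lemma A_sum:
  "(\<And>i. i \<in> E \<Longrightarrow> v i \<in> Free n (b 0)) \<Longrightarrow> A (sum v E) - (\<Sum>i\<in>E. A (v i)) \<in> I"
proof (induction E rule: infinite_finite_induct)
  case (insert i E)
  have "A (v i + sum v E) - (A (v i) + A (sum v E)) \<in> I"
    using insert by (intro A_plus Free_sum) auto
  moreover have "(A (v i) + A (sum v E)) - (A (v i) + (\<Sum>i\<in>E. A (v i))) \<in> I"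
    using insert by simp
  ultimately have "A (v i + sum v E) - (A (v i) + (\<Sum>i\<in>E. A (v i))) \<in> I" by (rule I_trans)
  then show ?case using insert.hyps by (simp only: sum.insert not_False_eq_True)
qed (use A_0 in \<open>simp_all only: sum.infinite sum.empty diff_0_right not_False_eq_True\<close>)

lemma A_vc:
  assumes v: "v \<in> Free n (b 0)"
  shows "A (vc (a 0) e v) - hc e (A v) \<in> I"
proof -
  let ?c = "\<lambda>d. vc (a 0) d v"
  obtain E0 where E0: "finite E0" "v = (\<Sum>d\<in>E0. ?c d)" using vc_expand[OF v] by blast
  \<comment> \<open>The degree e is added so that it is selected from the sum even when the
    component of v there is 0: the augmentation is additive only modulo I.\<close>
  define E where "E = insert e E0"
  have 0: "?c d = 0" if "d \<notin> E0" for d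
  proof -
    have "?c d = vc (a 0) d (\<Sum>d\<in>E0. ?c d)" using E0(2) by simp
    also have "\<dots> = (\<Sum>d'\<in>E0. if d' = d then ?c d' else 0)"
      using vc_free_part[OF free_part_vc[OF v]] by (simp add: vc_sum)
    also have "\<dots> = 0" using that by (intro sum.neutral) auto
    finally show ?thesis .
  qed
  have E: "finite E" "v = (\<Sum>d\<in>E. ?c d)" "e \<in> E"
  proof -
    show "v = (\<Sum>d\<in>E. ?c d)"
    proof (cases "e \<in> E0")
      case False
      then show ?thesis using E0 0[of e] by (simp only: E_def sum.insert not_False_eq_True add_0)
    qed (use E0 in \<open>simp add: E_def insert_absorb\<close>)
  qed (use E0 in \<open>auto simp: E_def\<close>)
  have "\<forall>d. \<exists>f\<in>Pol n. homog d f \<and> A (?c d) - f \<in> I" using A_degree[OF free_part_vc[OF v]] by blast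
  then obtain f where f: "\<And>d. f d \<in> Pol n" "\<And>d. homog d (f d)" "\<And>d. A (?c d) - f d \<in> I" by metis
  have "A v - (\<Sum>d\<in>E. A (?c d)) \<in> I" using A_sum[of E ?c] Free_vc[OF v] E(2) by simp
  moreover have "(\<Sum>d\<in>E. A (?c d)) - (\<Sum>d\<in>E. f d) \<in> I"
    unfolding sum_subtractf[symmetric] using f(3) by (intro ideal_sum[OF idl])
  ultimately have "A v - (\<Sum>d\<in>E. f d) \<in> I" by (rule I_trans)
  then have "hc e (A v) - hc e (\<Sum>d\<in>E. f d) \<in> I" using hcI[of _ e] by (metis hc_diff)
  moreover have "hc e (\<Sum>d\<in>E. f d) = (\<Sum>d\<in>E. if d = e then f d else 0)"
    using hc_homog[OF f(2)] by (simp add: hc_sum)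
  moreover have "\<dots> = f e" using E(1,3) by simp
  ultimately have "hc e (A v) - f e \<in> I" by simp
  then show ?thesis using I_trans[OF f(3)[of e] I_sym] by simp
qed

lemma A_lift:
  assumes "f \<in> Pol n" "homog e f"
  shows "\<exists>v\<in>free_part n (b 0) (a 0) e. A v - f \<in> I"
proof -
  obtain v where v: "v \<in> Free n (b 0)" "A v - f \<in> I" using A_surj assms by blast
  have "hc e (A v) - f \<in> I" using hcI[OF v(2), of e] hc_homog[OF assms(2), of e] by (simp add: hc_diff)
  then have "A (vc (a 0) e v) - f \<in> I" using I_trans[OF A_vc[OF v(1)]] by blast
  then show ?thesis using free_part_vc[OF v(1)] by blast
qed

lemma A_N: "i \<le> n \<Longrightarrow> y \<in> N i 0 e \<Longrightarrow> A y \<in> Iid (n - i)"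
proof (induction i arbitrary: y e)
  case 0
  then have "y = 0" by (simp only: N.simps singleton_iff)
  then show ?case using A_0 by (simp only: diff_zero Iid_top)
next
  case (Suc i)
  then obtain y' w where yw: "y = y' + (\<lambda>l. lin n i * w l)" "y' \<in> N i 0 e" "w \<in> free_part n (b 0) (a 0) (e - 1)" by auto
  have F: "y' \<in> Free n (b 0)" "w \<in> Free n (b 0)" "(\<lambda>l. lin n i * w l) \<in> Free n (b 0)"
    using N_C[OF yw(2)] yw(3) by (auto simp: free_part_iff Free_smult)
  have "A y - (A y' + lin n i * A w) \<in> I"
    using I_trans[OF A_plus[OF F(1,3)], of "A y' + lin n i * A w"] A_smult[OF lin_Pol F(2), of i] yw(1) by simp
  moreover have "A y' \<in> Iid (n - Suc i)"
  proof -
    have "Iid (n - i) \<subseteq> Iid (n - Suc i)"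
      unfolding Iid_def Xid_def using monoms_mono[of "n - Suc i" "n - i"] by fastforce
    then show ?thesis using Suc.IH[OF _ yw(2)] Suc.prems by auto
  qed
  moreover have "lin n i * A w \<in> Iid (n - Suc i)"
  proof -
    have "lin n i \<in> Xid (n - Suc i)" using Suc.prems by (auto simp: Xid_def lin_def)
    then have "A w * lin n i \<in> Iid (n - Suc i)"
      using ideal_mult[OF Iid_ideal A_Pol[OF F(2)]] Xid_subset_Iid by blast
    then show ?thesis by (simp add: mult.commute)
  qed
  ultimately show ?case using Iid_cong ideal_add[OF Iid_ideal] by blast
qed

text \<open>Together with \<open>A_N\<close>, this identifies the image of \<open>N i 0\<close>
  under the augmentation with \<open>(x_{n-i+1}, ..., x_n)\<close> modulo I, degree by
  degree.\<close>

lemma N_lift: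
  "i \<le> n \<Longrightarrow> y \<in> Pol n \<Longrightarrow> homog e y \<Longrightarrow> supp y \<inter> monoms (n - i) = {} \<Longrightarrow> \<exists>v\<in>N i 0 e. A v - y \<in> I"
proof (induction i arbitrary: y e)
  case 0
  then have "supp y = {}" unfolding Pol_iff by (simp only: diff_zero) blast
  then have y: "y = 0" by simp
  show ?case
  proof
    show "A 0 - y \<in> I" unfolding y diff_zero by (rule A_0)
  qed (rule N_zero)
next
  case (Suc i)
  let ?m = "n - i"
  have m: "1 \<le> ?m" "?m \<le> n" "n - Suc i = ?m - 1" using Suc.prems by auto
  have lin: "lin n i = xvar ?m" using Suc.prems by (simp add: lin_def)
  obtain y' w where yw: "y = y' + xvar ?m * w" "y' \<in> Pol n" "homog e y'" "supp y' \<inter> monoms ?m = {}"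
      "w \<in> Pol n" "homog (e - 1) w"
    using avoid_monoms_split[OF Suc.prems(2,3) Suc.prems(4)[unfolded m(3)] m(1,2)] by blast
  obtain v where v: "v \<in> N i 0 e" "A v - y' \<in> I" using Suc.IH[of y' e] yw Suc.prems by auto
  obtain u where u: "u \<in> free_part n (b 0) (a 0) (e - 1)" "A u - w \<in> I" using A_lift yw by blast
  have F: "v \<in> Free n (b 0)" "u \<in> Free n (b 0)" "(\<lambda>l. lin n i * u l) \<in> Free n (b 0)"
    using N_C[OF v(1)] u(1) by (auto simp: free_part_iff Free_smult)
  have "A (v + (\<lambda>l. lin n i * u l)) - (A v + A (\<lambda>l. lin n i * u l)) \<in> I" by (rule A_plus[OF F(1,3)])
  moreover have "(A v + A (\<lambda>l. lin n i * u l)) - (y' + lin n i * w) \<in> I"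
    using I_cong_add[OF v(2) I_trans[OF A_smult[OF lin_Pol F(2)] I_cong_mult[OF lin_Pol u(2)]]] .
  ultimately have "A (v + (\<lambda>l. lin n i * u l)) - y \<in> I" using I_trans yw(1) lin by metis
  then show ?case using N_SucI[OF v(1) u(1)] by (rule bexI)
qed

text \<open>Cokernels at place 0 become quotients by \<open>Iid\<close>: the augmentation kills the
  image of the differential, and an element of the ideal of variables lifts to \<open>N i 0\<close>.
  The converse passes to homogeneous components so that all lifts stay in degree e.\<close>

lemma B_0_iff:
  assumes i: "i \<le> n" and v: "v \<in> free_part n (b 0) (a 0) e" and f: "f \<in> Pol n" "homog e f" "A v - f \<in> I"
  shows "v \<in> B i 0 e \<longleftrightarrow> f \<in> Iid (n - i)"
proof
  assume "v \<in> B i 0 e"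
  then obtain u y where uy: "v = D (Suc 0) u + y" "u \<in> Free n (b (Suc 0))" "y \<in> N i 0 e"
    by (auto simp: B_def free_part_iff)
  have F: "D (Suc 0) u \<in> Free n (b 0)" "y \<in> Free n (b 0)"
    using D_Free[OF uy(2)] N_C[OF uy(3)] by (auto simp: free_part_iff)
  have "A (D (Suc 0) u) \<in> I" using A_kernel[OF F(1)] uy(2) by blast
  then have "A (D (Suc 0) u) + A y \<in> Iid (n - i)"
    using A_N[OF i uy(3)] I_subset_Iid ideal_add[OF Iid_ideal] by blast
  then have "A v \<in> Iid (n - i)" using A_plus[OF F] uy(1) Iid_cong by blast
  then show "f \<in> Iid (n - i)" using f(3) Iid_cong by blast
next
  assume "f \<in> Iid (n - i)"
  then obtain g0 y0 where gy0: "f = g0 + y0" "g0 \<in> I" "y0 \<in> Xid (n - i)" by (auto simp: Iid_def)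
  define g y where "g = hc e g0" and "y = hc e y0"
  have gy: "f = g + y" "g \<in> I" "y \<in> Xid (n - i)" "homog e y"
    using hc_homog[OF f(2), of e] gy0 hcI Xid_hc by (auto simp: g_def y_def hc_add)
  obtain w where w: "w \<in> N i 0 e" "A w - y \<in> I"
    using N_lift[OF i _ gy(4)] gy(3) by (auto simp: Xid_def)
  have F: "v \<in> Free n (b 0)" "w \<in> Free n (b 0)" using v N_C[OF w(1)] by (auto simp: free_part_iff)
  have "(A v - A w) - (f - y) \<in> I" using ideal_diff[OF idl f(3) w(2)] by (simp add: algebra_simps)
  then have "A (v - w) - g \<in> I" using I_trans[OF A_minus[OF F]] gy(1) by simp
  then have "A (v - w) \<in> I" using ideal_add[OF idl _ gy(2)] by fastforce
  then obtain u where u: "u \<in> Free n (b (Suc 0))" "v - w = D (Suc 0) u" using A_kernel[OF Free_diff[OF F]] by blast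
  have "v - w \<in> free_part n (b 0) (a 0) e" using v N_C[OF w(1)] C_diff by blast
  then have "D (Suc 0) (vc (a (Suc 0)) e u) = v - w"
    using D_vc[OF u(1), of e] vc_free_part[of "v - w" n "b 0" "a 0" e e] u(2) by simp
  then have "v = D (Suc 0) (vc (a (Suc 0)) e u) + w" by simp
  then show "v \<in> B i 0 e" using free_part_vc[OF u(1)] w(1) unfolding B_def by blast
qed

lemma H_0_iff:
  assumes i: "i \<le> n"
  shows "H i 0 e \<longleftrightarrow> (\<exists>f\<in>Pol n. homog e f \<and> f \<notin> Iid (n - i))"
  using B_0_iff[OF i] A_degree A_lift unfolding H_def Z_def by simp meson

lemma Hk_0_iff:
  assumes i: "i < n"
  shows "Hk i 0 e \<longleftrightarrow> (\<exists>f\<in>Pol n. homog e f \<and> f \<notin> Iid (n - i) \<and> xvar (n - i) * f \<in> Iid (n - i))"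
proof -
  have lin: "lin n i = xvar (n - i)" using i by (simp add: lin_def)
  have *: "(\<lambda>l. lin n i * v l) \<in> B i 0 (e + 1) \<longleftrightarrow> xvar (n - i) * f \<in> Iid (n - i)"
    if v: "v \<in> free_part n (b 0) (a 0) e" and f: "f \<in> Pol n" "homog e f" "A v - f \<in> I" for v f
  proof (rule B_0_iff)
    have vF: "v \<in> Free n (b 0)" using v by (simp add: free_part_iff)
    show "A (\<lambda>l. lin n i * v l) - xvar (n - i) * f \<in> I"
      using I_trans[OF A_smult[OF lin_Pol vF] I_cong_mult[OF lin_Pol f(3)]] lin by metis
    show "xvar (n - i) * f \<in> Pol n" using f(1) i by simp
    show "homog (e + 1) (xvar (n - i) * f)" using homog_mult[of 1 "xvar (n - i)" e f] f(2) by (simp add: add.commute)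
  qed (use i x_C[OF v] in auto)
  show ?thesis
    using B_0_iff[of i] i A_degree A_lift * unfolding Hk_def Z_def by simp meson
qed

text \<open>Finiteness of the \<open>c_i\<close> bounds the kernels at place 0; for d < n the
  dimension then bounds place 0 at stage d. What remains is the translation of both sides into
  degrees of homology.\<close>

lemma degrees_bound_iff:
  assumes d: "d \<le> n" and dim: "d < n \<Longrightarrow> krull_dim (poly_ring n Quot I) \<le> enat d"
    and c: "\<And>i. i < d \<Longrightarrow> c_inv n I i < \<infinity>"
  shows "(\<forall>j. \<forall>l<b j. a j l - int j \<le> m) \<longleftrightarrow>
    (\<forall>i<d. c_inv n I i \<le> ereal (real_of_int m)) \<and> r_inv n I d \<le> ereal (real_of_int m)"
proof -
  have fin: "\<exists>q. \<forall>e. Hk i 0 e \<longrightarrow> e \<le> q" if i: "i < d" for i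
  proof -
    obtain r where r: "c_inv n I i \<le> ereal r"
      using c[OF i] by (cases "c_inv n I i") auto
    have "ereal (real_of_int e) \<le> ereal r" if "Hk i 0 e" for e
      using r that i d unfolding c_inv_le_iff' by (auto simp: Hk_0_iff)
    then have "\<forall>e. Hk i 0 e \<longrightarrow> e \<le> \<lfloor>r\<rfloor>" by (auto simp: le_floor_iff)
    then show ?thesis ..
  qed
  have fin': "\<exists>q. \<forall>e. H d 0 e \<longrightarrow> e \<le> q"
  proof (cases "d < n")
    case True
    have "\<exists>q::int. \<forall>e f. f \<in> Pol n \<longrightarrow> homog e f \<longrightarrow> f \<notin> Iid (n - d) \<longrightarrow> e \<le> q"
    proof (rule bounded_if_krull_dim[OF dim[OF True] d])
      fix i assume i: "i < d"
      have "i < n" using i d by simp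
      from fin[OF i] obtain q where "\<forall>e. Hk i 0 e \<longrightarrow> e \<le> q" ..
      then show "\<exists>q::int. \<forall>e f. f \<in> Pol n \<longrightarrow> homog e f \<longrightarrow>
          xvar (n - i) * f \<in> Iid (n - i) \<longrightarrow> f \<notin> Iid (n - i) \<longrightarrow> e \<le> q"
        unfolding Hk_0_iff[OF \<open>i < n\<close>] by blast
    qed
    then show ?thesis unfolding H_0_iff[OF d] by blast
  next
    case False
    \<comment> \<open>Here d = n, and the homology at place 0 lives in the finitely many generator
      degrees of \<open>F_0\<close>.\<close>
    then have "\<forall>e. H d 0 e \<longrightarrow> e \<le> Max (a 0 ` {..<b 0})" using d H_top_iff[of 0] by auto
    then show ?thesis ..
  qed
  have "(\<forall>j. \<forall>l<b j. a j l - int j \<le> m) \<longleftrightarrow> (\<forall>j e. H n j e \<longrightarrow> e - int j \<le> m)"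
    by (auto simp: H_top_iff)
  also have "\<dots> \<longleftrightarrow> (\<forall>i<d. \<forall>e. Hk i 0 e \<longrightarrow> e \<le> m) \<and> (\<forall>e. H d 0 e \<longrightarrow> e \<le> m)"
    by (rule homology_bound_iff[OF fin fin' d])
  also have "\<dots> \<longleftrightarrow> (\<forall>i<d. c_inv n I i \<le> ereal (real_of_int m)) \<and> r_inv n I d \<le> ereal (real_of_int m)"
    using d by (auto simp: c_inv_le_iff' r_inv_le_iff' Hk_0_iff H_0_iff)
  finally show ?thesis .
qed

end

section \<open>Existence of minimal covers\<close>

text \<open>A weakly decreasing subsequence of natural numbers reaches its least value and stays
  there, so its tail is constant and also counts as weakly increasing.\<close>

lemma nat_seq_mono_subseq:
  fixes s :: "nat \<Rightarrow> nat"
  shows "\<exists>g :: nat \<Rightarrow> nat. strict_mono g \<and> (\<forall>i j. i \<le> j \<longrightarrow> s (g i) \<le> s (g j))"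
proof -
  obtain g where g: "strict_mono g" "monoseq (\<lambda>k. s (g k))" using seq_monosub[of s] by blast
  show ?thesis
  proof (cases "\<forall>i j. i \<le> j \<longrightarrow> s (g i) \<le> s (g j)")
    case False
    then have dec: "s (g j) \<le> s (g i)" if "i \<le> j" for i j using g(2) that by (auto simp: monoseq_def)
    define q where "q = (LEAST q. q \<in> range (\<lambda>k. s (g k)))"
    have "q \<in> range (\<lambda>k. s (g k))" unfolding q_def by (rule LeastI[of _ "s (g 0)"]) simp
    then obtain K where K: "s (g K) = q" by auto
    have "s (g k) = q" if "k \<ge> K" for k
    proof (rule antisym)
      show "s (g k) \<le> q" using dec[OF that] K by simp
      show "q \<le> s (g k)" unfolding q_def by (rule Least_le) simp
    qed
    then have "\<forall>i j. s (g (K + i)) \<le> s (g (K + j))" by simp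
    moreover have "strict_mono (\<lambda>k. g (K + k))" using g(1) by (simp add: strict_mono_def)
    ultimately show ?thesis by (intro exI[of _ "\<lambda>k. g (K + k)"]) simp
  qed (use g in blast)
qed

lemma monoms_mono_subseq:
  fixes f :: "nat \<Rightarrow> monom"
  shows "\<exists>g :: nat \<Rightarrow> nat. strict_mono g \<and> (\<forall>l\<in>{1..m}. \<forall>i j. i \<le> j \<longrightarrow> coef (f (g i)) l \<le> coef (f (g j)) l)"
proof (induction m)
  case 0
  show ?case using strict_mono_id by auto
next
  case (Suc m)
  then obtain g :: "nat \<Rightarrow> nat" where
    g: "strict_mono g" "\<forall>l\<in>{1..m}. \<forall>i j. i \<le> j \<longrightarrow> coef (f (g i)) l \<le> coef (f (g j)) l"
    by (elim exE conjE)
  from nat_seq_mono_subseq[of "\<lambda>k. coef (f (g k)) (Suc m)"] obtain h :: "nat \<Rightarrow> nat" where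
    h: "strict_mono h" "\<forall>i j. i \<le> j \<longrightarrow> coef (f (g (h i))) (Suc m) \<le> coef (f (g (h j))) (Suc m)"
    by (elim exE conjE)
  have "strict_mono (\<lambda>k. g (h k))" using g(1) h(1) by (simp add: strict_mono_def)
  moreover have "coef (f (g (h i))) l \<le> coef (f (g (h j))) l" if "l \<in> {1..Suc m}" "i \<le> j" for l i j
  proof (cases "l = Suc m")
    case False
    then show ?thesis using g(2)[rule_format, of l "h i" "h j"] that h(1) by (simp add: strict_mono_less_eq)
  qed (use h(2) that in simp)
  ultimately show ?case by (intro exI[of _ "\<lambda>k. g (h k)"]) simp
qed

lemma monom_divides_iff: "(\<exists>u. t = s + u) \<longleftrightarrow> (\<forall>l. coef s l \<le> coef t l)" for s t :: monom
proof
  assume *: "\<forall>l. coef s l \<le> coef t l"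
  then have "t = s + (t - s)" by (intro poly_mapping_eqI) (simp add: lookup_add lookup_minus)
  then show "\<exists>u. t = s + u" by blast
qed (auto simp: lookup_add)

text \<open>B is the set of elements minimal under divisibility. Infinitely many of them would
  contain a sequence that increases in every exponent, hence two distinct minimal elements of which
  one divides the other.\<close>

lemma dickson:
  assumes M: "M \<subseteq> monoms n"
  shows "\<exists>B\<subseteq>M. finite B \<and> (\<forall>t\<in>M. \<exists>s\<in>B. \<exists>u. t = s + u)"
proof -
  define B where "B = {t \<in> M. \<forall>s\<in>M. (\<exists>u. t = s + u) \<longrightarrow> s = t}"
  have "finite B"
  proof (rule ccontr)
    assume "infinite B"
    then obtain f :: "nat \<Rightarrow> monom" where f: "inj f" "range f \<subseteq> B"
      using infinite_countable_subset by blast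
    from monoms_mono_subseq[of n f] obtain g :: "nat \<Rightarrow> nat" where
      g: "strict_mono g" "\<forall>l\<in>{1..n}. \<forall>i j. i \<le> j \<longrightarrow> coef (f (g i)) l \<le> coef (f (g j)) l"
      by (elim exE conjE)
    have "coef (f (g 0)) l \<le> coef (f (g 1)) l" for l
    proof (cases "l \<in> {1..n}")
      case False
      have "f (g 0) \<in> monoms n" using f(2) M by (auto simp: B_def)
      then have "l \<notin> supp (f (g 0))" using False by (auto simp: monoms_def)
      then show ?thesis by (simp add: in_keys_iff)
    qed (use g(2)[rule_format, of l 0 1] in simp)
    then have "\<exists>u. f (g 1) = f (g 0) + u" by (simp add: monom_divides_iff)
    moreover have "f (g 1) \<in> B" "f (g 0) \<in> M" using f(2) by (auto simp: B_def)
    ultimately have "f (g 0) = f (g 1)" unfolding B_def by blast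
    then have "g 0 = g 1" using f(1) by (simp add: inj_eq)
    then show False using g(1) by (simp add: strict_mono_eq)
  qed
  moreover have "\<exists>s\<in>B. \<exists>u. t = s + u" if "t \<in> M" for t
    using that
  proof (induction "mdeg t" arbitrary: t rule: less_induct)
    case less
    show ?case
    proof (cases "t \<in> B")
      case True
      then show ?thesis by (intro bexI[of _ t] exI[of _ 0]) auto
    next
      case False
      then obtain s u where s: "s \<in> M" "t = s + u" "s \<noteq> t" using less.prems by (auto simp: B_def)
      then have "u \<noteq> 0" by auto
      then have "mdeg u > 0" using mdeg_eq_0_iff[of u] by blast
      then have "mdeg s < mdeg t" using s(2) by simp
      then obtain s' u' where "s' \<in> B" "s = s' + u'" using less.hyps s(1) by blast
      then show ?thesis using s(2) by (intro bexI[of _ s'] exI[of _ "u' + u"]) (simp_all add: add.assoc)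
    qed
  qed
  ultimately show ?thesis by (intro exI[of _ B]) (auto simp: B_def)
qed

section \<open>Finite generation of submodules of free modules\<close>

definition submod :: "nat \<Rightarrow> nat \<Rightarrow> 'k::field vect set \<Rightarrow> bool" where
  "submod n b K \<longleftrightarrow> K \<subseteq> Free n b \<and> 0 \<in> K \<and> (\<forall>u\<in>K. \<forall>v\<in>K. u + v \<in> K) \<and>
     (\<forall>s\<in>Pol n. \<forall>v\<in>K. (\<lambda>l. s * v l) \<in> K)"

lemma submod_Free: "submod n b K \<Longrightarrow> v \<in> K \<Longrightarrow> v \<in> Free n b"
  and submod_0: "submod n b K \<Longrightarrow> 0 \<in> K"
  and submod_add: "submod n b K \<Longrightarrow> u \<in> K \<Longrightarrow> v \<in> K \<Longrightarrow> u + v \<in> K"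
  and submod_smult: "submod n b K \<Longrightarrow> s \<in> Pol n \<Longrightarrow> v \<in> K \<Longrightarrow> (\<lambda>l. s * v l) \<in> K"
  by (auto simp: submod_def)

lemma submod_diff:
  assumes "submod n b K" "u \<in> K" "v \<in> K"
  shows "u - v \<in> K"
proof -
  have "u + (\<lambda>l. (- 1) * v l) \<in> K" using assms by (intro submod_add submod_smult) auto
  moreover have "u + (\<lambda>l. (- 1) * v l) = u - v" by (simp add: fun_eq_iff)
  ultimately show ?thesis by simp
qed

lemma submod_sum: "submod n b K \<Longrightarrow> (\<And>i. i \<in> A \<Longrightarrow> v i \<in> K) \<Longrightarrow> sum v A \<in> K"
  by (induction A rule: infinite_finite_induct) (auto simp: submod_0 submod_add)

text \<open>Generation is expressed impredicatively: \<open>K\<close> lies in every submodule containing \<open>G\<close>.\<close>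

definition generates :: "nat \<Rightarrow> nat \<Rightarrow> 'k::field vect set \<Rightarrow> 'k vect set \<Rightarrow> bool" where
  "generates n b G K \<longleftrightarrow> G \<subseteq> K \<and> (\<forall>K'. submod n b K' \<longrightarrow> G \<subseteq> K' \<longrightarrow> K \<subseteq> K')"

text \<open>Descending induction on the number c of leading zero entries. Dickson's lemma gives
  finitely many vectors whose c-th entries have leading monomials dividing all those that occur;
  reduction by them cancels the c-th entry and leaves a vector with c + 1 leading zeros.\<close>

lemma finite_generators_aux:
  fixes K :: "'k::field vect set"
  assumes K: "submod n b K" and "c \<le> b"
  shows "\<exists>G\<subseteq>K. finite G \<and> (\<forall>K'. submod n b K' \<longrightarrow> G \<subseteq> K' \<longrightarrow> {v \<in> K. \<forall>l<c. v l = 0} \<subseteq> K')"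
  using \<open>c \<le> b\<close>
proof (induction c rule: inc_induct)
  case base
  have "v = 0" if v: "v \<in> K" "\<forall>l<b. v l = 0" for v
  proof
    fix l show "v l = 0 l"
      using v submod_Free[OF K v(1)] by (cases "l < b") (simp_all add: Free_iff)
  qed
  then show ?case using submod_0 by (intro exI[of _ "{}"]) blast
next
  case (step c)
  let ?K = "\<lambda>c. {v \<in> K. \<forall>l<c. v l = 0}"
  obtain G where G: "G \<subseteq> K" "finite G" "\<And>K'. submod n b K' \<Longrightarrow> G \<subseteq> K' \<Longrightarrow> ?K (Suc c) \<subseteq> K'"
    using step.IH by blast
  define M where "M = {lead_monom (v c) | v. v \<in> ?K c \<and> v c \<noteq> 0}"
  have Pol: "v c \<in> Pol n" if "v \<in> K" for v using Free_Pol submod_Free[OF K that] .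
  have "M \<subseteq> monoms n"
  proof
    fix t assume "t \<in> M"
    then obtain v where "v \<in> K" "v c \<noteq> 0" "t = lead_monom (v c)" by (auto simp: M_def)
    then show "t \<in> monoms n" using Pol[of v] lead_monom_in[of "v c"] by (auto simp: Pol_iff)
  qed
  then obtain B where B: "B \<subseteq> M" "finite B" "\<And>t. t \<in> M \<Longrightarrow> \<exists>s\<in>B. \<exists>u. t = s + u" using dickson by metis
  have "\<forall>s\<in>B. \<exists>v. v \<in> ?K c \<and> v c \<noteq> 0 \<and> lead_monom (v c) = s" using B(1) by (auto simp: M_def)
  from bchoice[OF this] obtain w
    where w': "\<forall>s\<in>B. w s \<in> ?K c \<and> w s c \<noteq> 0 \<and> lead_monom (w s c) = s" ..
  have w: "w s \<in> ?K c" "w s c \<noteq> 0" "lead_monom (w s c) = s" if "s \<in> B" for s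
    using bspec[OF w' that] by simp_all
  have "?K c \<subseteq> K'" if K': "submod n b K'" and sub: "G \<union> w ` B \<subseteq> K'" for K'
  proof
    fix v assume "v \<in> ?K c"
    then show "v \<in> K'"
    proof (induction "lead_monom (v c)" arbitrary: v rule: wf_induct_rule[OF wf_drl_monoms[of n]])
      case 1
      show ?case
      proof (cases "v c = 0")
        case True
        then have "v \<in> ?K (Suc c)" using 1(2) by (auto simp: less_Suc_eq)
        then show ?thesis using G(3)[OF K'] sub by blast
      next
        case False
        let ?t = "lead_monom (v c)"
        have "?t \<in> M" using 1(2) False by (auto simp: M_def)
        then obtain s u where s: "s \<in> B" "?t = s + u" using B(3) by blast
        have tm: "?t \<in> monoms n" using \<open>?t \<in> M\<close> \<open>M \<subseteq> monoms n\<close> by blast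
        then have um: "u \<in> monoms n" using s(2) by simp
        define q where "q = coef (v c) ?t / coef (w s c) s"
        let ?p = "Poly_Mapping.single u q"
        let ?h = "\<lambda>l. ?p * w s l"
        have h: "?h \<in> ?K c" "?h \<in> K'"
          using w(1)[OF s(1)] submod_smult[OF K, of ?p "w s"] submod_smult[OF K', of ?p "w s"] um sub s(1) by auto
        have ws: "coef (w s c) s \<noteq> 0" using lead_monom_in[OF w(2)[OF s(1)]] w(3)[OF s(1)] by (simp add: in_keys_iff)
        have ht: "coef (?h c) ?t = coef (v c) ?t"
          using coef_monom_mult_add[of u q "w s c" s] ws by (simp add: q_def s(2) add.commute)
        have hs: "drl_less z ?t" if z: "z \<in> supp (?h c)" "z \<noteq> ?t" for z
        proof -
          obtain y where y: "z = u + y" "y \<in> supp (w s c)" using z(1) supp_monom_mult_subset by blast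
          then have "y \<noteq> s" using z(2) s(2) by (auto simp: add.commute)
          then have "drl_less y s" using lead_monom_max[OF y(2)] w(3)[OF s(1)] by simp
          then show ?thesis using y(1) s(2) by (simp add: add.commute[of s u])
        qed
        let ?v = "v - ?h"
        have vK: "?v \<in> ?K c" using submod_diff[OF K, of v ?h] 1(2) h(1) by simp
        have "?v \<in> K'"
        proof (cases "?v c = 0")
          case True
          then have "?v \<in> ?K (Suc c)" using vK by (auto simp: less_Suc_eq)
          then show ?thesis using G(3)[OF K'] sub by blast
        next
          case v0: False
          have l: "lead_monom (?v c) \<in> supp (?v c)" by (rule lead_monom_in[OF v0])
          then have ne: "lead_monom (?v c) \<noteq> ?t" using ht by (auto simp: in_keys_iff lookup_minus)
          moreover have "lead_monom (?v c) \<in> supp (v c) \<or> lead_monom (?v c) \<in> supp (?h c)"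
            using l by (auto simp: in_keys_iff lookup_minus)
          ultimately have "drl_less (lead_monom (?v c)) ?t" using lead_monom_max hs by blast
          moreover have "lead_monom (?v c) \<in> monoms n"
            using l Pol[of ?v] vK unfolding Pol_iff by blast
          ultimately show ?thesis using 1(1)[of ?v] vK tm by blast
        qed
        then have "?v + ?h \<in> K'" using h(2) submod_add[OF K'] by blast
        then show ?thesis by simp
      qed
    qed
  qed
  moreover have "G \<union> w ` B \<subseteq> K" using G(1) w(1) by blast
  moreover have "finite (G \<union> w ` B)" using G(2) B(2) by blast
  ultimately show ?case by blast
qed

lemma finite_generators:
  fixes K :: "'k::field vect set"
  assumes "submod n b K"
  shows "\<exists>G. finite G \<and> generates n b G K"
  using finite_generators_aux[OF assms, of 0] unfolding generates_def by auto

section \<open>Minimal homogeneous generators and minimal covers\<close>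

definition comb :: "nat \<Rightarrow> (nat \<Rightarrow> 'k::field vect) \<Rightarrow> 'k vect \<Rightarrow> 'k vect" where
  "comb b g v = (\<lambda>k. \<Sum>l<b. v l * g l k)"

lemma submod_comb:
  assumes "submod n b K" "\<And>l. l < b' \<Longrightarrow> g l \<in> K" "\<And>l. l < b' \<Longrightarrow> v l \<in> Pol n"
  shows "comb b' g v \<in> K"
proof -
  have "comb b' g v = (\<Sum>l<b'. (\<lambda>k. v l * g l k))"
    by (rule ext) (simp add: comb_def sum_fun_apply)
  then show ?thesis using assms by (simp only:) (intro submod_sum submod_smult; simp)
qed

lemma comb_add: "comb b g (u + v) = comb b g u + comb b g v"
  by (rule ext) (simp add: comb_def sum.distrib distrib_right)

lemma comb_smult: "comb b g (\<lambda>l. s * v l) = (\<lambda>k. s * comb b g v k)"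
  by (rule ext) (simp add: comb_def sum_distrib_left mult.assoc)

lemma comb_0 [simp]: "comb b g 0 = 0"
  by (rule ext) (simp add: comb_def)

lemma comb_unit_vec: "l < b \<Longrightarrow> comb b g (unit_vec l) = g l"
  by (rule ext) (simp add: comb_def unit_vec_def if_distrib[of "\<lambda>x. x * _"] cong: if_cong)

lemma comb_vc:
  assumes "\<And>l k. l < b \<Longrightarrow> homog (a' l - a k) (g l k)"
  shows "vc a e (comb b g v) = comb b g (vc a' e v)"
proof
  fix k
  have "hc (e - a k) (v l * g l k) = hc (e - a' l) (v l) * g l k" if "l < b" for l
    using hc_homog_mult[OF assms[OF that, of k], of "e - a k" "v l"] by (simp add: mult.commute)
  then show "vc a e (comb b g v) k = comb b g (vc a' e v) k"
    by (simp add: vc_def comb_def hc_sum)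
qed

definition graded_sub :: "(nat \<Rightarrow> int) \<Rightarrow> 'k::field vect set \<Rightarrow> bool" where
  "graded_sub a K \<longleftrightarrow> (\<forall>v\<in>K. \<forall>e. vc a e v \<in> K)"

definition hgens :: "nat \<Rightarrow> nat \<Rightarrow> (nat \<Rightarrow> int) \<Rightarrow> 'k::field vect set \<Rightarrow> nat \<Rightarrow> (nat \<Rightarrow> int) \<Rightarrow> (nat \<Rightarrow> 'k vect) \<Rightarrow> bool" where
  "hgens n b a K b' a' g \<longleftrightarrow> (\<forall>l<b'. g l \<in> free_part n b a (a' l)) \<and> generates n b (g ` {..<b'}) K"

lemma hgens_exist:
  fixes K :: "'k::field vect set"
  assumes K: "submod n b K" and gr: "graded_sub a K"
  shows "\<exists>b' a' g. hgens n b a K b' a' g"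
proof -
  obtain G where G: "finite G" "generates n b G K" using finite_generators[OF K] by blast
  have GF: "v \<in> Free n b" if "v \<in> G" for v using G(2) that submod_Free[OF K] by (auto simp: generates_def)
  have "\<forall>v\<in>G. \<exists>E. finite E \<and> v = (\<Sum>e\<in>E. vc a e v)" using vc_expand[OF GF] by metis
  then obtain E where E: "\<And>v. v \<in> G \<Longrightarrow> finite (E v)" "\<And>v. v \<in> G \<Longrightarrow> v = (\<Sum>e\<in>E v. vc a e v)" by metis
  define G' where "G' = (\<Union>v\<in>G. (\<lambda>e. vc a e v) ` E v)"
  have fin: "finite G'" using G(1) E(1) by (auto simp: G'_def)
  have gen: "generates n b G' K"
    unfolding generates_def
  proof (intro conjI allI impI)
    show "G' \<subseteq> K" using G(2) gr by (auto simp: G'_def generates_def graded_sub_def)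
    fix K' assume K': "submod n b K'" "G' \<subseteq> K'"
    have "v \<in> K'" if v: "v \<in> G" for v
    proof -
      have "(\<Sum>e\<in>E v. vc a e v) \<in> K'" using v K' by (intro submod_sum[OF K'(1)]) (auto simp: G'_def)
      then show ?thesis using E(2)[OF v] by simp
    qed
    then show "K \<subseteq> K'" using G(2) K'(1) by (auto simp: generates_def)
  qed
  have "\<forall>w\<in>G'. \<exists>e. w \<in> free_part n b a e" using free_part_vc[OF GF] by (auto simp: G'_def)
  then obtain dg where dg: "\<And>w. w \<in> G' \<Longrightarrow> w \<in> free_part n b a (dg w)" by metis
  obtain g where g: "bij_betw g {..<card G'} G'" using ex_bij_betw_nat_finite[OF fin] by (auto simp: atLeast0LessThan)
  have im: "g ` {..<card G'} = G'" using g by (simp add: bij_betw_def)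
  then have "hgens n b a K (card G') (\<lambda>l. dg (g l)) g"
    using gen dg by (auto simp: hgens_def)
  then show ?thesis by blast
qed

text \<open>In a family of least size no generator is redundant, so that no relation has an invertible coefficient.\<close>

lemma minimal_hgens_exist:
  fixes K :: "'k::field vect set"
  assumes K: "submod n b K" and gr: "graded_sub a K"
  shows "\<exists>b' a' g. hgens n b a K b' a' g \<and>
    (\<forall>v\<in>Free n b'. comb b' g v = 0 \<longrightarrow> (\<forall>l. coef (v l) 0 = 0))"
proof -
  let ?P = "\<lambda>b'. \<exists>a' g. hgens n b a K b' a' g"
  define b' where "b' = (LEAST b'. ?P b')"
  have "?P b'" unfolding b'_def using LeastI_ex[of ?P] hgens_exist[OF K gr] by blast
  then obtain a' g where g: "hgens n b a K b' a' g" by blast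
  have least: "\<not> ?P c" if "c < b'" for c using not_less_Least[of c ?P] that unfolding b'_def by blast
  have "coef (v l0) 0 = 0" if v: "v \<in> Free n b'" "comb b' g v = 0" for v l0
  proof (rule ccontr)
    assume c: "coef (v l0) 0 \<noteq> 0"
    then have l0: "l0 < b'" using v(1) by (auto simp: Free_iff not_less[symmetric])
    \<comment> \<open>The component of the relation in degree \<open>a' l0\<close> is again a
      relation, and its entry at l0 is the nonzero constant term of \<open>v l0\<close>, a unit. So
      \<open>g l0\<close> is a combination of the other generators.\<close>
    define w where "w = vc a' (a' l0) v"
    have wF: "w \<in> Free n b'" unfolding w_def by (rule Free_vc[OF v(1)])
    have "comb b' g w = vc a (a' l0) (comb b' g v)" unfolding w_def
      by (rule comb_vc[symmetric]) (use g in \<open>auto simp: hgens_def free_part_iff\<close>)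
    then have w0: "comb b' g w = 0" using v(2) by simp
    have wl0: "w l0 = Poly_Mapping.single 0 (coef (v l0) 0)"
      by (rule poly_mapping_eqI) (auto simp: w_def vc_def hc_def coef_restr lookup_single when_def)
    define q where "q = - inverse (coef (v l0) 0)"
    have rel: "g l0 = (\<lambda>k. Poly_Mapping.single 0 q * (\<Sum>l\<in>{..<b'} - {l0}. w l * g l k))"
    proof
      fix k
      have "0 = (\<Sum>l<b'. w l * g l k)" using fun_cong[OF w0, of k] by (simp add: comb_def)
      also have "\<dots> = w l0 * g l0 k + (\<Sum>l\<in>{..<b'} - {l0}. w l * g l k)"
        using l0 by (intro sum.remove) auto
      finally have "(\<Sum>l\<in>{..<b'} - {l0}. w l * g l k) = - (w l0 * g l0 k)" by (simp add: eq_neg_iff_add_eq_0 add.commute)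
      then have "Poly_Mapping.single 0 q * (\<Sum>l\<in>{..<b'} - {l0}. w l * g l k) =
          - ((Poly_Mapping.single 0 q * w l0) * g l0 k)" by (simp add: mult.assoc)
      also have "Poly_Mapping.single 0 q * w l0 = - (1 :: 'k mpol)"
        using c by (simp add: wl0 mult_single q_def single_uminus)
      finally show "g l0 k = Poly_Mapping.single 0 q * (\<Sum>l\<in>{..<b'} - {l0}. w l * g l k)" by simp
    qed
    \<comment> \<open>The last generator takes the place of the redundant one, so that the family is
      again indexed by an initial segment.\<close>
    let ?r = "\<lambda>l. if l = l0 then b' - 1 else l"
    have "hgens n b a K (b' - 1) (\<lambda>l. a' (?r l)) (\<lambda>l. g (?r l))"
      unfolding hgens_def
    proof (intro conjI allI impI)
      fix l assume "l < b' - 1"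
      then have "?r l < b'" by auto
      then show "g (?r l) \<in> free_part n b a (a' (?r l))" using g unfolding hgens_def by blast
    next
      have im: "(\<lambda>l. g (?r l)) ` {..<b' - 1} = g ` ({..<b'} - {l0})"
      proof -
        have "?r ` {..<b' - 1} = {..<b'} - {l0}"
        proof (intro equalityI subsetI)
          fix m assume m: "m \<in> {..<b'} - {l0}"
          show "m \<in> ?r ` {..<b' - 1}"
          proof (cases "m = b' - 1")
            case True
            then show ?thesis using m l0 by (intro image_eqI[of _ _ l0]) auto
          next
            case False
            then show ?thesis using m by (intro image_eqI[of _ _ m]) auto
          qed
        qed (use l0 in \<open>auto split: if_splits\<close>)
        then show ?thesis by (metis image_image)
      qed
      show "generates n b ((\<lambda>l. g (?r l)) ` {..<b' - 1}) K"
        unfolding generates_def im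
      proof (intro conjI allI impI)
        show "g ` ({..<b'} - {l0}) \<subseteq> K" using g by (auto simp: hgens_def generates_def)
        fix K' assume K': "submod n b K'" "g ` ({..<b'} - {l0}) \<subseteq> K'"
        have "(\<Sum>l\<in>{..<b'} - {l0}. (\<lambda>k. w l * g l k)) \<in> K'"
          using K'(2) Free_Pol[OF wF] by (intro submod_sum[OF K'(1)] submod_smult[OF K'(1)]) auto
        then have "(\<lambda>k. Poly_Mapping.single 0 q * (\<Sum>l\<in>{..<b'} - {l0}. (\<lambda>k. w l * g l k)) k) \<in> K'"
          by (intro submod_smult[OF K'(1)]) auto
        then have "g l0 \<in> K'" unfolding sum_fun_apply rel[symmetric] .
        then have "g ` {..<b'} \<subseteq> K'" using K'(2) by blast
        then show "K \<subseteq> K'" using g K'(1) by (auto simp: hgens_def generates_def)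
      qed
    qed
    then show False using least[of "b' - 1"] l0 by auto
  qed
  then show ?thesis using g by blast
qed

text \<open>The map that sends basis vectors to a least family of homogeneous generators. Its kernel
  is again a graded submodule without constant terms, so that the construction can be repeated on
  it.\<close>

lemma minimal_cover:
  fixes K :: "'k::field vect set"
  assumes K: "submod n b K" "graded_sub a K"
  shows "\<exists>b' a' \<phi>. (\<forall>u v. \<phi> (u + v) = \<phi> u + \<phi> v) \<and> (\<forall>s v. \<phi> (\<lambda>l. s * v l) = (\<lambda>l. s * \<phi> v l)) \<and>
    (\<forall>e v. v \<in> free_part n b' a' e \<longrightarrow> \<phi> v \<in> free_part n b a e) \<and> \<phi> ` Free n b' = K \<and>
    submod n b' {v \<in> Free n b'. \<phi> v = 0} \<and> graded_sub a' {v \<in> Free n b'. \<phi> v = 0} \<and>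
    (\<forall>v\<in>Free n b'. \<phi> v = 0 \<longrightarrow> (\<forall>l. coef (v l) 0 = 0))"
proof -
  obtain b' a' g where g: "hgens n b a K b' a' g"
    and min: "\<forall>v\<in>Free n b'. comb b' g v = 0 \<longrightarrow> (\<forall>l. coef (v l) 0 = 0)"
    using minimal_hgens_exist[OF K] by blast
  let ?\<phi> = "comb b' g"
  have gK: "g l \<in> K" if "l < b'" for l using g that by (auto simp: hgens_def generates_def)
  have vc: "vc a e (?\<phi> v) = ?\<phi> (vc a' e v)" for e v
    by (rule comb_vc) (use g in \<open>auto simp: hgens_def free_part_iff\<close>)
  have mem: "?\<phi> v \<in> K" if "v \<in> Free n b'" for v
    using submod_comb[OF K(1) gK Free_Pol[OF that]] .
  have "?\<phi> v \<in> free_part n b a e" if v: "v \<in> free_part n b' a' e" for e v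
  proof -
    have "?\<phi> v \<in> Free n b" using mem v submod_Free[OF K(1)] by (auto simp: free_part_iff)
    moreover have "vc a e (?\<phi> v) = ?\<phi> v" using vc[of e v] vc_free_part[OF v, of e] by simp
    ultimately show ?thesis using free_part_vc by metis
  qed
  moreover have "?\<phi> ` Free n b' = K"
  proof
    have "submod n b (?\<phi> ` Free n b')"
      unfolding submod_def
    proof (intro conjI ballI)
      show "?\<phi> ` Free n b' \<subseteq> Free n b" using mem submod_Free[OF K(1)] by blast
      show "0 \<in> ?\<phi> ` Free n b'" using comb_0[of b' g] Free_zero by (metis imageI)
    next
      fix u v assume "u \<in> ?\<phi> ` Free n b'" "v \<in> ?\<phi> ` Free n b'"
      then show "u + v \<in> ?\<phi> ` Free n b'" using comb_add[of b' g, symmetric] Free_add by force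
    next
      fix s :: "'k mpol" and v assume "s \<in> Pol n" "v \<in> ?\<phi> ` Free n b'"
      then show "(\<lambda>l. s * v l) \<in> ?\<phi> ` Free n b'" using comb_smult[of b' g s, symmetric] Free_smult by force
    qed
    moreover have "g ` {..<b'} \<subseteq> ?\<phi> ` Free n b'"
      using comb_unit_vec[of _ b' g] unit_vec_Free by (metis image_eqI image_subsetI lessThan_iff)
    ultimately show "K \<subseteq> ?\<phi> ` Free n b'" using g by (auto simp: hgens_def generates_def)
  qed (use mem in blast)
  moreover have "submod n b' {v \<in> Free n b'. ?\<phi> v = 0}"
    unfolding submod_def
  proof (intro conjI ballI)
    fix u v assume "u \<in> {v \<in> Free n b'. ?\<phi> v = 0}" "v \<in> {v \<in> Free n b'. ?\<phi> v = 0}"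
    then show "u + v \<in> {v \<in> Free n b'. ?\<phi> v = 0}" using comb_add[of b' g u v] Free_add[of u n b' v] by simp
  next
    fix s :: "'k mpol" and v assume "s \<in> Pol n" "v \<in> {v \<in> Free n b'. ?\<phi> v = 0}"
    then show "(\<lambda>l. s * v l) \<in> {v \<in> Free n b'. ?\<phi> v = 0}"
      using comb_smult[of b' g s v] Free_smult[of s n v b'] by (simp add: fun_eq_iff)
  qed (use comb_0[of b' g] Free_zero in blast)+
  moreover have "graded_sub a' {v \<in> Free n b'. ?\<phi> v = 0}"
    unfolding graded_sub_def by (auto simp: vc[symmetric] Free_vc)
  ultimately show ?thesis using min comb_add comb_smult
    by (intro exI[of _ b'] exI[of _ a'] exI[of _ ?\<phi>] conjI allI impI)
qed

lemma minimal_complex_exists: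
  fixes K :: "'k::field vect set"
  assumes K: "submod n b0 K" "graded_sub a0 K" "\<forall>v\<in>K. \<forall>l. coef (v l) 0 = 0"
  shows "\<exists>b a D. graded_free_complex n b a D \<and> b 0 = b0 \<and> a 0 = a0 \<and> D (Suc 0) ` Free n (b (Suc 0)) = K"
proof -
  \<comment> \<open>A state consists of rank, shifts, map to the previous module and the submodule
    to be covered next. At place 0 the map is a placeholder; afterwards the submodule is the kernel
    of the map.\<close>
  let ?P = "\<lambda>j (b, a, \<phi> :: 'k vect \<Rightarrow> 'k vect, L). submod n b L \<and> graded_sub a L \<and> (\<forall>v\<in>L. \<forall>l. coef (v l) 0 = 0) \<and>
      (j = 0 \<longrightarrow> b = b0 \<and> a = a0 \<and> L = K)"
  let ?Q = "\<lambda>j (b, a, \<phi> :: 'k vect \<Rightarrow> 'k vect, L) (b', a', \<phi>', L').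
      (\<forall>u v. \<phi>' (u + v) = \<phi>' u + \<phi>' v) \<and> (\<forall>s v. \<phi>' (\<lambda>l. s * v l) = (\<lambda>l. s * \<phi>' v l)) \<and>
      (\<forall>e v. v \<in> free_part n b' a' e \<longrightarrow> \<phi>' v \<in> free_part n b a e) \<and> \<phi>' ` Free n b' = L \<and>
      L' = {v \<in> Free n b'. \<phi>' v = 0}"
  have "\<exists>f. \<forall>j. ?P j (f j) \<and> ?Q j (f j) (f (Suc j))"
  proof (rule dependent_nat_choice)
    show "\<exists>x. ?P 0 x" using K by (intro exI[of _ "(b0, a0, id, K)"]) simp
    fix x and j :: nat assume Px: "?P j x"
    obtain b a \<phi> L where x: "x = (b, a, \<phi>, L)" by (cases x)
    obtain b' a' \<phi>' where s: "(\<forall>u v. \<phi>' (u + v) = \<phi>' u + \<phi>' v) \<and> (\<forall>s v. \<phi>' (\<lambda>l. s * v l) = (\<lambda>l. s * \<phi>' v l)) \<and>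
        (\<forall>e v. v \<in> free_part n b' a' e \<longrightarrow> \<phi>' v \<in> free_part n b a e) \<and> \<phi>' ` Free n b' = L \<and>
        submod n b' {v \<in> Free n b'. \<phi>' v = 0} \<and> graded_sub a' {v \<in> Free n b'. \<phi>' v = 0} \<and>
        (\<forall>v\<in>Free n b'. \<phi>' v = 0 \<longrightarrow> (\<forall>l. coef (v l) 0 = 0))"
      using minimal_cover[of n b L a] Px unfolding x by auto
    show "\<exists>y. ?P (Suc j) y \<and> ?Q j x y"
      using s unfolding x by (intro exI[of _ "(b', a', \<phi>', {v \<in> Free n b'. \<phi>' v = 0})"]) simp
  qed
  then obtain f where f': "\<forall>j. ?P j (f j) \<and> ?Q j (f j) (f (Suc j))" ..
  have f: "?P j (f j)" "?Q j (f j) (f (Suc j))" for j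
    using spec[OF f', of j] by (rule conjunct1, rule conjunct2)
  define b where "b j = fst (f j)" for j
  define a where "a j = fst (snd (f j))" for j
  define D where "D j = fst (snd (snd (f j)))" for j
  define L where "L j = snd (snd (snd (f j)))" for j
  have fj: "f j = (b j, a j, D j, L j)" for j by (simp add: b_def a_def D_def L_def)
  have P: "(\<forall>v\<in>L j. \<forall>l. coef (v l) 0 = 0)" "L j \<subseteq> Free n (b j)" for j
    using f(1)[of j] unfolding fj by (auto simp: submod_def)
  have P0: "b 0 = b0" "a 0 = a0" "L 0 = K" using f(1)[of 0] unfolding fj by auto
  have Q: "\<And>u v. D (Suc j) (u + v) = D (Suc j) u + D (Suc j) v"
    "\<And>s v. D (Suc j) (\<lambda>l. s * v l) = (\<lambda>l. s * D (Suc j) v l)"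
    "\<And>e v. v \<in> free_part n (b (Suc j)) (a (Suc j)) e \<Longrightarrow> D (Suc j) v \<in> free_part n (b j) (a j) e"
    "D (Suc j) ` Free n (b (Suc j)) = L j" "L (Suc j) = {v \<in> Free n (b (Suc j)). D (Suc j) v = 0}" for j
    using f(2)[of j] unfolding fj by auto
  have "graded_free_complex n b a D"
  proof
    fix j and v :: "'k vect" and l
    show "D (Suc j) v \<in> Free n (b j)" if "v \<in> Free n (b (Suc j))" using Q(4)[of j] P(2)[of j] that by blast
    show "D (Suc j) v = 0 \<longleftrightarrow> v \<in> D (Suc (Suc j)) ` Free n (b (Suc (Suc j)))" if "v \<in> Free n (b (Suc j))"
      using that unfolding Q(4) Q(5) by blast
    show "coef (D (Suc j) v l) 0 = 0" if "v \<in> Free n (b (Suc j))"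
      using that Q(4)[of j] P(1)[of j] by blast
  qed (rule Q(1) Q(2) Q(3), assumption?)+
  then show ?thesis using P0 Q(4)[of 0] by blast
qed

section \<open>Regularity\<close>

lemma quot_module_simps:
  "carrier (quot_module n I) = coset n I ` Pol n"
  "zero (quot_module n I) = I"
  "add (quot_module n I) = add (poly_ring n Quot I)"
  "smult (quot_module n I) s C = coset n I s \<otimes>\<^bsub>poly_ring n Quot I\<^esub> C"
  by (simp_all add: quot_module_def ring.defs carrier_Quot) (simp_all add: FactRing_def)

lemma Quot_add:
  "ideal I (poly_ring n) \<Longrightarrow> f \<in> Pol n \<Longrightarrow> g \<in> Pol n \<Longrightarrow>
   coset n I f \<oplus>\<^bsub>poly_ring n Quot I\<^esub> coset n I g = coset n I (f + g)"
  by (simp add: FactRing_def ideal.a_rcos_sum)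

lemma coset_eq_ideal_iff:
  fixes I :: "'k::field mpol set"
  assumes I: "ideal I (poly_ring n)" and f: "f \<in> Pol n"
  shows "coset n I f = I \<longleftrightarrow> f \<in> I"
proof -
  have "coset n I 0 = I"
    by (auto simp: a_r_coset_def r_coset_def)
  then show ?thesis using coset_eq_iff[OF I f Pol_zero] by simp
qed

lemma free_module_simps:
  "zero (free_module n b) = 0" "u \<oplus>\<^bsub>free_module n b\<^esub> v = u + v" "s \<odot>\<^bsub>free_module n b\<^esub> v = (\<lambda>l. s * v l)"
  by (simp_all add: free_module_def fun_eq_iff)

lemma res_regularity_le_iff:
  assumes "\<And>i. i \<le> len F \<Longrightarrow> 0 < rk F i"
  shows "res_regularity F \<le> m \<longleftrightarrow> (\<forall>i\<le>len F. \<forall>l<rk F i. gdeg F i l - int i \<le> m)"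
proof -
  have "max_gen_degree F i \<le> k \<longleftrightarrow> (\<forall>l<rk F i. gdeg F i l \<le> k)" if "i \<le> len F" for i k
    using assms[OF that] unfolding max_gen_degree_def by (subst Max_le_iff) auto
  then have "max_gen_degree F i - int i \<le> m \<longleftrightarrow> (\<forall>l<rk F i. gdeg F i l - int i \<le> m)" if "i \<le> len F" for i
    using that by (simp add: diff_le_eq)
  then show ?thesis unfolding res_regularity_def by (subst Max_le_iff) auto
qed

context graded_ideal
begin

text \<open>Beyond its length the resolution is continued by rank 0 and zero maps, which matches the
  convention for \<open>boundaries\<close>. Cosets in the target of the augmentation are replaced by
  chosen representatives.\<close>

lemma res_of_minimal_resolution:
  assumes F: "minimal_graded_free_resolution n I F"
  defines "b \<equiv> \<lambda>j. if j \<le> len F then rk F j else 0"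
    and "D \<equiv> \<lambda>j. if j \<le> len F then diff F j else (\<lambda>_. 0)"
    and "A \<equiv> \<lambda>v. SOME f. f \<in> Pol n \<and> aug F v = coset n I f"
  shows "graded_free_res n b (gdeg F) D I A"
proof -
  note M = F[unfolded minimal_graded_free_resolution_def]
  note R1 = M[THEN conjunct1, unfolded graded_free_resolution_def]
  note R2 = R1[THEN conjunct2] note R3 = R2[THEN conjunct2] note R4 = R3[THEN conjunct2]
  note R5 = R4[THEN conjunct2] note R6 = R5[THEN conjunct2] note R7 = R6[THEN conjunct2]
  note aug_lin = R2[THEN conjunct1, unfolded linear_map_def free_module_simps quot_module_simps]
  have aug_car: "aug F v \<in> coset n I ` Pol n" if "v \<in> Free n (rk F 0)" for v
    using aug_lin[THEN conjunct1] that by (rule funcset_mem)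
  note aug_add = aug_lin[THEN conjunct2, THEN conjunct1, rule_format]
  note aug_smult = aug_lin[THEN conjunct2, THEN conjunct2, rule_format]
  have aug_deg: "aug F v \<in> quot_part n I e" if "v \<in> cpart n F 0 e" for v e
    using R3[THEN conjunct1, rule_format, of e] that by blast
  note aug_surj = R5[THEN conjunct1, unfolded quot_module_simps]
  have aug_ker: "{v \<in> Free n (rk F 0). aug F v = I} = boundaries n F 1"
    using R6[THEN conjunct1] by (simp only: a_kernel_def' quot_module_simps)
  have d: "\<And>v. v \<in> Free n (rk F (Suc j)) \<Longrightarrow> diff F (Suc j) v \<in> Free n (rk F j)"
    "\<And>u v. u \<in> Free n (rk F (Suc j)) \<Longrightarrow> v \<in> Free n (rk F (Suc j)) \<Longrightarrow>
       diff F (Suc j) (u + v) = diff F (Suc j) u + diff F (Suc j) v"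
    "\<And>s v. s \<in> Pol n \<Longrightarrow> v \<in> Free n (rk F (Suc j)) \<Longrightarrow>
       diff F (Suc j) (\<lambda>l. s * v l) = (\<lambda>l. s * diff F (Suc j) v l)"
    "\<And>v e. v \<in> cpart n F (Suc j) e \<Longrightarrow> diff F (Suc j) v \<in> cpart n F j e"
    "{v \<in> Free n (rk F (Suc j)). diff F (Suc j) v = 0} = boundaries n F (Suc (Suc j))"
    "\<And>v l. v \<in> Free n (rk F (Suc j)) \<Longrightarrow> l < rk F j \<Longrightarrow> diff F (Suc j) v l \<in> irrelevant_ideal n"
    if "Suc j \<le> len F" for j
  proof -
    have mem: "Suc j \<in> {1..len F}" using that by simp
    note lg = R4[THEN conjunct1, THEN bspec, OF mem, unfolded linear_map_def free_module_simps diff_Suc_1]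
    note lin = lg[THEN conjunct1]
    show "\<And>v. v \<in> Free n (rk F (Suc j)) \<Longrightarrow> diff F (Suc j) v \<in> Free n (rk F j)"
      using lin[THEN conjunct1] by (rule funcset_mem)
    show "\<And>u v. u \<in> Free n (rk F (Suc j)) \<Longrightarrow> v \<in> Free n (rk F (Suc j)) \<Longrightarrow>
         diff F (Suc j) (u + v) = diff F (Suc j) u + diff F (Suc j) v"
      by (rule lin[THEN conjunct2, THEN conjunct1, rule_format])
    show "\<And>s v. s \<in> Pol n \<Longrightarrow> v \<in> Free n (rk F (Suc j)) \<Longrightarrow>
         diff F (Suc j) (\<lambda>l. s * v l) = (\<lambda>l. s * diff F (Suc j) v l)"
      by (rule lin[THEN conjunct2, THEN conjunct2, rule_format])
    show "\<And>v e. v \<in> cpart n F (Suc j) e \<Longrightarrow> diff F (Suc j) v \<in> cpart n F j e"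
      using lg[THEN conjunct2] by blast
    show "{v \<in> Free n (rk F (Suc j)). diff F (Suc j) v = 0} = boundaries n F (Suc (Suc j))"
      using R7[THEN bspec, OF mem] by (simp only: a_kernel_def' free_module_simps)
    show "\<And>v l. v \<in> Free n (rk F (Suc j)) \<Longrightarrow> l < rk F j \<Longrightarrow> diff F (Suc j) v l \<in> irrelevant_ideal n"
      using M[THEN conjunct2, THEN bspec, OF mem] unfolding diff_Suc_1 by blast
  qed
  have b0: "b 0 = rk F 0" by (simp add: b_def)
  have Free0: "Free n 0 = {0 :: 'k vect}" by (auto simp: Free_iff fun_eq_iff)
  have part0: "free_part n 0 a e = {0 :: 'k vect}" for a e by (auto simp: free_part_iff Free0)
  have bd: "D (Suc j) ` Free n (b (Suc j)) = boundaries n F (Suc j)" for j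
    by (cases "Suc j \<le> len F") (simp_all add: D_def b_def boundaries_def Free0 zero_fun_def)
  have A: "A v \<in> Pol n \<and> aug F v = coset n I (A v)" if "v \<in> Free n (b 0)" for v
    unfolding A_def by (rule someI_ex) (use aug_car[of v] that b0 in auto)
  have A_cong: "A v - f \<in> I" if "v \<in> Free n (b 0)" "f \<in> Pol n" "aug F v = coset n I f" for v f
    using coset_eq_iff[OF idl, of "A v" f] A[OF that(1)] that by simp
  show ?thesis
  proof
    fix v :: "'k vect" and j l
    assume v: "v \<in> Free n (b (Suc j))"
    show "D (Suc j) v \<in> Free n (b j)"
      using v d(1)[of j] by (cases "Suc j \<le> len F") (auto simp: b_def D_def zero_fun_def[symmetric])
    show "coef (D (Suc j) v l) 0 = 0"
    proof (cases "Suc j \<le> len F")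
      case True
      then have "l < rk F j \<Longrightarrow> diff F (Suc j) v l \<in> irrelevant_ideal n"
        using v d(6)[of j v l] by (simp add: b_def)
      moreover have "l \<ge> rk F j \<Longrightarrow> diff F (Suc j) v l = 0"
        using d(1)[of j v] True v by (simp add: b_def Free_iff)
      ultimately show ?thesis using True by (cases "l < rk F j") (auto simp: D_def irrelevant_ideal_eq)
    qed (simp add: D_def)
    show "D (Suc j) v = 0 \<longleftrightarrow> v \<in> D (Suc (Suc j)) ` Free n (b (Suc (Suc j)))"
    proof (cases "Suc j \<le> len F")
      case True
      then show ?thesis using d(5)[OF True] v bd[of "Suc j"] by (auto simp: b_def D_def)
    next
      case False
      then show ?thesis using v by (simp add: b_def D_def Free0 zero_fun_def)
    qed
  next
    fix u v :: "'k vect" and j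
    assume "u \<in> Free n (b (Suc j))" "v \<in> Free n (b (Suc j))"
    then show "D (Suc j) (u + v) = D (Suc j) u + D (Suc j) v"
      using d(2)[of j u v] by (cases "Suc j \<le> len F") (simp_all add: b_def D_def fun_eq_iff)
  next
    fix s :: "'k mpol" and v :: "'k vect" and j
    assume "s \<in> Pol n" "v \<in> Free n (b (Suc j))"
    then show "D (Suc j) (\<lambda>l. s * v l) = (\<lambda>l. s * D (Suc j) v l)"
      using d(3)[of j s v] by (cases "Suc j \<le> len F") (simp_all add: b_def D_def fun_eq_iff)
  next
    fix v :: "'k vect" and j e
    assume "v \<in> free_part n (b (Suc j)) (gdeg F (Suc j)) e"
    then show "D (Suc j) v \<in> free_part n (b j) (gdeg F j) e"
      using d(4)[of j v e] by (cases "Suc j \<le> len F") (auto simp: b_def D_def free_part_iff zero_fun_def[symmetric])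
  next
    fix v :: "'k vect" assume v: "v \<in> Free n (b 0)"
    show "A v \<in> Pol n" using A v by blast
    show "A v \<in> I \<longleftrightarrow> v \<in> D (Suc 0) ` Free n (b (Suc 0))"
      using A[OF v] coset_eq_ideal_iff[OF idl, of "A v"] aug_ker v b0 bd[of 0] by auto
  next
    fix u v :: "'k vect" assume u: "u \<in> Free n (b 0)" and v: "v \<in> Free n (b 0)"
    then show "A (u + v) - (A u + A v) \<in> I"
      using A[OF u] A[OF v] aug_add[of u v] Quot_add[OF idl, of "A u" "A v"] b0
      by (intro A_cong Free_add) auto
  next
    fix s :: "'k mpol" and v :: "'k vect" assume s: "s \<in> Pol n" and v: "v \<in> Free n (b 0)"
    then show "A (\<lambda>l. s * v l) - s * A v \<in> I"
      using A[OF v] aug_smult[of s v] Quot_mult[OF idl, of s "A v"] b0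
      by (intro A_cong Free_smult) auto
  next
    fix v :: "'k vect" and e assume v: "v \<in> free_part n (b 0) (gdeg F 0) e"
    then obtain f where "f \<in> Pol n" "homog e f" "aug F v = coset n I f"
      using aug_deg[of v e] b0 by (auto simp: quot_part_def)
    then show "\<exists>f\<in>Pol n. homog e f \<and> A v - f \<in> I"
      using A_cong[of v f] v by (auto simp: free_part_iff)
  next
    fix f :: "'k mpol" assume f: "f \<in> Pol n"
    then have "coset n I f \<in> aug F ` Free n (b 0)" unfolding b0 aug_surj by blast
    then obtain v where "v \<in> Free n (b 0)" "aug F v = coset n I f" by (metis imageE)
    then show "\<exists>v\<in>Free n (b 0). A v - f \<in> I" using A_cong f by blast
  qed
qed

text \<open>Starts from \<open>F_0 = S\<close> in degree 0, with I as the submodule to be covered,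
  embedded as the kernel in rank 1.\<close>

lemma minimal_resolution_exists: "\<exists>F. minimal_graded_free_resolution n I F"
proof -
  let ?K = "{v \<in> Free n 1. v 0 \<in> I}"
  have K: "submod n 1 ?K"
    unfolding submod_def
    by (auto simp: Free_add Free_smult ideal_zero[OF idl] ideal_add[OF idl] ideal_mult[OF idl])
  have gr: "graded_sub (\<lambda>_. 0) ?K"
    unfolding graded_sub_def by (auto simp: Free_vc) (simp add: vc_def hcI)
  \<comment> \<open>A proper graded ideal contains no polynomial with a constant term, since its
    degree 0 component would be a unit.\<close>
  have min: "coef (v l) 0 = 0" if "v \<in> ?K" for v l
  proof (cases "l = 0")
    case True
    show ?thesis
    proof (rule ccontr)
      assume "coef (v l) 0 \<noteq> 0"
      then have "hc 0 (v 0) \<in> I" "hc 0 (v 0) \<noteq> 0" "lead_monom (hc 0 (v 0)) = 0"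
        using that True hcI lead_monom_homog[OF homog_hc, of 0 "v 0"]
        by (auto simp: hc_eq_0_iff in_keys_iff)
      then have "0 \<in> lms" unfolding lms_def by (metis (mono_tags, lifting) mem_Collect_eq)
      then show False using zero_notin_lms by blast
    qed
  qed (use that in \<open>simp add: Free_iff\<close>)
  obtain b a D where C: "graded_free_complex n b a D" and b0: "b 0 = 1" "a 0 = (\<lambda>_. 0)"
    and D1: "D (Suc 0) ` Free n (b (Suc 0)) = ?K"
    using minimal_complex_exists[of n 1 ?K "\<lambda>_. 0", OF K gr] min by blast
  interpret graded_free_complex n b a D by (rule C)
  \<comment> \<open>The complex is cut just before its first zero module, so that
    \<open>F_0, ..., F_p\<close> are all nonzero as the definition of a resolution demands. Such a p
    exists because the ranks vanish beyond n.\<close>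
  define p where "p = (LEAST p. b (Suc p) = 0)"
  have bp: "b (Suc p) = 0" unfolding p_def by (rule LeastI[of _ n]) (simp add: rank_vanish)
  have pos: "0 < b i" if "i \<le> p" for i
  proof (cases i)
    case (Suc q)
    then have "q < p" using that by simp
    then show ?thesis using not_less_Least[of q "\<lambda>p. b (Suc p) = 0"] Suc by (simp add: p_def)
  qed (simp add: b0)
  define F where "F = \<lparr>len = p, rk = b, gdeg = a, diff = D, aug = (\<lambda>v. coset n I (v 0))\<rparr>"
  have Fs: "len F = p" "rk F = b" "gdeg F = a" "diff F = D" "\<And>v. aug F v = coset n I (v 0)"
    by (simp_all add: F_def)
  have Free0: "Free n 0 = {0 :: 'k vect}" by (auto simp: Free_iff fun_eq_iff)
  have bd: "boundaries n F (Suc j) = D (Suc j) ` Free n (b (Suc j))" if "j \<le> p" for j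
  proof (cases "j = p")
    case True
    then show ?thesis using bp D_0[of p] by (simp add: boundaries_def Fs Free0 zero_fun_def)
  qed (use that in \<open>simp add: boundaries_def Fs\<close>)
  have F0: "v 0 \<in> Pol n" if "v \<in> Free n (b 0)" for v :: "'k vect" using Free_Pol[OF that] .
  have "graded_free_resolution n I F"
    unfolding graded_free_resolution_def
  proof (intro conjI allI ballI impI)
    show "0 < rk F i" if "i \<le> len F" for i using pos that by (simp add: Fs)
    show "linear_map (poly_ring n) (cmod n F 0) (quot_module n I) (aug F)"
      unfolding linear_map_def free_module_simps quot_module_simps Fs
      using F0 Quot_add[OF idl] Quot_mult[OF idl] by auto
    show "aug F ` cpart n F 0 e \<subseteq> quot_part n I e" for e
      using F0 by (auto simp: Fs quot_part_def free_part_iff b0)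
    show "aug F ` Free n (rk F 0) = carrier (quot_module n I)"
    proof
      show "aug F ` Free n (rk F 0) \<subseteq> carrier (quot_module n I)"
        using F0 by (auto simp: Fs quot_module_simps)
      show "carrier (quot_module n I) \<subseteq> aug F ` Free n (rk F 0)"
      proof
        fix C assume "C \<in> carrier (quot_module n I)"
        then obtain f where f: "f \<in> Pol n" "C = coset n I f" by (auto simp: quot_module_simps)
        let ?v = "\<lambda>l::nat. if l = 0 then f else 0"
        have "?v \<in> Free n (b 0)" using f(1) by (auto simp: Free_iff b0)
        then show "C \<in> aug F ` Free n (rk F 0)" using f(2) by (intro image_eqI[of _ _ ?v]) (simp_all add: Fs)
      qed
    qed
    show "a_kernel (cmod n F 0) (quot_module n I) (aug F) = boundaries n F 1"
      using bd[of 0] D1 coset_eq_ideal_iff[OF idl] F0 b0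
      by (auto simp: a_kernel_def' quot_module_simps Fs)
  next
    fix i assume "i \<in> {1..len F}"
    then obtain j where j: "i = Suc j" "Suc j \<le> p" by (cases i) (auto simp: Fs)
    show "linear_map (poly_ring n) (cmod n F i) (cmod n F (i - 1)) (diff F i)"
      unfolding linear_map_def free_module_simps Fs j diff_Suc_1
      using D_Free D_plus D_smult by auto
    show "diff F i ` cpart n F i e \<subseteq> cpart n F (i - 1) e" for e
      unfolding Fs j diff_Suc_1 using D_degree by blast
    show "a_kernel (cmod n F i) (cmod n F (i - 1)) (diff F i) = boundaries n F (Suc i)"
    proof -
      have "D (Suc (Suc j)) ` Free n (b (Suc (Suc j))) \<subseteq> Free n (b (Suc j))" using D_Free by blast
      then show ?thesis using bd[of "Suc j"] j(2) D_exact
        unfolding a_kernel_def' free_module_simps Fs j by auto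
    qed
  qed
  moreover have "diff F i v l \<in> irrelevant_ideal n"
    if i: "i \<in> {1..len F}" and v: "v \<in> Free n (rk F i)" for i v l
  proof -
    obtain j where j: "i = Suc j" using i by (cases i) auto
    have "D i v \<in> Free n (b j)" using v j D_Free by (simp add: Fs)
    then show ?thesis using v j D_minimal Free_Pol by (auto simp: Fs irrelevant_ideal_eq)
  qed
  ultimately show ?thesis unfolding minimal_graded_free_resolution_def by blast
qed

text \<open>Only integer degrees occur in the supremum, so a real bound can be rounded down; this
  passes from arbitrary bounds to the integer bounds of the homological argument.\<close>

lemma c_inv_floor: "c_inv n I i \<le> ereal x \<Longrightarrow> c_inv n I i \<le> ereal (real_of_int \<lfloor>x\<rfloor>)"
  unfolding c_inv_le_iff' by (simp add: le_floor_iff)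

lemma r_inv_floor: "r_inv n I i \<le> ereal x \<Longrightarrow> r_inv n I i \<le> ereal (real_of_int \<lfloor>x\<rfloor>)"
  unfolding r_inv_le_iff' by (simp add: le_floor_iff)

lemma r_inv_nonneg: "0 \<le> r_inv n I i"
proof -
  have "\<forall>t\<in>monoms (n - i). t \<notin> lms \<longrightarrow> ereal (real (mdeg t)) \<le> r_inv n I i"
    using r_inv_le_iff[of i "r_inv n I i"] by simp
  then show ?thesis using zero_notin_lms monoms_zero by (metis ereal_eq_0(2) mdeg_0 of_nat_0)
qed

lemma res_regularity_eq:
  assumes F: "minimal_graded_free_resolution n I F"
    and dim: "krull_dim (poly_ring n Quot I) \<le> enat d"
    and c: "\<And>i. i < d \<Longrightarrow> c_inv n I i < \<infinity>"
  shows "ereal (real_of_int (res_regularity F)) = Max (insert (r_inv n I d) (c_inv n I ` {..<d}))" (is "_ = ?M")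
proof -
  define b D A where "b = (\<lambda>j. if j \<le> len F then rk F j else 0)"
    and "D = (\<lambda>j. if j \<le> len F then diff F j else (\<lambda>_. 0))"
    and "A = (\<lambda>v. SOME f. f \<in> Pol n \<and> aug F v = coset n I f)"
  interpret G: graded_free_res n b "gdeg F" D I A
    unfolding b_def D_def A_def by (rule res_of_minimal_resolution[OF F])
  have pos: "0 < rk F i" if "i \<le> len F" for i
    using F that by (simp add: minimal_graded_free_resolution_def graded_free_resolution_def)
  \<comment> \<open>Truncation to n changes neither side: for i \<ge> n the invariant
    \<open>c_inv n I i\<close> is -\<infinity>, and \<open>n - d'\<close> equals
    \<open>n - d\<close> in the natural numbers.\<close>
  define d' where "d' = min d n"
  have "(\<forall>i<d'. c_inv n I i \<le> z) \<longleftrightarrow> (\<forall>i<d. c_inv n I i \<le> z)" for z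
    unfolding d'_def by (auto simp: c_inv_le_iff[of _ z])
  moreover have "r_inv n I d' = r_inv n I d" by (simp add: r_inv_def J_ideal_def d'_def min_def)
  ultimately have key: "res_regularity F \<le> m \<longleftrightarrow> ?M \<le> ereal (real_of_int m)" for m
    using G.degrees_bound_iff[of d' m] dim c
    by (simp add: res_regularity_le_iff[OF pos] b_def d'_def) (auto split: if_splits)
  show ?thesis
  proof (rule antisym)
    show M: "?M \<le> ereal (real_of_int (res_regularity F))" using key by blast
    \<comment> \<open>The monomial 1 gives \<open>r\<close> \<ge> 0, which excludes -\<infinity>,
      and the regularity bounds the maximum from above; so the maximum is a real number and can be
      rounded.\<close>
    have "0 \<le> ?M" using r_inv_nonneg[of d] by (simp add: Max_ge_iff)
    then obtain x where x: "?M = ereal x" using M by (cases ?M) auto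
    have "r_inv n I d \<le> ereal x" "\<forall>i<d. c_inv n I i \<le> ereal x" using x by (simp_all flip: x)
    then have "?M \<le> ereal (real_of_int \<lfloor>x\<rfloor>)" using c_inv_floor r_inv_floor by simp
    then have "res_regularity F \<le> \<lfloor>x\<rfloor>" using key by blast
    then show "ereal (real_of_int (res_regularity F)) \<le> ?M" unfolding x by (simp add: le_floor_iff)
  qed
qed

end

theorem theorem3p6:
  fixes I :: "'k::field mpol set" and n d :: nat
  assumes "n \<ge> 1"
    and "ideal I (poly_ring n)"
    and "I \<noteq> carrier (poly_ring n)"
    and "homogeneous_ideal n I"
    and "krull_dim (poly_ring n Quot I) = enat d"
    and "\<And>i. i < d \<Longrightarrow> c_inv n I i < \<infinity>"
  shows "ereal (real_of_int (cm_regularity n I)) =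
         Max (insert (r_inv n I d) (c_inv n I ` {..<d}))"
proof -
  interpret graded_ideal n I
  proof (rule graded_ideal.intro)
    show "1 \<notin> I"
    proof
      assume "1 \<in> I"
      then have "r \<in> I" if "r \<in> Pol n" for r using ideal_mult[OF assms(2) that, of 1] by simp
      then show False using assms(2,3) ideal_Pol by blast
    qed
  qed (use assms(2,4) homogeneous_ideal_hc in auto)
  have eq: "ereal (real_of_int (res_regularity F)) = Max (insert (r_inv n I d) (c_inv n I ` {..<d}))"
    if "minimal_graded_free_resolution n I F" for F
    using res_regularity_eq[OF that] assms(5,6) by simp
  obtain F where F: "minimal_graded_free_resolution n I F" using minimal_resolution_exists by blast
  have "cm_regularity n I = res_regularity F"
    unfolding cm_regularity_def
  proof (rule the_equality)
    show "\<exists>F'. minimal_graded_free_resolution n I F' \<and> res_regularity F = res_regularity F'" using F by blast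
    \<comment> \<open>Two minimal resolutions have the same regularity because both values equal the
      same expression in \<open>c_i\<close> and \<open>r\<close>.\<close>
    show "r = res_regularity F" if "\<exists>F'. minimal_graded_free_resolution n I F' \<and> r = res_regularity F'" for r
      using that eq[OF F] eq by (metis ereal.inject of_int_eq_iff)
  qed
  then show ?thesis using eq[OF F] by simp
qed

end
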